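(* Let $N\ge1$ be an integer and $\nu\in\{0,1\}$. The vector of $q$-series $\mathsf{EI}^{(\nu)}_N(\tau)$, $\tau\in\mathbb H$, is a vector-valued quantum modular form for $\mathsf{SL}_2(\mathbb Z)$ of weight $\eta=3/2-\nu$. More precisely, for every $\gamma=\begin{pmatrix}a&b\\c&d\end{pmatrix}\in\mathsf{SL}_2(\mathbb Z)$, the function $$h_\gamma(\tau)=(c\tau+d)^{-\eta}\,\Omega^{(\nu)}(\gamma)^{-1}\,\mathsf{EI}^{(\nu)}_N\left(\tfrac{a\tau+b}{c\tau+d}\right)-\mathsf{EI}^{(\nu)}_N(\tau),\qquad\tau\in\mathbb H,$$ extends holomorphically to $\mathbb C_\gamma=\{\tau\in\mathbb C: c\tau+d\in\mathbb C\smallsetminus\mathbb R_{\le0}\}$.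
   Context: $\mathbb H$ is the upper half-plane, $q=e^{2\pi i\tau}$, and powers $(c\tau+d)^{-\eta}$ use the principal branch. $\delta_{k,n\,(2N)}=1$ if $n\equiv k\pmod{2N}$ and $0$ otherwise. For $k\in\mathbb Z/2N$, $$\mathsf{EI}[\theta^{(\nu)}_{N,k}](\tau)=\sum_{n\in\mathbb Z}\mathrm{sgn}(n)\,n^{1-\nu}\,\delta_{k,n\,(2N)}\,q^{n^2/4N},\qquad \theta^{(\nu)}_{N,k}(\tau)=\sum_{n\in\mathbb Z}n^\nu\,\delta_{k,n\,(2N)}\,q^{n^2/4N},$$ with $\mathrm{sgn}(0)=0$. Put $\widetilde G^{(0)}_N=\{0,1,\dots,N\}$, $\widetilde G^{(1)}_N=\{1,\dots,N-1\}$, $r_\nu=|\widetilde G^{(\nu)}_N|=N+1-2\nu$, $\mathsf{EI}^{(\nu)}_N=(\mathsf{EI}[\theta^{(\nu)}_{N,k}])_{k\in\widetilde G^{(\nu)}_N}$, $\boldsymbol\theta^{(\nu)}_N=(\theta^{(\nu)}_{N,k})_{k\in\widetilde G^{(\nu)}_N}$. The multiplier system $\Omega^{(\nu)}:\mathsf{SL}_2(\mathbb Z)\to\mathsf{GL}_{r_\nu}(\mathbb C)$ is the one of the theta vector, i.e. determined by $\boldsymbol\theta^{(\nu)}_N(\gamma\tau)=(c\tau+d)^{1/2+\nu}\,\Omega^{(\nu)}(\gamma)\,\boldsymbol\theta^{(\nu)}_N(\tau)$ for all $\gamma\in\mathsf{SL}_2(\mathbb Z)$ (principal branch). On generators: $\Omega^{(\nu)}_{kk'}(T)=\delta_{kk'}e^{2\pi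 i k^2/4N}$, and $\Omega^{(\nu)}_{kk'}(S)=\frac{(-i)^\nu|\mathcal O_{k'}|}{\sqrt{2iN}}\cos(\pi kk'/N)$ if $\nu=0$, with $\sin(\pi kk'/N)$ instead of $\cos(\pi kk'/N)$ if $\nu=1$, where $T=\begin{pmatrix}1&1\\0&1\end{pmatrix}$, $S=\begin{pmatrix}0&-1\\1&0\end{pmatrix}$, and $|\mathcal O_{k'}|=1$ for $k'\in\{0,N\}$ and $2$ otherwise. A holomorphic $\mathbf f:\mathbb H\to\mathbb C^r$ is a vector-valued (holomorphic) quantum modular form for $\mathsf{SL}_2(\mathbb Z)$ of weight $\eta$ and multiplier $\Omega$ if for every $\gamma$ the function $(c\tau+d)^{-\eta}\Omega(\gamma)^{-1}\mathbf f(\gamma\tau)-\mathbf f(\tau)$ extends holomorphically to $\mathbb C_\gamma$. *)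

theory Defs
  imports
    "HOL-Complex_Analysis.Complex_Analysis"
    "HOL-Number_Theory.Cong"
    "Jordan_Normal_Form.Determinant"
    "Jordan_Normal_Form.Gauss_Jordan_Elimination"
begin

(* Vectors and matrices are those of Jordan_Normal_Form, because their size N + 1 - 2 * \<nu>
   depends on N.  Both HOL-Analysis and Jordan_Normal_Form define det, hence the
   qualified name Determinant.det. *)

definition upper_half_plane :: "complex set" where
  "upper_half_plane = {\<tau>. Im \<tau> > 0}"

definition SL2Z :: "int mat set" where
  "SL2Z = {\<gamma> \<in> carrier_mat 2 2. Determinant.det \<gamma> = 1}"

definition automorphy_base :: "int mat \<Rightarrow> complex \<Rightarrow> complex" where
  "automorphy_base \<gamma> \<tau> = of_int (\<gamma> $$ (1,0)) * \<tau> + of_int (\<gamma> $$ (1,1))"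

definition moebius_action :: "int mat \<Rightarrow> complex \<Rightarrow> complex" where
  "moebius_action \<gamma> \<tau> =
     (of_int (\<gamma> $$ (0,0)) * \<tau> + of_int (\<gamma> $$ (0,1))) / automorphy_base \<gamma> \<tau>"

definition slit_domain :: "int mat \<Rightarrow> complex set" where
  "slit_domain \<gamma> = {\<tau>. automorphy_base \<gamma> \<tau> \<in> UNIV - \<real>\<^sub>\<le>\<^sub>0}"

(* k :: int stands for its residue class modulo 2N, and delta k n m for
   \<delta>_{k,n (m)}. *)

definition delta :: "int \<Rightarrow> int \<Rightarrow> nat \<Rightarrow> complex" where
  "delta k n m = (if [n = k] (mod int m) then 1 else 0)"

definition q_pow :: "complex \<Rightarrow> real \<Rightarrow> complex" where
  "q_pow \<tau> x = exp (2 * of_real pi * \<i> * \<tau> * of_real x)"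

(* In both series \<nu> is 0 or 1, so the subtraction 1 - \<nu> is not truncated;
   n ^ 0 = 1 also for n = 0. *)

definition theta :: "nat \<Rightarrow> nat \<Rightarrow> int \<Rightarrow> complex \<Rightarrow> complex" where
  "theta \<nu> N k \<tau> =
     (\<Sum>\<^sub>\<infinity>n::int. of_int (n ^ \<nu>) * delta k n (2 * N) * q_pow \<tau> (of_int (n\<^sup>2) / (4 * real N)))"

definition EI_theta :: "nat \<Rightarrow> nat \<Rightarrow> int \<Rightarrow> complex \<Rightarrow> complex" where
  "EI_theta \<nu> N k \<tau> =
     (\<Sum>\<^sub>\<infinity>n::int. of_int (sgn n) * of_int (n ^ (1 - \<nu>)) * delta k n (2 * N)
                 * q_pow \<tau> (of_int (n\<^sup>2) / (4 * real N)))"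

(* The index set is {0..N} for \<nu> = 0 and {1..N-1} for \<nu> = 1 (empty for N = 1); its element
   i + \<nu> sits at position i of the vectors below. *)

definition index_set :: "nat \<Rightarrow> nat \<Rightarrow> nat set" where
  "index_set \<nu> N = {\<nu>..N - \<nu>}"

definition theta_dim :: "nat \<Rightarrow> nat \<Rightarrow> nat" where
  "theta_dim \<nu> N = N + 1 - 2 * \<nu>"

lemma card_index_set:
  assumes "N \<ge> 1" and "\<nu> \<in> {0, 1}"
  shows "card (index_set \<nu> N) = theta_dim \<nu> N"
  using assms by (auto simp: index_set_def theta_dim_def)

lemma bij_betw_index_set:
  assumes "N \<ge> 1" and "\<nu> \<in> {0, 1}"
  shows "bij_betw (\<lambda>i. i + \<nu>) {..<theta_dim \<nu> N} (index_set \<nu> N)"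
  by (rule bij_betw_byWitness[where f' = "\<lambda>k. k - \<nu>"])
     (use assms in \<open>auto simp: index_set_def theta_dim_def\<close>)

definition theta_vec :: "nat \<Rightarrow> nat \<Rightarrow> complex \<Rightarrow> complex Matrix.vec" where
  "theta_vec \<nu> N \<tau> = Matrix.vec (theta_dim \<nu> N) (\<lambda>i. theta \<nu> N (int (i + \<nu>)) \<tau>)"

definition EI_vec :: "nat \<Rightarrow> nat \<Rightarrow> complex \<Rightarrow> complex Matrix.vec" where
  "EI_vec \<nu> N \<tau> = Matrix.vec (theta_dim \<nu> N) (\<lambda>i. EI_theta \<nu> N (int (i + \<nu>)) \<tau>)"

(* powr on complex is exp (s * Ln z) with Im (Ln z) in (-pi, pi], so it is the principal branch;
   (-1) powr s = exp (\<i> * pi * s). *)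

definition theta_multiplier :: "nat \<Rightarrow> nat \<Rightarrow> int mat \<Rightarrow> complex mat" where
  "theta_multiplier \<nu> N \<gamma> =
     (THE M. M \<in> carrier_mat (theta_dim \<nu> N) (theta_dim \<nu> N) \<and> invertible_mat M \<and>
        (\<forall>\<tau>\<in>upper_half_plane.
           theta_vec \<nu> N (moebius_action \<gamma> \<tau>) =
             (automorphy_base \<gamma> \<tau> powr of_real (1/2 + real \<nu>)) \<cdot>\<^sub>v (M *\<^sub>v theta_vec \<nu> N \<tau>)))"

definition modular_cocycle ::
    "real \<Rightarrow> (int mat \<Rightarrow> complex mat) \<Rightarrow> (complex \<Rightarrow> complex Matrix.vec)
      \<Rightarrow> int mat \<Rightarrow> complex \<Rightarrow> complex Matrix.vec" where
  "modular_cocycle \<eta> \<Omega> f \<gamma> \<tau> =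
     (automorphy_base \<gamma> \<tau> powr of_real (- \<eta>))
       \<cdot>\<^sub>v (the (mat_inverse (\<Omega> \<gamma>)) *\<^sub>v f (moebius_action \<gamma> \<tau>)) - f \<tau>"

definition holomorphic_vec_on :: "nat \<Rightarrow> (complex \<Rightarrow> complex Matrix.vec) \<Rightarrow> complex set \<Rightarrow> bool" where
  "holomorphic_vec_on r f A \<longleftrightarrow>
     (\<forall>\<tau>\<in>A. f \<tau> \<in> carrier_vec r) \<and> (\<forall>i<r. (\<lambda>\<tau>. vec_index (f \<tau>) i) holomorphic_on A)"

(* The slit domain contains the upper half-plane except when c = 0 and d = -1, where it is empty.
   Asking for an extension of the function on the upper half-plane to the union of both sets
   makes sense in that case too. *)

definition quantum_modular_form ::
    "nat \<Rightarrow> real \<Rightarrow> (int mat \<Rightarrow> complex mat) \<Rightarrow> (complex \<Rightarrow> complex Matrix.vec) \<Rightarrow> bool" where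
  "quantum_modular_form r \<eta> \<Omega> f \<longleftrightarrow>
     holomorphic_vec_on r f upper_half_plane \<and>
     (\<forall>\<gamma>\<in>SL2Z. \<exists>g. holomorphic_vec_on r g (upper_half_plane \<union> slit_domain \<gamma>) \<and>
        (\<forall>\<tau>\<in>upper_half_plane. g \<tau> = modular_cocycle \<eta> \<Omega> f \<gamma> \<tau>))"

end

theory Submission
  imports Defs "HOL-Probability.Probability"
begin

text \<open>
  Let \<open>e(z)\<close> denote \<open>exp (2 \<pi> i z)\<close>. Both vectors consist of series
  \<open>\<Sum> w(n) q^(n^2/4N)\<close> over one residue class modulo \<open>2N\<close>; the
  weights are \<open>n^\<nu>\<close> for the theta vector and \<open>sgn(n) n^(1-\<nu>)\<close>
  for the vector of Eichler integrals. The two weights have the same parity under \<open>n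
  \<mapsto> -n\<close>, and this is why one and the same matrix governs both.

  The heart of the matter is the inversion \<open>\<tau> \<mapsto> -1/\<tau>\<close>. On the
  imaginary axis both series are sums of residues of a Gaussian \<open>\<phi>\<close> times the
  kernel \<open>K(s) = (1 - e(s))/(1 + e(s)) = -i tan(\<pi> s)\<close>. The integral of
  \<open>\<phi> K\<close> along a line through the origin with small positive slope is compared
  with the integral along a horizontal line above the real axis. The residue theorem shows that
  they differ by the poles on the negative half-axis; on the horizontal line the kernel is a
  geometric series, and it turns the integral into a one-sided sum of Fourier coefficients of
  \<open>\<phi>\<close> (lemma \<open>tan_kernel_rotated_line\<close>). Reflecting \<open>s
  \<mapsto> -s\<close> gives the companion identity for the positive poles. The sum of the two
  identities is Poisson summation, which is the law for the theta series; in it the tilted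
  integral cancels. Their difference puts signs on both sides and retains the tilted integral,
  which is therefore exactly the failure of modularity of the Eichler integral (lemma
  \<open>inversion_on_imaginary_axis\<close>).

  That integral is a Mordell integral. If the slope of the line moves with \<open>\<tau>\<close>,
  namely if the direction is \<open>exp(i \<pi>/4) \<tau>^(-1/4)\<close>, then the line stays in
  the open first quadrant and the Gaussian decays along it for all \<open>\<tau>\<close> outside
  the non-positive reals. So it is holomorphic on the whole slit plane (lemma
  \<open>mordell_integral_holomorphic\<close>), and the identity theorem carries both laws from
  the imaginary axis to the upper half-plane. Collecting residue classes up to sign turns the sums
  into matrix identities. The theta functions are linearly independent, since their expansions
  have disjoint supports; hence the matrices are invertible and the multiplier system is
  determined by its defining equation.

  For a general \<open>\<gamma>\<close> the statement is carried by the predicate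
  \<open>quantum_at\<close>. The slash action is a cocycle, so extensions for
  \<open>\<gamma>1\<close> and \<open>\<gamma>2\<close> combine to one for \<open>\<gamma>1
  \<gamma>2\<close>, provided that no branch is crossed and that the slit domains fit together.
  This is the case when \<open>\<gamma>2\<close> is a translation, and also when
  \<open>\<gamma>2\<close> is the inversion and the lower row \<open>(c, d)\<close> of
  \<open>\<gamma>1\<close> has \<open>c \<ge> 0\<close> and \<open>d > 0\<close>. A Euclidean
  descent on \<open>c\<close> that uses only such products reaches every \<open>\<gamma>\<close>
  with \<open>c > 0\<close>; complex conjugation \<open>\<tau> \<mapsto> -cnj \<tau>\<close>
  exchanges \<open>c\<close> and \<open>-c\<close>, and \<open>c = 0\<close> is elementary.
\<close>

section \<open>The tangent kernel\<close>

text \<open>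
  This is \<open>-i tan(\<pi> s)\<close>. The exponential form displays the geometric series above
  the real axis.
\<close>

definition tan_kernel :: "complex \<Rightarrow> complex" where
  "tan_kernel s = (1 - exp (2 * of_real pi * \<i> * s)) / (1 + exp (2 * of_real pi * \<i> * s))"

lemma tan_kernel_minus: "tan_kernel (- s) = - tan_kernel s"
proof -
  let ?w = "exp (2 * of_real pi * \<i> * s)"
  have e: "exp (2 * of_real pi * \<i> * (- s)) = inverse ?w"
    by (simp add: exp_minus)
  have quot: "(1 - inverse w) / (1 + inverse w) = - ((1 - w) / (1 + w))" if "w \<noteq> 0" for w :: complex
  proof -
    have "(1 - inverse w) / (1 + inverse w) = (w * (1 - inverse w)) / (w * (1 + inverse w))"
      using that by simp
    also have "\<dots> = (w - 1) / (w + 1)" using that by (simp add: ring_distribs)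
    also have "\<dots> = - ((1 - w) / (1 + w))" by (metis add.commute minus_diff_eq minus_divide_left)
    finally show ?thesis .
  qed
  show ?thesis unfolding tan_kernel_def e by (rule quot) simp
qed

lemma tan_kernel_pole_iff:
  "1 + exp (2 * of_real pi * \<i> * s) = 0 \<longleftrightarrow> (\<exists>m::int. s = of_int m + 1/2)"
proof -
  have "1 + exp (2 * of_real pi * \<i> * s) = 0 \<longleftrightarrow> exp (2 * of_real pi * \<i> * s) = exp (of_real pi * \<i>)"
    unfolding exp_pi_i by (rule add_eq_0_iff)
  also have "\<dots> \<longleftrightarrow> (\<exists>m::int. 2 * of_real pi * \<i> * s = of_real pi * \<i> + (of_int (2 * m) * of_real pi) * \<i>)"
    by (simp only: exp_eq of_real_mult of_real_of_int_eq)
  also have "\<dots> \<longleftrightarrow> (\<exists>m::int. s = of_int m + 1/2)"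
  proof (intro ex_cong1)
    fix m :: int
    have "2 * of_real pi * \<i> * s - (of_real pi * \<i> + (of_int (2 * m) * of_real pi) * \<i>)
       = 2 * of_real pi * \<i> * (s - (of_int m + 1/2))"
      by (simp add: algebra_simps)
    moreover have "2 * of_real pi * \<i> \<noteq> (0::complex)" by simp
    ultimately show "(2 * of_real pi * \<i> * s = of_real pi * \<i> + (of_int (2 * m) * of_real pi) * \<i>)
      = (s = of_int m + 1/2)"
      by (metis (no_types) eq_iff_diff_eq_0 mult_eq_0_iff)
  qed
  finally show ?thesis .
qed

text \<open>
  The three cases are the places where the kernel is integrated: off the real axis, on vertical
  lines half-way between two poles, and near the origin.
\<close>

lemma tan_kernel_denominator_nonzero:
  assumes "Im s \<noteq> 0 \<or> (\<exists>m::int. Re s = of_int m) \<or> \<bar>Re s\<bar> < 1/2"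
  shows "1 + exp (2 * of_real pi * \<i> * s) \<noteq> 0"
proof
  assume "1 + exp (2 * of_real pi * \<i> * s) = 0"
  then obtain m :: int where m: "s = of_int m + 1/2" by (auto simp: tan_kernel_pole_iff)
  have I: "Im s = 0" and R: "Re s = of_int m + 1/2" using m by auto
  from assms I consider n :: int where "Re s = of_int n" | "\<bar>Re s\<bar> < 1/2" by auto
  then show False
  proof cases
    case 1
    with R have "2 * (of_int n :: real) = of_int (2 * m + 1)" by simp
    then have "2 * n = 2 * m + 1" by linarith
    then show False by presburger
  next
    case 2
    with R have "\<bar>(of_int m :: real) + 1/2\<bar> < 1/2" by simp
    then have "- 1 < (of_int m :: real)" "(of_int m :: real) < 0" by linarith+
    then have "- 1 < m" "m < 0" by linarith+
    then show False by simp
  qed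
qed

lemma tan_kernel_holomorphic:
  assumes "\<And>s. s \<in> X \<Longrightarrow> 1 + exp (2 * of_real pi * \<i> * s) \<noteq> 0"
  shows "tan_kernel holomorphic_on X"
  unfolding tan_kernel_def using assms by (intro holomorphic_intros) auto

lemma norm_tan_kernel_le_1:
  assumes "0 \<le> Re (exp (2 * of_real pi * \<i> * s))"
  shows "norm (tan_kernel s) \<le> 1"
proof -
  let ?w = "exp (2 * of_real pi * \<i> * s)"
  have "(norm (1 - w))\<^sup>2 \<le> (norm (1 + w))\<^sup>2" if "0 \<le> Re w" for w
    using that unfolding cmod_power2 by (simp add: power2_eq_square algebra_simps)
  from this[OF assms] have "norm (1 - ?w) \<le> norm (1 + ?w)" by (simp add: power2_le_iff_abs_le)
  then show ?thesis by (simp add: tan_kernel_def norm_divide divide_le_eq_1)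
qed

lemma norm_exp_2pi: "norm (exp (2 * of_real pi * \<i> * s)) = exp (- 2 * pi * Im s)"
  by simp

text \<open>
  On these strips \<open>e(s)\<close> lies in the right half-plane, so it is closer to 1 than to
  -1. The vertical lines through integers are the ones on which contours may cross the real axis.
\<close>

lemma norm_tan_kernel_le_1_vertical:
  assumes "Re s = of_int m \<or> \<bar>Re s\<bar> \<le> 1/4"
  shows "norm (tan_kernel s) \<le> 1"
proof (rule norm_tan_kernel_le_1)
  have "0 \<le> cos (2 * pi * Re s)"
  proof (cases "\<bar>Re s\<bar> \<le> 1/4")
    case True
    have "pi * \<bar>Re s\<bar> \<le> pi * (1/4)" using True pi_gt_zero by (intro mult_left_mono) auto
    then have "\<bar>2 * pi * Re s\<bar> \<le> pi / 2" by (simp add: abs_mult)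
    then show ?thesis by (intro cos_ge_zero) linarith+
  next
    case False
    then have "cos (2 * pi * Re s) = 1" using assms cos_int_2pin[of m] by (simp add: mult.commute mult.left_commute)
    then show ?thesis by simp
  qed
  then show "0 \<le> Re (exp (2 * of_real pi * \<i> * s))" by (simp add: Re_exp)
qed

lemma norm_tan_kernel_le_height:
  assumes "0 < \<delta>" "\<delta> \<le> \<bar>Im s\<bar>"
  shows "norm (tan_kernel s) \<le> 2 / (1 - exp (- 2 * pi * \<delta>))"
proof -
  have up: "norm (tan_kernel s) \<le> 2 / (1 - exp (- 2 * pi * \<delta>))" if "\<delta> \<le> Im s" for s
  proof -
    let ?w = "exp (2 * of_real pi * \<i> * s)"
    have w: "norm ?w \<le> exp (- 2 * pi * \<delta>)" using that by (simp add: norm_exp_2pi)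
    have e: "exp (- 2 * pi * \<delta>) < 1" using assms by simp
    have "norm (1 - ?w) \<le> 1 + norm ?w" using norm_triangle_ineq4[of 1 ?w] by simp
    then have n: "norm (1 - ?w) \<le> 2" using w e by linarith
    have "1 - norm ?w \<le> norm (1 + ?w)" using norm_triangle_ineq2[of 1 "- ?w"] by simp
    then have d: "1 - exp (- 2 * pi * \<delta>) \<le> norm (1 + ?w)" using w by linarith
    show ?thesis unfolding tan_kernel_def norm_divide by (rule frac_le) (use n d e in auto)
  qed
  show ?thesis
  proof (cases "0 \<le> Im s")
    case True then show ?thesis using assms up[of s] by simp
  next
    case False then show ?thesis using assms up[of "- s"] by (simp add: tan_kernel_minus)
  qed
qed

lemma residue_mult_tan_kernel:
  assumes "\<phi> holomorphic_on UNIV" and "s = of_int m + 1/2"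
  shows "residue (\<lambda>z. \<phi> z * tan_kernel z) s = - \<phi> s / (of_real pi * \<i>)"
proof -
  let ?w = "\<lambda>s. exp (2 * of_real pi * \<i> * s)"
  have ws: "?w s = -1"
    using tan_kernel_pole_iff[of s] assms(2) by (auto simp: add_eq_0_iff)
  show ?thesis
  proof (rule residue_simple'[of "ball s 1"])
    have "1 + ?w z \<noteq> 0" if "z \<in> ball s 1 - {s}" for z
    proof
      assume "1 + ?w z = 0"
      then obtain n :: int where n: "z = of_int n + 1/2" by (auto simp: tan_kernel_pole_iff)
      then have "dist s z = norm (of_int (m - n) :: complex)" using assms(2) by (simp add: dist_norm)
      then have "dist s z = \<bar>of_int (m - n)\<bar>" by (metis norm_of_int)
      with that have "\<bar>of_int (m - n) :: real\<bar> < 1" by simp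
      then have "m = n" by linarith
      with n assms(2) that show False by simp
    qed
    then show "(\<lambda>z. \<phi> z * tan_kernel z) holomorphic_on ball s 1 - {s}"
      by (intro holomorphic_on_mult tan_kernel_holomorphic holomorphic_on_subset[OF assms(1)]) auto
    have "((\<lambda>z. 1 + ?w z) has_field_derivative - (2 * of_real pi * \<i>)) (at s)"
      by (rule derivative_eq_intros refl | simp add: ws)+
    then have "((\<lambda>z. (1 + ?w z) / (z - s)) \<longlongrightarrow> - (2 * of_real pi * \<i>)) (at s)"
      by (simp add: has_field_derivative_iff ws)
    then have 1: "((\<lambda>z. inverse ((1 + ?w z) / (z - s))) \<longlongrightarrow> inverse (- (2 * of_real pi * \<i>))) (at s)"
      by (rule tendsto_inverse) simp
    have "continuous_on UNIV (\<lambda>z. \<phi> z * (1 - ?w z))"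
      by (intro continuous_intros holomorphic_on_imp_continuous_on assms)
    then have 2: "((\<lambda>z. \<phi> z * (1 - ?w z)) \<longlongrightarrow> \<phi> s * (1 - ?w s)) (at s)"
      by (simp add: continuous_on_def)
    have "(\<lambda>z. \<phi> z * tan_kernel z * (z - s))
        = (\<lambda>z. \<phi> z * (1 - ?w z) * inverse ((1 + ?w z) / (z - s)))"
      by (simp add: tan_kernel_def fun_eq_iff)
    moreover have "\<phi> s * (1 - ?w s) * inverse (- (2 * of_real pi * \<i>)) = - \<phi> s / (of_real pi * \<i>)"
      unfolding ws by (simp add: field_simps)
    ultimately show "((\<lambda>z. \<phi> z * tan_kernel z * (z - s)) \<longlongrightarrow> - \<phi> s / (of_real pi * \<i>)) (at s)"
      using tendsto_mult[OF 2 1] by simp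
  qed simp_all
qed

section \<open>Residues of the kernel along a tilted line\<close>

text \<open>
  The first side lies on the tilted line, the second one is horizontal at the height where the
  tilted line leaves the strip, and the third one is vertical. So the triangle catches exactly the
  negative poles: the positive ones are below the tilted line. Using the height \<open>M
  \<beta>\<close>, which grows with \<open>M\<close>, makes a single triangle suffice.
\<close>

lemma triangle_contour_sum:
  fixes M :: nat and \<beta> :: real
  assumes hol: "\<phi> holomorphic_on UNIV" and "0 < \<beta>" "0 < M"
  defines "F \<equiv> \<lambda>z. \<phi> z * tan_kernel z"
    and "a \<equiv> Complex (- real M) (- real M * \<beta>)" and "b \<equiv> Complex (real M) (real M * \<beta>)"
    and "c \<equiv> Complex (- real M) (real M * \<beta>)"
  shows "contour_integral (linepath a b) F + contour_integral (linepath b c) F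
       + contour_integral (linepath c a) F = - 2 * (\<Sum>j<M. \<phi> (- (of_nat j + 1/2)))"
proof -
  \<comment> \<open>A convex strip that contains the triangle and only finitely many poles.\<close>
  define S where "S = {z. - (real M + 1/2) < Re z \<and> Re z < real M + 1/2}"
  define pole where "pole = (\<lambda>m::int. of_int m + 1/2 :: complex)"
  define I where "I = {- int M..<int M}"
  define g where "g = linepath a b +++ linepath b c +++ linepath c a"
  have S_eq: "S = {z. - (real M + 1/2) < Re z} \<inter> {z. Re z < real M + 1/2}"
    by (auto simp: S_def)
  have S: "open S" "convex S" unfolding S_eq
    by (intro open_Int open_halfspace_Re_gt open_halfspace_Re_lt)
       (intro convex_Int convex_halfspace_Re_gt convex_halfspace_Re_lt)
  have inj: "inj_on pole I" by (auto simp: inj_on_def pole_def)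
  have holF: "F holomorphic_on S - pole ` I"
  proof -
    have "1 + exp (2 * of_real pi * \<i> * z) \<noteq> 0" if z: "z \<in> S - pole ` I" for z
    proof
      assume "1 + exp (2 * of_real pi * \<i> * z) = 0"
      then obtain m :: int where m: "z = of_int m + 1/2" by (auto simp: tan_kernel_pole_iff)
      then have "Re z = of_int m + 1/2" by simp
      with z have "- (real M + 1/2) < of_int m + 1/2" "of_int m + 1/2 < real M + 1/2" by (auto simp: S_def)
      then have "m \<in> I" by (auto simp: I_def)
      with m z show False by (auto simp: pole_def)
    qed
    then show ?thesis unfolding F_def
      by (intro holomorphic_on_mult tan_kernel_holomorphic holomorphic_on_subset[OF hol]) auto
  qed
  have seg: "closed_segment a b \<subseteq> {z. Im z = \<beta> * Re z}" "closed_segment b c \<subseteq> {z. Im z = real M * \<beta>}"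
      "closed_segment c a \<subseteq> {z. Re z = - real M}"
    by (auto simp: closed_segment_def a_def b_def c_def) (simp_all add: algebra_simps)
  have img: "path_image g = closed_segment a b \<union> closed_segment b c \<union> closed_segment c a"
    by (simp add: g_def path_image_join Un_assoc)
  have in_S: "path_image g \<subseteq> S"
  proof -
    have "a \<in> S" "b \<in> S" "c \<in> S" by (auto simp: S_def a_def b_def c_def)
    then show ?thesis unfolding img using S(2) by (simp add: closed_segment_subset)
  qed
  have avoid: "pole m \<notin> path_image g" for m
  proof
    assume "pole m \<in> path_image g"
    then consider "Im (pole m) = \<beta> * Re (pole m)" | "Im (pole m) = real M * \<beta>" | "Re (pole m) = - real M"
      using seg unfolding img by blast
    then have "2 * m + 1 = 0 \<or> 2 * m + 1 = - 2 * int M"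
    proof cases
      case 1
      with \<open>0 < \<beta>\<close> have "of_int m + 1/2 = (0 :: real)" by (simp add: pole_def)
      then have "of_int (2 * m + 1) = (0 :: real)" by simp
      then show ?thesis unfolding of_int_eq_0_iff by (rule disjI1)
    next
      case 2 with assms show ?thesis by (simp add: pole_def)
    next
      case 3
      then have "of_int (2 * m + 1) = (of_int (- 2 * int M) :: real)" by (simp add: pole_def)
      then show ?thesis unfolding of_int_eq_iff by (rule disjI2)
    qed
    then show False by presburger
  qed
  have g: "valid_path g" "pathfinish g = pathstart g" by (auto simp: g_def)
  have "contour_integral g F = 2 * pi * \<i> * (\<Sum>p\<in>pole ` I. winding_number g p * residue F p)"
  proof (rule Residue_theorem[OF S(1) convex_connected[OF S(2)] _ holF g(1) g(2)])
    show "path_image g \<subseteq> S - pole ` I" using in_S avoid by auto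
    show "\<forall>z. z \<notin> S \<longrightarrow> winding_number g z = 0"
      using winding_number_zero_outside[OF valid_path_imp_path[OF g(1)] S(2) g(2) _ in_S] by blast
  qed (simp add: I_def)
  also have "(\<Sum>p\<in>pole ` I. winding_number g p * residue F p)
      = (\<Sum>m\<in>I. winding_number g (pole m) * residue F (pole m))"
    using inj by (simp add: sum.reindex)
  also have "\<dots> = (\<Sum>m\<in>I. if m < 0 then - \<phi> (pole m) / (of_real pi * \<i>) else 0)"
  proof (rule sum.cong[OF refl])
    fix m assume m: "m \<in> I"
    show "winding_number g (pole m) * residue F (pole m)
        = (if m < 0 then - \<phi> (pole m) / (of_real pi * \<i>) else 0)"
    proof (cases "m < 0")
      case True
      define x where "x = real_of_int m + 1/2"
      have "x < 0" using True unfolding x_def by linarith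
      have "- real M < x" using m unfolding x_def I_def by auto
      have px: "pole m = of_real x" by (simp add: pole_def x_def)
      \<comment> \<open>The barycentric coordinates of a point of the real axis: both ends of the vertical side
           average to the real axis, hence the weight 1/2 of the lower vertex.\<close>
      have "pole m \<in> convex hull {a,b,c}"
      proof -
        define v where "v = (x / real M + 1) / 2"
        have v: "0 \<le> v" "v \<le> 1/2" using \<open>x < 0\<close> \<open>- real M < x\<close> \<open>0 < M\<close> by (auto simp: v_def field_simps)
        have "pole m = (1/2) *\<^sub>R a + v *\<^sub>R b + (1/2 - v) *\<^sub>R c"
          using \<open>0 < M\<close> by (auto simp: complex_eq_iff px a_def b_def c_def v_def field_simps)
        moreover have "0 \<le> (1/2::real)" "0 \<le> 1/2 - v" "1/2 + v + (1/2 - v) = 1" using v by auto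
        ultimately show ?thesis unfolding convex_hull_3 using v(1) by blast
      qed
      moreover have "pole m \<notin> closed_segment a b \<union> closed_segment b c \<union> closed_segment c a"
        using avoid[of m] by (simp add: img)
      ultimately have "pole m \<in> interior (convex hull {a,b,c})"
        by (simp add: interior_of_triangle)
      then have "winding_number g (pole m) = (if 0 < Im ((b - a) * cnj (b - pole m)) then 1 else -1)"
        unfolding g_def by (rule winding_number_triangle)
      moreover have "Im ((b - a) * cnj (b - pole m)) = - 2 * real M * \<beta> * x"
        by (simp add: a_def b_def px algebra_simps)
      moreover have "0 < - 2 * real M * \<beta> * x" using \<open>x < 0\<close> assms by (simp add: mult_pos_neg)
      moreover have "residue F (pole m) = - \<phi> (pole m) / (of_real pi * \<i>)"
        unfolding F_def by (rule residue_mult_tan_kernel[OF hol]) (simp add: pole_def)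
      ultimately show ?thesis using True by simp
    next
      case False
      \<comment> \<open>A positive pole is separated from the triangle by the tilted line.\<close>
      let ?H = "{z. 0 \<le> inner (Complex (- \<beta>) 1) z}"
      have H: "?H = {z. \<beta> * Re z \<le> Im z}" by (auto simp: inner_complex_def)
      have "convex ?H" by (simp add: convex_halfspace_ge)
      then have cH: "convex {z. \<beta> * Re z \<le> Im z}" by (simp only: H)
      have "a \<in> {z. \<beta> * Re z \<le> Im z}" "b \<in> {z. \<beta> * Re z \<le> Im z}" "c \<in> {z. \<beta> * Re z \<le> Im z}"
        using assms by (auto simp: a_def b_def c_def)
      then have "path_image g \<subseteq> {z. \<beta> * Re z \<le> Im z}"
        unfolding img using cH by (simp add: closed_segment_subset)
      moreover have "pole m \<notin> {z. \<beta> * Re z \<le> Im z}"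
      proof -
        have "0 < real_of_int m + 1/2" using False by simp
        then have "0 < \<beta> * (real_of_int m + 1/2)" using \<open>0 < \<beta>\<close> by (rule mult_pos_pos[rotated])
        then show ?thesis by (simp add: pole_def)
      qed
      ultimately have "winding_number g (pole m) = 0"
        using winding_number_zero_outside[OF valid_path_imp_path[OF g(1)] cH g(2)] by blast
      then show ?thesis using False by simp
    qed
  qed
  also have "\<dots> = (\<Sum>j<M. - \<phi> (- (of_nat j + 1/2)) / (of_real pi * \<i>))"
  proof -
    have "(\<Sum>m\<in>I. if m < 0 then - \<phi> (pole m) / (of_real pi * \<i>) else 0)
        = (\<Sum>m\<in>{- int M..<0}. - \<phi> (pole m) / (of_real pi * \<i>))"
      by (rule sum.mono_neutral_cong_right) (auto simp: I_def)
    also have "\<dots> = (\<Sum>j<M. - \<phi> (- (of_nat j + 1/2)) / (of_real pi * \<i>))"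
      by (rule sum.reindex_bij_witness[of _ "\<lambda>j. - int j - 1" "\<lambda>m. nat (- m - 1)"])
         (auto simp: pole_def algebra_simps)
    finally show ?thesis .
  qed
  also have "2 * pi * \<i> * \<dots> = - 2 * (\<Sum>j<M. \<phi> (- (of_nat j + 1/2)))"
    by (simp add: sum_distrib_left sum_negf field_simps flip: sum_divide_distrib)
  finally have total: "contour_integral g F = - 2 * (\<Sum>j<M. \<phi> (- (of_nat j + 1/2)))" .
  have "F contour_integrable_on g"
    by (rule contour_integrable_holomorphic_simple[OF holF _ g(1)])
       (use S(1) in_S avoid in \<open>auto intro!: open_Diff finite_imp_closed simp: I_def\<close>)
  then have "(F has_contour_integral contour_integral g F) (linepath a b +++ linepath b c +++ linepath c a)"
    unfolding g_def by (rule has_contour_integral_integral)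
  from has_chain_integral_chain_integral3[OF this] total show ?thesis by simp
qed

lemma tan_kernel_series:
  assumes "0 < Im s"
  shows "(\<lambda>m. (if m = 0 then 1 else 2) * (-1) ^ m * exp (2 * of_real pi * \<i> * of_nat m * s)) sums tan_kernel s"
proof -
  define w where "w = - exp (2 * of_real pi * \<i> * s)"
  have w: "norm w < 1" unfolding w_def norm_minus_cancel norm_exp_2pi using assms by (simp add: mult_less_0_iff)
  have "(\<lambda>m. if m = 0 then (1::complex) else 0) sums 1"
    using sums_single[of 0 "\<lambda>_. 1 :: complex"] by simp
  then have "(\<lambda>m. 2 * w ^ m - (if m = 0 then 1 else 0)) sums (2 * (1 / (1 - w)) - 1)"
    by (intro sums_diff sums_mult geometric_sums w)
  moreover have "2 * (1 / (1 - w)) - 1 = tan_kernel s"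
  proof -
    have "1 - w \<noteq> 0" using w by auto
    then show ?thesis by (simp add: tan_kernel_def w_def field_simps)
  qed
  moreover have "2 * w ^ m - (if m = 0 then 1 else 0)
      = (if m = 0 then 1 else 2) * (-1) ^ m * exp (2 * of_real pi * \<i> * of_nat m * s)" for m
  proof -
    have "exp (2 * of_real pi * \<i> * of_nat m * s) = exp (2 * of_real pi * \<i> * s) ^ m"
      by (simp add: exp_of_nat_mult[symmetric] mult_ac)
    then show ?thesis by (simp add: w_def power_minus[of "exp _"])
  qed
  ultimately show ?thesis by simp
qed

text \<open>
  Above the real axis the kernel is a geometric series in \<open>e(s)\<close>, and termwise
  integration produces Fourier coefficients of \<open>\<phi>\<close>.
\<close>

lemma tan_kernel_horizontal_integral:
  fixes \<phi> :: "complex \<Rightarrow> complex"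
  assumes h: "0 < h" and int: "integrable lborel (\<lambda>x. \<phi> (of_real x + \<i> * of_real h))"
    and c: "\<And>m. (LINT x|lborel. \<phi> (of_real x + \<i> * of_real h)
               * exp (2 * of_real pi * \<i> * of_nat m * (of_real x + \<i> * of_real h))) = c m"
  shows "(\<lambda>m. (if m = 0 then 1 else 2) * (-1) ^ m * c m) sums
      (LINT x|lborel. \<phi> (of_real x + \<i> * of_real h) * tan_kernel (of_real x + \<i> * of_real h))"
proof -
  define s where "s = (\<lambda>x::real. of_real x + \<i> * of_real h)"
  define f where "f = (\<lambda>(m::nat) x. (if m = 0 then 1 else 2) * (-1) ^ m *
      (\<phi> (s x) * exp (2 * of_real pi * \<i> * of_nat m * s x)))"
  define r where "r = exp (- 2 * pi * h)"
  have r: "0 < r" "r < 1" using h by (auto simp: r_def)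
  have norm_e: "norm (exp (2 * of_real pi * \<i> * of_nat m * s x)) = r ^ m" for m x
    by (simp add: s_def r_def exp_of_nat_mult[symmetric] mult_ac)
  have norm_f: "norm (f m x) = (if m = 0 then 1 else 2) * r ^ m * norm (\<phi> (s x))" for m x
    by (simp add: f_def norm_mult norm_power norm_e del: norm_exp_eq_Re)
  have int': "integrable lborel (\<lambda>x. \<phi> (s x))" using int by (simp add: s_def)
  have int_f: "integrable lborel (f m)" for m
  proof (rule Bochner_Integration.integrable_bound)
    show "integrable lborel (\<lambda>x. 2 * norm (\<phi> (s x)))" using int' by simp
    have "(\<lambda>x. exp (2 * of_real pi * \<i> * of_nat m * s x)) \<in> borel_measurable borel"
      unfolding s_def by (intro borel_measurable_continuous_onI continuous_intros)
    then show "f m \<in> borel_measurable lborel"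
      unfolding f_def using borel_measurable_integrable[OF int'] by (intro borel_measurable_times) auto
    have "(if m = 0 then 1 else 2) * r ^ m \<le> 2" using r by (auto intro: power_le_one)
    then have "norm (f m x) \<le> 2 * norm (\<phi> (s x))" for x
      unfolding norm_f by (rule mult_right_mono) simp
    then show "AE x in lborel. norm (f m x) \<le> norm (2 * norm (\<phi> (s x)))"
      by (intro AE_I2) (simp del: norm_conv_dist)
  qed
  have sumr: "summable (\<lambda>m. (if m = 0 then 1 else 2) * r ^ m)"
  proof (rule summable_comparison_test)
    show "\<exists>N. \<forall>n\<ge>N. norm ((if n = 0 then 1 else 2) * r ^ n) \<le> 2 * r ^ n" using r by auto
    show "summable (\<lambda>n. 2 * r ^ n)" using r by (intro summable_mult summable_geometric) simp
  qed
  have "(\<lambda>m. integral\<^sup>L lborel (f m)) sums (LINT x|lborel. (\<Sum>m. f m x))"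
  proof (rule sums_integral[OF int_f])
    show "AE x in lborel. summable (\<lambda>i. norm (f i x))"
      unfolding norm_f using sumr by (auto intro: summable_mult2)
    show "summable (\<lambda>i. LINT x|lborel. norm (f i x))"
      unfolding norm_f integral_mult_right_zero using sumr by (rule summable_mult2)
  qed
  moreover have "(\<Sum>m. f m x) = \<phi> (s x) * tan_kernel (s x)" for x
  proof -
    have "0 < Im (s x)" using h by (simp add: s_def)
    from sums_mult[OF tan_kernel_series[OF this], of "\<phi> (s x)"]
    show ?thesis by (simp add: f_def mult_ac sums_iff)
  qed
  moreover have "integral\<^sup>L lborel (f m) = (if m = 0 then 1 else 2) * (-1) ^ m * c m" for m
    unfolding f_def s_def integral_mult_right_zero c ..
  ultimately show ?thesis by (simp add: s_def)
qed

lemma contour_integral_linepath_affine: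
  fixes z u :: complex and p q :: real
  assumes "p < q"
  shows "contour_integral (linepath (z + of_real p * u) (z + of_real q * u)) f
       = integral {p..q} (\<lambda>t. f (z + of_real t * u) * u)"
proof -
  have "integral {p..q} (\<lambda>t. f (z + of_real t * u) * u)
      = contour_integral (linepath (of_real p) (of_real q)) (\<lambda>w. f (z + w * u) * u)"
    using assms by (simp add: contour_integral_linepath_Reals_eq)
  also have "\<dots> = contour_integral (linepath (z + of_real p * u) (z + of_real q * u)) f"
    by (simp add: contour_integral_integral linepath_def algebra_simps scaleR_conv_of_real)
  finally show ?thesis ..
qed

lemma truncated_integral_tendsto:
  fixes f :: "real \<Rightarrow> complex"
  assumes f: "integrable lborel f" and T: "filterlim T at_top sequentially"
  shows "(\<lambda>n. integral {- T n..T n} f) \<longlonglongrightarrow> (LINT x|lborel. f x)"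
proof -
  have "integral {- T n..T n} f = (LINT x|lborel. indicator {- T n..T n} x *\<^sub>R f x)" for n
  proof -
    have "set_integrable lborel {- T n..T n} f"
      unfolding set_integrable_def using f by (intro integrable_mult_indicator) auto
    from set_borel_integral_eq_integral(2)[OF this] show ?thesis by (simp add: set_lebesgue_integral_def)
  qed
  moreover have "(\<lambda>n. LINT x|lborel. indicator {- T n..T n} x *\<^sub>R f x) \<longlonglongrightarrow> (LINT x|lborel. f x)"
  proof (rule integral_dominated_convergence[where w = "\<lambda>x. norm (f x)"])
    have "(\<lambda>n. indicator {- T n..T n} x *\<^sub>R f x) \<longlonglongrightarrow> f x" for x
    proof (rule tendsto_eventually)
      have "eventually (\<lambda>n. \<bar>x\<bar> \<le> T n) sequentially" using T by (simp add: filterlim_at_top)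
      then show "eventually (\<lambda>n. indicator {- T n..T n} x *\<^sub>R f x = f x) sequentially"
        by eventually_elim (auto simp: indicator_def)
    qed
    then show "AE x in lborel. (\<lambda>n. indicator {- T n..T n} x *\<^sub>R f x) \<longlonglongrightarrow> f x" by simp
  qed (use f in \<open>auto simp: indicator_def\<close>)
  ultimately show ?thesis by simp
qed

lemma integrable_inverse_quadratic:
  fixes C r :: real
  assumes "r \<noteq> 0"
  shows "integrable lborel (\<lambda>t. C / (1 + (r * t)\<^sup>2))"
proof -
  have "integrable lborel (\<lambda>x::real. inverse (1 + x\<^sup>2))"
    using integrable_inverse_1_plus_square by (simp add: set_integrable_def)
  from lborel_integrable_real_affine[OF this assms, of 0]
  have "integrable lborel (\<lambda>t. C * inverse (1 + (r * t)\<^sup>2))" by simp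
  then show ?thesis by (simp add: divide_inverse)
qed

text \<open>
  Let the triangle grow. The horizontal side tends to a sum that does not depend on the height,
  because the Fourier coefficients \<open>c m\<close> do not; the truncation error is controlled
  by the decay of \<open>\<phi>\<close> in the cone, where both the horizontal tails and the
  vertical side are contained.
\<close>

lemma tan_kernel_rotated_line:
  fixes \<phi> :: "complex \<Rightarrow> complex" and u :: complex
  assumes hol: "\<phi> holomorphic_on UNIV" and u: "0 < Re u" "0 < Im u"
    and bound: "\<And>s. \<bar>Im s\<bar> * Re u \<le> Im u * \<bar>Re s\<bar> \<Longrightarrow> norm (\<phi> s) \<le> C / (1 + (Re s)\<^sup>2)"
    and int: "\<And>h. 0 < h \<Longrightarrow> integrable lborel (\<lambda>x. \<phi> (of_real x + \<i> * of_real h))"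
    and c: "\<And>h m. 0 < h \<Longrightarrow> (LINT x|lborel. \<phi> (of_real x + \<i> * of_real h)
               * exp (2 * of_real pi * \<i> * of_nat m * (of_real x + \<i> * of_real h))) = c m"
  shows "(\<lambda>j. \<phi> (- (of_nat j + 1/2))) sums
     (((\<Sum>m. (if m = 0 then 1 else 2) * (-1) ^ m * c m)
       - (LINT t|lborel. \<phi> (of_real t * u) * tan_kernel (of_real t * u) * u)) / 2)"
proof -
  define \<beta> where "\<beta> = Im u / Re u"
  have \<beta>: "0 < \<beta>" using u by (simp add: \<beta>_def)
  have u_eq: "Im u = \<beta> * Re u" using u by (simp add: \<beta>_def)
  have C: "0 \<le> C" using bound[of 0] by (auto intro: order_trans[OF norm_ge_zero])
  have cone: "norm (\<phi> s) \<le> C / (1 + (Re s)\<^sup>2)" if "\<bar>Im s\<bar> \<le> \<beta> * \<bar>Re s\<bar>" for s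
  proof (rule bound)
    have "\<bar>Im s\<bar> * Re u \<le> (\<beta> * \<bar>Re s\<bar>) * Re u" using that u by (intro mult_right_mono) auto
    then show "\<bar>Im s\<bar> * Re u \<le> Im u * \<bar>Re s\<bar>" by (simp add: u_eq mult_ac)
  qed
  \<comment> \<open>A point of the tilted line has either real part at most 1/4 or height at least
       \<open>\<beta>/4\<close>.\<close>
  define B where "B = max 1 (2 / (1 - exp (- 2 * pi * (\<beta> / 4))))"
  have B: "norm (tan_kernel s) \<le> B" if "\<bar>Re s\<bar> \<le> 1/4 \<or> \<beta> / 4 \<le> \<bar>Im s\<bar>" for s
    using that norm_tan_kernel_le_1_vertical[of s 0] norm_tan_kernel_le_height[of "\<beta>/4" s] \<beta>
    unfolding B_def by (auto simp: le_max_iff_disj)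
  have B1: "1 \<le> B" by (simp add: B_def)
  have B_line: "norm (tan_kernel (of_real t * u)) \<le> B" for t
  proof (rule B)
    show "\<bar>Re (of_real t * u)\<bar> \<le> 1/4 \<or> \<beta> / 4 \<le> \<bar>Im (of_real t * u)\<bar>"
    proof (cases "\<bar>Re (of_real t * u)\<bar> \<le> 1/4")
      case False
      then have "\<beta> * (1/4) \<le> \<beta> * \<bar>Re (of_real t * u)\<bar>" using \<beta> by (intro mult_left_mono) auto
      also have "\<dots> = \<bar>Im (of_real t * u)\<bar>" using \<beta> u by (simp add: u_eq abs_mult)
      finally show ?thesis by simp
    qed simp
  qed
  define F where "F = (\<lambda>z. \<phi> z * tan_kernel z)"
  define S where "S = (\<Sum>m. (if m = 0 then 1 else 2) * (-1) ^ m * c m)"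
  define G where "G = (LINT t|lborel. F (of_real t * u) * u)"
  define w where "w = (\<lambda>x::real. B * C / (1 + (1 * x)\<^sup>2))"
  have int_w: "integrable lborel w" unfolding w_def by (rule integrable_inverse_quadratic) simp
  have cont_\<phi>: "continuous_on X (\<lambda>x. \<phi> (g x))" if "continuous_on X g" for X :: "real set" and g
    using continuous_on_compose2[OF holomorphic_on_imp_continuous_on[OF hol] that] by simp
  have cont_K: "continuous_on X (\<lambda>x. tan_kernel (g x))"
    if "continuous_on X g" "\<And>x. x \<in> X \<Longrightarrow> Im (g x) \<noteq> 0 \<or> (\<exists>m::int. Re (g x) = of_int m)"
    for X :: "real set" and g
    unfolding tan_kernel_def using that tan_kernel_denominator_nonzero
    by (intro continuous_intros) blast+

  define a where "a = (\<lambda>M. Complex (- real M) (- real M * \<beta>))"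
  define b where "b = (\<lambda>M. Complex (real M) (real M * \<beta>))"
  define d where "d = (\<lambda>M. Complex (- real M) (real M * \<beta>))"

  have side1: "(\<lambda>M. contour_integral (linepath (a M) (b M)) F) \<longlonglongrightarrow> G"
  proof -
    define T where "T = (\<lambda>M::nat. real M / Re u)"
    have "integrable lborel (\<lambda>t. F (of_real t * u) * u)"
    proof (rule Bochner_Integration.integrable_bound)
      show "integrable lborel (\<lambda>t. (C * B * norm u) / (1 + (Re u * t)\<^sup>2))"
        using u by (intro integrable_inverse_quadratic) simp
      have "Im (of_real t * u) \<noteq> 0 \<or> (\<exists>m::int. Re (of_real t * u) = of_int m)" for t
      proof (cases "t = 0")
        case True then show ?thesis by (auto intro!: exI[of _ "0::int"])
      next
        case False then show ?thesis using u by simp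
      qed
      then show "(\<lambda>t. F (of_real t * u) * u) \<in> borel_measurable lborel"
        unfolding F_def measurable_lborel2
        by (intro borel_measurable_continuous_onI continuous_intros cont_\<phi> cont_K)
      show "AE t in lborel. norm (F (of_real t * u) * u) \<le> norm ((C * B * norm u) / (1 + (Re u * t)\<^sup>2))"
      proof (rule AE_I2)
        fix t :: real
        have "norm (\<phi> (of_real t * u)) \<le> C / (1 + (Re u * t)\<^sup>2)"
          using cone[of "of_real t * u"] \<beta> u by (simp add: u_eq abs_mult mult_ac)
        then have "norm (\<phi> (of_real t * u)) * norm (tan_kernel (of_real t * u)) * norm u
           \<le> C / (1 + (Re u * t)\<^sup>2) * B * norm u"
          using B_line[of t] C by (intro mult_right_mono mult_mono) (auto intro!: divide_nonneg_nonneg add_nonneg_nonneg)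
        then show "norm (F (of_real t * u) * u) \<le> norm ((C * B * norm u) / (1 + (Re u * t)\<^sup>2))"
          using C B1 by (simp add: F_def norm_mult abs_mult)
      qed
    qed
    moreover have "filterlim T at_top sequentially"
      unfolding T_def divide_inverse using u
      by (intro filterlim_at_top_mult_tendsto_pos[OF tendsto_const _ filterlim_real_sequentially]) auto
    ultimately have "(\<lambda>M. integral {- T M..T M} (\<lambda>t. F (of_real t * u) * u)) \<longlonglongrightarrow> G"
      unfolding G_def by (rule truncated_integral_tendsto)
    moreover have "eventually (\<lambda>M. integral {- T M..T M} (\<lambda>t. F (of_real t * u) * u)
        = contour_integral (linepath (a M) (b M)) F) sequentially"
    proof (intro eventually_sequentiallyI[of 1])
      fix M :: nat assume "1 \<le> M"
      then have "0 < T M" using u by (simp add: T_def)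
      then have "contour_integral (linepath (0 + of_real (- T M) * u) (0 + of_real (T M) * u)) F
         = integral {- T M..T M} (\<lambda>t. F (0 + of_real t * u) * u)"
        by (intro contour_integral_linepath_affine) simp
      moreover have "0 + of_real (- T M) * u = a M" "0 + of_real (T M) * u = b M"
        using u by (auto simp: complex_eq_iff a_def b_def T_def u_eq)
      ultimately show "integral {- T M..T M} (\<lambda>t. F (of_real t * u) * u)
         = contour_integral (linepath (a M) (b M)) F" by simp
    qed
    ultimately show ?thesis by (rule Lim_transform_eventually)
  qed

  have side2: "(\<lambda>M. contour_integral (linepath (b M) (d M)) F) \<longlonglongrightarrow> - S"
  proof -
    define H where "H = (\<lambda>(M::nat) x. F (of_real x + \<i> * of_real (real M * \<beta>)))"
    define tail where "tail = (\<lambda>M::nat. LINT x|lborel. indicator (- {- real M..real M}) x * w x)"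
    have H: "integrable lborel (H M)" "(LINT x|lborel. H M x) = S" if "1 \<le> M" for M
    proof -
      have h: "0 < real M * \<beta>" using that \<beta> by simp
      from sums_unique[OF tan_kernel_horizontal_integral[OF h int[OF h] c[OF h]]]
      show "(LINT x|lborel. H M x) = S" by (simp add: H_def S_def F_def)
      have Kc: "(\<lambda>x. tan_kernel (of_real x + \<i> * of_real (real M * \<beta>))) \<in> borel_measurable lborel"
        unfolding measurable_lborel2 using h
        by (intro borel_measurable_continuous_onI continuous_intros cont_K) auto
      show "integrable lborel (H M)"
      proof (rule Bochner_Integration.integrable_bound)
        show "integrable lborel (\<lambda>x. norm (\<phi> (of_real x + \<i> * of_real (real M * \<beta>))) * B)"
          using int[OF h] by simp
        show "H M \<in> borel_measurable lborel"
          unfolding H_def F_def using borel_measurable_integrable[OF int[OF h]] Kc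
          by (intro borel_measurable_times) auto
        have "norm (tan_kernel (of_real x + \<i> * of_real (real M * \<beta>))) \<le> B" for x
        proof (rule B)
          have "\<beta> * 1 \<le> \<beta> * real M" using that \<beta> by (intro mult_left_mono) auto
          then show "\<bar>Re (of_real x + \<i> * of_real (real M * \<beta>))\<bar> \<le> 1/4
              \<or> \<beta> / 4 \<le> \<bar>Im (of_real x + \<i> * of_real (real M * \<beta>))\<bar>"
            using \<beta> by (simp add: mult.commute)
        qed
        then have "norm (H M x) \<le> norm (\<phi> (of_real x + \<i> * of_real (real M * \<beta>))) * B" for x
          unfolding H_def F_def norm_mult by (rule mult_left_mono) simp
        then show "AE x in lborel. norm (H M x) \<le> norm (norm (\<phi> (of_real x + \<i> * of_real (real M * \<beta>))) * B)"
          unfolding real_norm_def by (intro AE_I2 order_trans[OF _ abs_ge_self])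
      qed
    qed
    have bd: "norm (contour_integral (linepath (b M) (d M)) F - (- S)) \<le> tail M" if "1 \<le> M" for M
    proof -
      have "contour_integral (linepath (\<i> * of_real (real M * \<beta>) + of_real (- real M) * 1)
               (\<i> * of_real (real M * \<beta>) + of_real (real M) * 1)) F
          = integral {- real M..real M} (\<lambda>t. F (\<i> * of_real (real M * \<beta>) + of_real t * 1) * 1)"
        using that by (intro contour_integral_linepath_affine) simp
      moreover have "\<i> * of_real (real M * \<beta>) + of_real (- real M) * 1 = d M"
          "\<i> * of_real (real M * \<beta>) + of_real (real M) * 1 = b M"
        by (auto simp: complex_eq_iff d_def b_def)
      ultimately have "contour_integral (linepath (d M) (b M)) F = integral {- real M..real M} (H M)"
        by (simp add: H_def add.commute)
      also have "\<dots> = (LINT x|lborel. indicator {- real M..real M} x *\<^sub>R H M x)"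
      proof -
        have "set_integrable lborel {- real M..real M} (H M)"
          unfolding set_integrable_def using H(1)[OF that] by (intro integrable_mult_indicator) auto
        from set_borel_integral_eq_integral(2)[OF this] show ?thesis by (simp add: set_lebesgue_integral_def)
      qed
      finally have "contour_integral (linepath (b M) (d M)) F - (- S)
         = (LINT x|lborel. H M x) - (LINT x|lborel. indicator {- real M..real M} x *\<^sub>R H M x)"
        using H(2)[OF that] contour_integral_reversepath[of "linepath (d M) (b M)" F] by simp
      also have "\<dots> = (LINT x|lborel. H M x - indicator {- real M..real M} x *\<^sub>R H M x)"
        using H(1)[OF that]
        by (intro Bochner_Integration.integral_diff[symmetric] integrable_mult_indicator) auto
      also have "norm \<dots> \<le> tail M"
        unfolding tail_def
      proof (rule Bochner_Integration.integral_norm_bound_integral)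
        show "integrable lborel (\<lambda>x. H M x - indicator {- real M..real M} x *\<^sub>R H M x)"
          using H(1)[OF that] by (intro Bochner_Integration.integrable_diff integrable_mult_indicator) auto
        show "integrable lborel (\<lambda>x. indicator (- {- real M..real M}) x * w x)"
          using integrable_mult_indicator[OF _ int_w, of "- {- real M..real M}"] by simp
        fix x :: real
        show "norm (H M x - indicator {- real M..real M} x *\<^sub>R H M x) \<le> indicator (- {- real M..real M}) x * w x"
        proof (cases "x \<in> {- real M..real M}")
          case False
          then have x: "real M \<le> \<bar>x\<bar>" by auto
          let ?s = "of_real x + \<i> * of_real (real M * \<beta>)"
          have "\<bar>Im ?s\<bar> \<le> \<beta> * \<bar>Re ?s\<bar>" using x \<beta> by (simp add: abs_mult mult.commute)
          then have "norm (\<phi> ?s) \<le> C / (1 + (Re ?s)\<^sup>2)" by (rule cone)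
          then have 1: "norm (\<phi> ?s) \<le> C / (1 + x\<^sup>2)" by simp
          have 2: "norm (tan_kernel ?s) \<le> B"
          proof (rule B)
            have "\<beta> * 1 \<le> \<beta> * real M" using that \<beta> by (intro mult_left_mono) auto
            then show "\<bar>Re ?s\<bar> \<le> 1/4 \<or> \<beta> / 4 \<le> \<bar>Im ?s\<bar>" using \<beta> by (simp add: mult.commute)
          qed
          have "norm (\<phi> ?s) * norm (tan_kernel ?s) \<le> C / (1 + x\<^sup>2) * B"
            using 1 2 C by (intro mult_mono) (auto intro!: divide_nonneg_nonneg add_nonneg_nonneg)
          then show ?thesis using False by (simp add: H_def F_def w_def norm_mult mult_ac)
        qed simp
      qed
      finally show ?thesis .
    qed
    have "tail \<longlonglongrightarrow> integral\<^sup>L lborel (\<lambda>x::real. 0::real)"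
      unfolding tail_def
    proof (rule integral_dominated_convergence[where w = "\<lambda>x. norm (w x)"])
      have "(\<lambda>M. indicator (- {- real M..real M}) x * w x) \<longlonglongrightarrow> 0" for x
      proof (rule tendsto_eventually)
        have "eventually (\<lambda>M. \<bar>x\<bar> \<le> real M) sequentially"
          using filterlim_real_sequentially by (simp add: filterlim_at_top)
        then show "eventually (\<lambda>M. indicator (- {- real M..real M}) x * w x = 0) sequentially"
          by eventually_elim (auto simp: indicator_def)
      qed
      then show "AE x in lborel. (\<lambda>M. indicator (- {- real M..real M}) x * w x) \<longlonglongrightarrow> 0" by simp
    qed (use int_w in \<open>auto simp: indicator_def intro!: borel_measurable_times borel_measurable_indicator\<close>)
    then have "tail \<longlonglongrightarrow> 0" by simp
    then have "(\<lambda>M. contour_integral (linepath (b M) (d M)) F - (- S)) \<longlonglongrightarrow> 0"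
      by (rule Lim_null_comparison[rotated]) (use bd in \<open>auto intro!: eventually_sequentiallyI[of 1]\<close>)
    then show ?thesis by (rule LIM_zero_cancel)
  qed

  have side3: "(\<lambda>M. contour_integral (linepath (d M) (a M)) F) \<longlonglongrightarrow> 0"
  proof (rule Lim_null_comparison)
    show "eventually (\<lambda>M. norm (contour_integral (linepath (d M) (a M)) F)
        \<le> C * (2 * \<beta>) * (real M / (1 + (real M)\<^sup>2))) sequentially"
    proof (intro eventually_sequentiallyI[of 1])
      fix M :: nat assume "1 \<le> M"
      have seg: "Re s = - real M \<and> \<bar>Im s\<bar> \<le> \<beta> * \<bar>Re s\<bar>" if "s \<in> closed_segment (d M) (a M)" for s
      proof -
        from that obtain t where t: "0 \<le> t" "t \<le> 1" "s = (1 - t) *\<^sub>R d M + t *\<^sub>R a M"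
          by (auto simp: closed_segment_def)
        have Re: "Re s = - real M" by (simp add: t a_def d_def algebra_simps)
        have "Im s = (1 - 2 * t) * (real M * \<beta>)" by (simp add: t a_def d_def algebra_simps)
        then have "\<bar>Im s\<bar> = \<bar>1 - 2 * t\<bar> * (real M * \<beta>)" using \<beta> by (simp add: abs_mult)
        also have "\<dots> \<le> 1 * (real M * \<beta>)" using t \<beta> by (intro mult_right_mono) auto
        finally show ?thesis using Re by (simp add: mult.commute)
      qed
      have "F contour_integrable_on linepath (d M) (a M)"
      proof (rule contour_integrable_continuous_linepath)
        have "1 + exp (2 * of_real pi * \<i> * s) \<noteq> 0" if "s \<in> closed_segment (d M) (a M)" for s
          by (rule tan_kernel_denominator_nonzero) (use seg[OF that] in \<open>auto intro!: exI[of _ "- int M"]\<close>)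
        then show "continuous_on (closed_segment (d M) (a M)) F"
          unfolding F_def
          by (intro continuous_on_mult holomorphic_on_imp_continuous_on tan_kernel_holomorphic
               holomorphic_on_subset[OF hol]) auto
      qed
      then have "norm (contour_integral (linepath (d M) (a M)) F) \<le> C / (1 + (real M)\<^sup>2) * norm (a M - d M)"
      proof (rule contour_integral_bound_linepath)
        show "0 \<le> C / (1 + (real M)\<^sup>2)" using C by (intro divide_nonneg_nonneg) auto
        fix s assume s: "s \<in> closed_segment (d M) (a M)"
        have "norm (\<phi> s) \<le> C / (1 + (real M)\<^sup>2)" using cone[OF conjunct2[OF seg[OF s]]] conjunct1[OF seg[OF s]] by simp
        moreover have "norm (tan_kernel s) \<le> 1"
          using norm_tan_kernel_le_1_vertical[of s "- int M"] seg[OF s] by simp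
        ultimately have "norm (\<phi> s) * norm (tan_kernel s) \<le> C / (1 + (real M)\<^sup>2) * 1"
          using C by (intro mult_mono) (auto intro!: divide_nonneg_nonneg add_nonneg_nonneg)
        then show "norm (F s) \<le> C / (1 + (real M)\<^sup>2)" by (simp add: F_def norm_mult)
      qed
      moreover have "norm (a M - d M) = 2 * (real M * \<beta>)"
      proof -
        have "a M - d M = - \<i> * of_real (2 * (real M * \<beta>))" by (simp add: complex_eq_iff a_def d_def)
        then show ?thesis using \<beta> by (simp add: norm_mult)
      qed
      ultimately show "norm (contour_integral (linepath (d M) (a M)) F)
          \<le> C * (2 * \<beta>) * (real M / (1 + (real M)\<^sup>2))" by (simp add: mult_ac)
    qed
    have "(\<lambda>M. real M / (1 + (real M)\<^sup>2)) \<longlonglongrightarrow> 0" by real_asymp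
    then show "(\<lambda>M. C * (2 * \<beta>) * (real M / (1 + (real M)\<^sup>2))) \<longlonglongrightarrow> 0"
      by (rule tendsto_mult_right_zero)
  qed

  have "(\<lambda>M. contour_integral (linepath (a M) (b M)) F + contour_integral (linepath (b M) (d M)) F
       + contour_integral (linepath (d M) (a M)) F) \<longlonglongrightarrow> G + - S + 0"
    by (intro tendsto_add side1 side2 side3)
  moreover have "eventually (\<lambda>M. contour_integral (linepath (a M) (b M)) F
       + contour_integral (linepath (b M) (d M)) F + contour_integral (linepath (d M) (a M)) F
       = - 2 * (\<Sum>j<M. \<phi> (- (of_nat j + 1/2)))) sequentially"
    unfolding a_def b_def d_def F_def
    by (intro eventually_sequentiallyI[of 1] triangle_contour_sum[OF hol \<beta>]) simp
  ultimately have "(\<lambda>M. - 2 * (\<Sum>j<M. \<phi> (- (of_nat j + 1/2)))) \<longlonglongrightarrow> G + - S + 0"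
    by (rule Lim_transform_eventually)
  from tendsto_mult[OF tendsto_const[of "- 1/2 :: complex"] this]
  have "(\<lambda>M. - 1/2 * (- 2 * (\<Sum>j<M. \<phi> (- (of_nat j + 1/2))))) \<longlonglongrightarrow> - 1/2 * (G + - S + 0)" .
  moreover have "- 1/2 * (G + - S + 0) = (S - G) / 2" by (simp add: field_simps)
  moreover have "(\<lambda>M. - 1/2 * (- 2 * (\<Sum>j<M. \<phi> (- (of_nat j + 1/2))))) = (\<lambda>M. \<Sum>j<M. \<phi> (- (of_nat j + 1/2)))"
    by simp
  ultimately have "(\<lambda>j. \<phi> (- (of_nat j + 1/2))) sums ((S - G) / 2)"
    unfolding sums_def by (simp only:)
  then show ?thesis by (simp add: S_def G_def F_def)
qed

section \<open>Fourier transforms of Gaussians along horizontal lines\<close>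

text \<open>
  Integrable majorants of the form \<open>C / (1 + t^2)\<close> are enough everywhere below, and
  they are stable under the linear substitutions that occur.
\<close>

lemma gaussian_growth_bound:
  fixes a b c :: real
  assumes "0 < a" "0 \<le> b"
  obtains C where "\<And>t. (1 + \<bar>t\<bar>) * exp (- a * t\<^sup>2 + b * \<bar>t\<bar> + c) \<le> C / (1 + t\<^sup>2)" "0 \<le> C"
proof
  \<comment> \<open>Half of the quadratic term absorbs \<open>b |t|\<close>, the other half absorbs the
       polynomial.\<close>
  define C where "C = 16 / a\<^sup>2 * exp (a / 2 + b\<^sup>2 / (2 * a) + c)"
  show "0 \<le> C" by (simp add: C_def)
  fix t :: real
  define s where "s = 1 + t\<^sup>2"
  have s: "1 \<le> s" by (simp add: s_def)
  have "0 \<le> (\<bar>t\<bar> - b / a)\<^sup>2" by simp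
  then have "2 * (b / a) * \<bar>t\<bar> \<le> t\<^sup>2 + (b / a)\<^sup>2"
    unfolding power2_diff power2_abs by (simp only: mult_ac)
  then have "a / 2 * (2 * (b / a) * \<bar>t\<bar>) \<le> a / 2 * (t\<^sup>2 + (b / a)\<^sup>2)"
    using assms by (intro mult_left_mono) auto
  moreover have "a / 2 * (2 * (b / a) * \<bar>t\<bar>) = b * \<bar>t\<bar>" using assms by simp
  moreover have "a / 2 * (t\<^sup>2 + (b / a)\<^sup>2) = a / 2 * t\<^sup>2 + b\<^sup>2 / (2 * a)"
    using assms by (simp add: field_simps power2_eq_square)
  ultimately have q: "b * \<bar>t\<bar> \<le> a / 2 * t\<^sup>2 + b\<^sup>2 / (2 * a)" by (simp only:)
  have "(1 + \<bar>t\<bar>) * s \<le> 2 * s\<^sup>2"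
  proof -
    have "0 \<le> (\<bar>t\<bar> - 1)\<^sup>2" by simp
    then have t: "2 * \<bar>t\<bar> \<le> t\<^sup>2 + 1" by (simp add: power2_diff)
    have aux: "1 + x \<le> 2 * (1 + y)" if "2 * x \<le> y + 1" "0 \<le> y" for x y :: real
      using that by argo
    have "1 + \<bar>t\<bar> \<le> 2 * s" unfolding s_def by (rule aux[OF t zero_le_power2])
    then have "(1 + \<bar>t\<bar>) * s \<le> (2 * s) * s" using s by (intro mult_right_mono) auto
    then show ?thesis by (simp add: power2_eq_square)
  qed
  also have "\<dots> \<le> 16 / a\<^sup>2 * exp (a / 2 * s)"
  proof -
    have "1 + a / 2 * s + (a / 2 * s)\<^sup>2 / 2 \<le> exp (a / 2 * s)"
      by (rule exp_lower_Taylor_quadratic) (use s assms in auto)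
    then have "(a / 2 * s)\<^sup>2 / 2 \<le> exp (a / 2 * s)" using s assms
      by (smt (verit) divide_nonneg_nonneg mult_nonneg_nonneg)
    then have "16 / a\<^sup>2 * ((a / 2 * s)\<^sup>2 / 2) \<le> 16 / a\<^sup>2 * exp (a / 2 * s)"
      by (rule mult_left_mono) simp
    then show ?thesis using assms by (simp add: power2_eq_square field_simps)
  qed
  finally have "(1 + \<bar>t\<bar>) * s \<le> 16 / a\<^sup>2 * exp (a / 2 * s)" .
  then have "(1 + \<bar>t\<bar>) * s * exp (- a * t\<^sup>2 + b * \<bar>t\<bar> + c)
      \<le> 16 / a\<^sup>2 * exp (a / 2 * s) * exp (- a * t\<^sup>2 + b * \<bar>t\<bar> + c)"
    by (rule mult_right_mono) simp
  also have "\<dots> = 16 / a\<^sup>2 * exp (a / 2 * s - a * t\<^sup>2 + b * \<bar>t\<bar> + c)"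
    by (simp add: exp_add[symmetric] exp_diff[symmetric] algebra_simps)
  also have "\<dots> \<le> C"
    unfolding C_def using q by (intro mult_left_mono) (auto simp: s_def algebra_simps)
  finally show "(1 + \<bar>t\<bar>) * exp (- a * t\<^sup>2 + b * \<bar>t\<bar> + c) \<le> C / (1 + t\<^sup>2)"
    using s by (simp add: s_def[symmetric] field_simps)
qed

abbreviation gaussian_wave :: "real \<Rightarrow> real \<Rightarrow> complex \<Rightarrow> complex" where
  "gaussian_wave A l s \<equiv> exp (- of_real A * s\<^sup>2) * exp (\<i> * of_real l * s)"

text \<open>
  On a horizontal line the exponent is a real quadratic plus an imaginary linear term, so the
  integral is a value of the characteristic function of the normal distribution and no contour has
  to be moved.
\<close>

lemma gaussian_fourier:
  fixes A l h :: real
  assumes "0 < A"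
  shows "(LINT x|lborel. gaussian_wave A l (of_real x + \<i> * of_real h))
       = of_real (sqrt (pi / A) * exp (- l\<^sup>2 / (4 * A)))"
proof -
  define r where "r = sqrt (2 * A)"
  have r: "0 < r" "r\<^sup>2 = 2 * A" using assms by (auto simp: r_def)
  define t where "t = (l - 2 * A * h) / r"
  have char: "(LINT x|lborel. std_normal_density x *\<^sub>R exp (\<i> * of_real (t * x))) = of_real (exp (- t\<^sup>2 / 2))"
  proof -
    have "char std_normal_distribution t = of_real (exp (- t\<^sup>2 / 2))"
      by (simp add: char_std_normal_distribution)
    moreover have "char std_normal_distribution t
        = (LINT x|lborel. std_normal_density x *\<^sub>R exp (\<i> * of_real (t * x)))"
      unfolding char_def by (subst integral_density) (auto simp: normal_density_nonneg)
    ultimately show ?thesis by simp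
  qed
  have pt: "gaussian_wave A l (of_real x + \<i> * of_real h)
     = of_real (sqrt (2 * pi) * exp (A * h\<^sup>2 - l * h)) *
       (std_normal_density (0 + r * x) *\<^sub>R exp (\<i> * of_real (t * (0 + r * x))))" for x
  proof -
    have "- of_real A * (of_real x + \<i> * of_real h)\<^sup>2 + \<i> * of_real l * (of_real x + \<i> * of_real h)
      = of_real (A * h\<^sup>2 - l * h) + of_real (- (r * x)\<^sup>2 / 2) + \<i> * of_real (t * (r * x))"
    proof -
      have "t * (r * x) = (l - 2 * A * h) * x" using r by (simp add: t_def)
      moreover have "(r * x)\<^sup>2 / 2 = A * x\<^sup>2" using r by (simp add: power_mult_distrib)
      ultimately show ?thesis
        by (simp add: complex_eq_iff power2_eq_square algebra_simps)
    qed
    then have "gaussian_wave A l (of_real x + \<i> * of_real h)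
      = of_real (exp (A * h\<^sup>2 - l * h)) * of_real (exp (- (r * x)\<^sup>2 / 2)) * exp (\<i> * of_real (t * (r * x)))"
      unfolding exp_add[symmetric] by (simp only: exp_add exp_of_real)
    then show ?thesis
      by (simp add: std_normal_density_def scaleR_conv_of_real exp_of_real)
  qed
  have "(LINT x|lborel. std_normal_density x *\<^sub>R exp (\<i> * of_real (t * x)))
     = \<bar>r\<bar> *\<^sub>R (LINT x|lborel. std_normal_density (0 + r * x) *\<^sub>R exp (\<i> * of_real (t * (0 + r * x))))"
    using r by (intro lborel_integral_real_affine) auto
  then have "(LINT x|lborel. std_normal_density (0 + r * x) *\<^sub>R exp (\<i> * of_real (t * (0 + r * x))))
     = of_real (exp (- t\<^sup>2 / 2) / r)"
    using r char by (simp add: scaleR_conv_of_real field_simps)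
  then have "(LINT x|lborel. gaussian_wave A l (of_real x + \<i> * of_real h))
     = of_real (sqrt (2 * pi) * exp (A * h\<^sup>2 - l * h) * (exp (- t\<^sup>2 / 2) / r))"
    unfolding pt integral_mult_right_zero by simp
  also have "sqrt (2 * pi) * exp (A * h\<^sup>2 - l * h) * (exp (- t\<^sup>2 / 2) / r)
     = (sqrt (2 * pi) / r) * (exp (A * h\<^sup>2 - l * h) * exp (- t\<^sup>2 / 2))"
    by simp
  also have "exp (A * h\<^sup>2 - l * h) * exp (- t\<^sup>2 / 2) = exp (A * h\<^sup>2 - l * h - t\<^sup>2 / 2)"
    by (subst exp_add[symmetric]) simp
  also have "A * h\<^sup>2 - l * h - t\<^sup>2 / 2 = - l\<^sup>2 / (4 * A)"
    using assms r by (simp add: t_def power_divide field_simps power2_eq_square)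
  also have "sqrt (2 * pi) / r = sqrt (pi / A)"
    using assms by (simp add: r_def real_sqrt_divide[symmetric])
  finally show ?thesis .
qed

lemma norm_exp_gaussian_line:
  fixes A l h x :: real
  shows "norm (gaussian_wave A l (of_real x + \<i> * of_real h))
       = exp (- A * x\<^sup>2 + 0 * \<bar>x\<bar> + (A * h\<^sup>2 - l * h))"
  by (simp add: norm_mult power2_eq_square algebra_simps flip: exp_add)

lemma norm_mult_le_mult:
  fixes a b :: complex
  assumes "norm a \<le> u" "norm b = v"
  shows "norm (a * b) \<le> u * v"
  using mult_right_mono[OF assms(1) norm_ge_zero[of b]] by (simp add: norm_mult assms(2))

lemma gaussian_integrable:
  fixes A l h :: real and p :: nat
  assumes "0 < A" "p \<le> 1"
  shows "integrable lborel (\<lambda>x. (of_real x + \<i> * of_real h) ^ p *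
      (gaussian_wave A l (of_real x + \<i> * of_real h)))"
proof -
  obtain C where C: "\<And>t. (1 + \<bar>t\<bar>) * exp (- A * t\<^sup>2 + 0 * \<bar>t\<bar> + (A * h\<^sup>2 - l * h)) \<le> C / (1 + t\<^sup>2)" "0 \<le> C"
    using gaussian_growth_bound[OF assms(1) order_refl] by blast
  show ?thesis
  proof (rule Bochner_Integration.integrable_bound)
    show "integrable lborel (\<lambda>t. ((1 + \<bar>h\<bar>) * C) / (1 + (1 * t)\<^sup>2))" by (rule integrable_inverse_quadratic) simp
    show "(\<lambda>x. (of_real x + \<i> * of_real h) ^ p *
      (gaussian_wave A l (of_real x + \<i> * of_real h)))
      \<in> borel_measurable lborel"
      unfolding measurable_lborel2 by (intro borel_measurable_continuous_onI continuous_intros)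
    show "AE x in lborel. norm ((of_real x + \<i> * of_real h) ^ p *
      (gaussian_wave A l (of_real x + \<i> * of_real h)))
      \<le> norm (((1 + \<bar>h\<bar>) * C) / (1 + (1 * x)\<^sup>2))"
    proof (rule AE_I2)
      fix x :: real
      have "norm (of_real x + \<i> * of_real h) \<le> \<bar>x\<bar> + \<bar>h\<bar>"
        using norm_triangle_ineq[of "of_real x" "\<i> * of_real h"] by (simp add: norm_mult)
      also have "\<dots> \<le> (1 + \<bar>h\<bar>) * (1 + \<bar>x\<bar>)" by (simp add: algebra_simps)
      finally have n1: "norm (of_real x + \<i> * of_real h) \<le> (1 + \<bar>h\<bar>) * (1 + \<bar>x\<bar>)" .
      have n2: "1 \<le> (1 + \<bar>h\<bar>) * (1 + \<bar>x\<bar>)" by (simp add: algebra_simps)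
      have np: "norm ((of_real x + \<i> * of_real h) ^ p) \<le> (1 + \<bar>h\<bar>) * (1 + \<bar>x\<bar>)"
        using assms(2) n1 n2 by (cases p) auto
      have "norm ((of_real x + \<i> * of_real h) ^ p *
        (gaussian_wave A l (of_real x + \<i> * of_real h)))
        \<le> ((1 + \<bar>h\<bar>) * (1 + \<bar>x\<bar>)) * exp (- A * x\<^sup>2 + 0 * \<bar>x\<bar> + (A * h\<^sup>2 - l * h))"
        by (rule norm_mult_le_mult[OF np norm_exp_gaussian_line])
      also have "\<dots> = (1 + \<bar>h\<bar>) * ((1 + \<bar>x\<bar>) * exp (- A * x\<^sup>2 + 0 * \<bar>x\<bar> + (A * h\<^sup>2 - l * h)))" by simp
      also have "\<dots> \<le> (1 + \<bar>h\<bar>) * (C / (1 + x\<^sup>2))" by (intro mult_left_mono C) simp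
      also have "\<dots> \<le> norm (((1 + \<bar>h\<bar>) * C) / (1 + (1 * x)\<^sup>2))" using C(2) by simp
      finally show "norm ((of_real x + \<i> * of_real h) ^ p *
        (gaussian_wave A l (of_real x + \<i> * of_real h)))
        \<le> norm (((1 + \<bar>h\<bar>) * C) / (1 + (1 * x)\<^sup>2))" .
    qed
  qed
qed

text \<open>
  The first moment follows because the derivative of the integrand, \<open>(- 2 A s + i l)\<close>
  times the Gaussian, has integral zero.
\<close>

lemma gaussian_moment_fourier:
  fixes A l h :: real and p :: nat
  assumes A: "0 < A" and p: "p \<le> 1"
  shows "(LINT x|lborel. (of_real x + \<i> * of_real h) ^ p *
      (gaussian_wave A l (of_real x + \<i> * of_real h)))
     = (\<i> * of_real (l / (2 * A))) ^ p * of_real (sqrt (pi / A) * exp (- l\<^sup>2 / (4 * A)))"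
proof -
  define s where "s = (\<lambda>x::real. of_real x + \<i> * of_real h)"
  define E where "E = (\<lambda>x. exp (- of_real A * (s x)\<^sup>2) * exp (\<i> * of_real l * s x))"
  have int: "integrable lborel (\<lambda>x. s x ^ q * E x)" if "q \<le> 1" for q
    using gaussian_integrable[OF A that, of h l] by (simp only: s_def E_def)
  have E0: "(LINT x|lborel. E x) = of_real (sqrt (pi / A) * exp (- l\<^sup>2 / (4 * A)))"
    unfolding E_def s_def by (rule gaussian_fourier[OF A])
  have "(LINT x|lborel. s x * E x) = \<i> * of_real (l / (2 * A)) * (LINT x|lborel. E x)"
  proof -
    define D where "D = (\<lambda>x. (- 2 * of_real A * s x + \<i> * of_real l) * E x)"
    have der: "(E has_vector_derivative D x) (at x)" for x
      unfolding E_def D_def s_def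
      by (rule has_vector_derivative_real_field derivative_eq_intros refl | simp)+ (simp add: algebra_simps)
    have intD: "integrable lborel D"
      using int[of 1] int[of 0] unfolding D_def by (simp add: ring_distribs mult.assoc)
    have E_lim: "(E \<longlongrightarrow> 0) F" if "filterlim (\<lambda>x::real. x\<^sup>2) at_top F" for F
    proof (rule tendsto_norm_zero_cancel)
      have "norm (E x) = exp (- A * x\<^sup>2 + (A * h\<^sup>2 - l * h))" for x
        unfolding E_def s_def norm_exp_gaussian_line by simp
      moreover have "((\<lambda>x. exp (- A * x\<^sup>2 + (A * h\<^sup>2 - l * h))) \<longlongrightarrow> 0) F"
      proof -
        have "((\<lambda>y. exp (- A * y + (A * h\<^sup>2 - l * h))) \<longlongrightarrow> 0) at_top" using A by real_asymp
        from filterlim_compose[OF this that] show ?thesis .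
      qed
      ultimately show "((\<lambda>x. norm (E x)) \<longlongrightarrow> 0) F" by simp
    qed
    have "(LBINT x=-\<infinity>..\<infinity>. D x) = 0 - 0"
    proof (rule interval_integral_FTC_integrable[where F = E])
      show "(E has_vector_derivative D x) (at x)" for x by (rule der)
      show "isCont D x" for x
        unfolding D_def E_def s_def by (intro continuous_intros)
      show "set_integrable lborel (einterval (-\<infinity>) \<infinity>) D"
        using intD by (simp add: set_integrable_def)
      show "((E \<circ> real_of_ereal) \<longlongrightarrow> 0) (at_right (-\<infinity>))"
        unfolding ereal_tendsto_simps by (rule E_lim) real_asymp
      show "((E \<circ> real_of_ereal) \<longlongrightarrow> 0) (at_left \<infinity>)"
        unfolding ereal_tendsto_simps by (rule E_lim) real_asymp
    qed simp
    then have "(LINT x|lborel. D x) = 0"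
      by (simp add: interval_lebesgue_integral_def set_lebesgue_integral_def)
    moreover have "(LINT x|lborel. D x)
        = - 2 * of_real A * (LINT x|lborel. s x * E x) + \<i> * of_real l * (LINT x|lborel. E x)"
      using int[of 1] int[of 0] unfolding D_def by (simp add: ring_distribs mult.assoc)
    ultimately have "2 * of_real A * (LINT x|lborel. s x * E x) = \<i> * of_real l * (LINT x|lborel. E x)"
      by (simp add: eq_neg_iff_add_eq_0)
    moreover have "X = \<i> * of_real (l / (2 * A)) * Y" if "2 * of_real A * X = \<i> * of_real l * Y" for X Y :: complex
    proof -
      have "X = (2 * of_real A * X) / (2 * of_real A)" using A by simp
      also have "\<dots> = \<i> * of_real (l / (2 * A)) * Y" unfolding that by simp
      finally show ?thesis .
    qed
    ultimately show ?thesis by blast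
  qed
  then have "(LINT x|lborel. s x ^ p * E x) = (\<i> * of_real (l / (2 * A))) ^ p * (LINT x|lborel. E x)"
    using p by (cases p) auto
  then show ?thesis unfolding E0 by (simp only: s_def E_def)
qed

section \<open>Theta-like series with arbitrary weights\<close>

lemma int_infsum_sums:
  fixes f :: "int \<Rightarrow> complex"
  assumes "(\<lambda>n. norm (f n)) summable_on UNIV"
  shows "summable (\<lambda>j. f (int j))" "summable (\<lambda>j. f (- int j - 1))"
    "infsum f UNIV = (\<Sum>j. f (int j)) + (\<Sum>j. f (- int j - 1))"
proof -
  define g where "g = (\<lambda>j. - int j - 1)"
  have U: "UNIV = range int \<union> range g"
  proof -
    have "n \<in> range int \<union> range g" for n
    proof (cases "0 \<le> n")
      case True then show ?thesis by (intro UnI1) (auto simp: image_iff zero_le_imp_eq_int)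
    next
      case False
      then have "n = g (nat (- n - 1))" by (simp add: g_def)
      then show ?thesis by blast
    qed
    then show ?thesis by blast
  qed
  have disj: "range int \<inter> range g = {}" by (auto simp: g_def)
  have inj: "inj int" "inj g" by (auto simp: inj_on_def g_def)
  have n1: "(\<lambda>n. norm (f n)) summable_on range int" "(\<lambda>n. norm (f n)) summable_on range g"
    by (rule summable_on_subset[OF assms], simp)+
  have s: "summable (\<lambda>j. norm (f (int j)))" "summable (\<lambda>j. norm (f (g j)))"
    using n1 inj by (auto simp: summable_on_reindex o_def summable_on_UNIV_nonneg_real_iff)
  show 1: "summable (\<lambda>j. f (int j))" using s(1) by (rule summable_norm_cancel)
  have 2: "summable (\<lambda>j. f (g j))" using s(2) by (rule summable_norm_cancel)
  then show "summable (\<lambda>j. f (- int j - 1))" by (simp add: g_def)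
  have "infsum f (range int \<union> range g) = infsum f (range int) + infsum f (range g)"
    by (rule infsum_Un_disjoint[OF abs_summable_summable[OF n1(1)] abs_summable_summable[OF n1(2)] disj])
  then have "infsum f UNIV = infsum f (range int) + infsum f (range g)"
    by (simp only: U[symmetric])
  moreover have "infsum f (range int) = (\<Sum>j. f (int j))"
    using infsumI[OF norm_summable_imp_has_sum[OF s(1) summable_sums[OF 1]]]
    unfolding infsum_reindex[OF inj(1)] o_def .
  moreover have "infsum f (range g) = (\<Sum>j. f (g j))"
    using infsumI[OF norm_summable_imp_has_sum[OF s(2) summable_sums[OF 2]]]
    unfolding infsum_reindex[OF inj(2)] o_def .
  ultimately show "infsum f UNIV = (\<Sum>j. f (int j)) + (\<Sum>j. f (- int j - 1))"
    by (simp add: g_def)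
qed

text \<open>
  Only the sums \<open>f(j) + f(-j)\<close> enter; this is what makes weights comparable up to
  parity.
\<close>

lemma int_infsum_symmetric_sums:
  fixes f :: "int \<Rightarrow> complex"
  assumes "(\<lambda>n. norm (f n)) summable_on UNIV"
  shows "(\<lambda>j. if j = 0 then f 0 else f (int j) + f (- int j)) sums infsum f UNIV"
proof -
  let ?h = "\<lambda>j. if j = 0 then 0 else f (- int j)"
  have "(\<lambda>j. ?h (Suc j)) = (\<lambda>j. f (- int j - 1))" by (simp add: minus_diff_commute)
  then have "(\<lambda>j. ?h (Suc j)) sums (\<Sum>j. f (- int j - 1))"
    using int_infsum_sums(2)[OF assms] by (simp add: summable_sums)
  then have "?h sums (\<Sum>j. f (- int j - 1))" using sums_Suc_iff[of ?h] by simp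
  from sums_add[OF summable_sums[OF int_infsum_sums(1)[OF assms]] this]
  have "(\<lambda>j. f (int j) + ?h j) sums infsum f UNIV" by (simp only: int_infsum_sums(3)[OF assms])
  moreover have "(\<lambda>j. f (int j) + ?h j) = (\<lambda>j. if j = 0 then f 0 else f (int j) + f (- int j))" by auto
  ultimately show ?thesis by simp
qed

definition unary_theta :: "nat \<Rightarrow> (int \<Rightarrow> complex) \<Rightarrow> complex \<Rightarrow> complex" where
  "unary_theta N w \<tau> = (\<Sum>\<^sub>\<infinity>n. w n * q_pow \<tau> (of_int (n\<^sup>2) / (4 * real N)))"

definition linear_growth :: "(int \<Rightarrow> complex) \<Rightarrow> bool" where
  "linear_growth w \<longleftrightarrow> (\<exists>C. \<forall>n. norm (w n) \<le> C * (1 + \<bar>of_int n\<bar>))"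

lemma linear_growth_add:
  assumes "linear_growth v" "linear_growth w"
  shows "linear_growth (\<lambda>n. v n + w n)"
proof -
  from assms obtain C D where CD: "\<And>n. norm (v n) \<le> C * (1 + \<bar>of_int n\<bar>)"
      "\<And>n. norm (w n) \<le> D * (1 + \<bar>of_int n\<bar>)"
    unfolding linear_growth_def by blast
  have "norm (v n + w n) \<le> (C + D) * (1 + \<bar>of_int n\<bar>)" for n
    using norm_triangle_ineq[of "v n" "w n"] CD[of n] unfolding ring_distribs by linarith
  then show ?thesis unfolding linear_growth_def by blast
qed

lemma linear_growth_bounded_mult:
  assumes "linear_growth w" "\<And>n. norm (c n) \<le> K"
  shows "linear_growth (\<lambda>n. c n * w n)"
proof -
  from assms obtain C where C: "\<And>n. norm (w n) \<le> C * (1 + \<bar>of_int n\<bar>)"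
    unfolding linear_growth_def by blast
  have K: "0 \<le> K" using order_trans[OF norm_ge_zero assms(2)] .
  have "norm (c n * w n) \<le> (K * C) * (1 + \<bar>of_int n\<bar>)" for n
    using mult_mono[OF assms(2)[of n] C[of n] K norm_ge_zero] by (simp add: norm_mult mult.assoc)
  then show ?thesis unfolding linear_growth_def by blast
qed

lemma linear_growth_cmult: "linear_growth w \<Longrightarrow> linear_growth (\<lambda>n. c * w n)"
  by (rule linear_growth_bounded_mult[where K = "norm c"]) auto

lemma linear_growth_sum:
  assumes "\<And>i. i \<in> I \<Longrightarrow> linear_growth (w i)"
  shows "linear_growth (\<lambda>n. \<Sum>i\<in>I. w i n)"
proof -
  have "linear_growth (\<lambda>n. 0)" unfolding linear_growth_def by (rule exI[of _ 0]) simp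
  then show ?thesis using assms
    by (induction I rule: infinite_finite_induct) (auto intro: linear_growth_add)
qed

lemma linear_growth_power: "p \<le> 1 \<Longrightarrow> linear_growth (\<lambda>n. of_int (n ^ p))"
  unfolding linear_growth_def by (intro exI[of _ 1]) (cases p; auto simp: le_Suc_eq)

lemma q_pow_eq_power:
  "q_pow \<tau> (of_int (n\<^sup>2) / (4 * real N)) = exp (2 * of_real pi * \<i> * \<tau> / (4 * of_nat N)) ^ nat (n\<^sup>2)"
proof -
  have "(of_nat (nat (n\<^sup>2)) :: complex) = of_int n ^ 2" by (metis of_int_of_nat_eq of_int_power nat_0_le zero_le_power2)
  then show ?thesis
    by (simp add: q_pow_def exp_of_nat_mult[symmetric] mult_ac)
qed

lemma norm_q_lt_1:
  assumes "0 < N" "0 < Im \<tau>"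
  shows "norm (exp (2 * of_real pi * \<i> * \<tau> / (4 * of_nat N))) < 1"
proof -
  have "Re (2 * of_real pi * \<i> * \<tau> / (4 * of_nat N)) = - (2 * pi * Im \<tau> / (4 * real N))"
    by (simp add: Re_divide power2_eq_square)
  then show ?thesis using assms by simp
qed

lemma unary_theta_summable:
  assumes N: "0 < N" and \<tau>: "0 < Im \<tau>" and w: "linear_growth w"
  shows "(\<lambda>n. norm (w n * q_pow \<tau> (of_int (n\<^sup>2) / (4 * real N)))) summable_on UNIV"
proof -
  define r where "r = norm (exp (2 * of_real pi * \<i> * \<tau> / (4 * of_nat N)))"
  have r: "0 \<le> r" "r < 1" using norm_q_lt_1[OF N \<tau>] by (auto simp: r_def)
  from w obtain C where C: "\<And>n. norm (w n) \<le> C * (1 + \<bar>of_int n\<bar>)" unfolding linear_growth_def by blast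
  have C0: "0 \<le> C" using order_trans[OF norm_ge_zero C[of 0]] by simp
  define D where "D = (\<lambda>n::int. C * (1 + \<bar>of_int n\<bar>) * r ^ nat \<bar>n\<bar>)"
  have bound: "norm (w n * q_pow \<tau> (of_int (n\<^sup>2) / (4 * real N))) \<le> D n" for n
  proof -
    have "\<bar>n\<bar> * 1 \<le> \<bar>n\<bar> * \<bar>n\<bar>" by (cases "n = 0", simp, intro mult_left_mono, auto)
    then have "\<bar>n\<bar> \<le> n\<^sup>2" by (simp add: power2_eq_square)
    then have "nat \<bar>n\<bar> \<le> nat (n\<^sup>2)" by simp
    then have "r ^ nat (n\<^sup>2) \<le> r ^ nat \<bar>n\<bar>" using r by (intro power_decreasing) auto
    then have "norm (w n) * r ^ nat (n\<^sup>2) \<le> (C * (1 + \<bar>of_int n\<bar>)) * r ^ nat \<bar>n\<bar>"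
      using C C0 r by (intro mult_mono) auto
    then show ?thesis unfolding q_pow_eq_power norm_mult norm_power r_def[symmetric] D_def .
  qed
  have "summable (\<lambda>j. C * (of_nat (Suc j) * r ^ j))"
    using geometric_deriv_sums[of r] r by (intro summable_mult) (auto simp: sums_iff)
  then have s: "(\<lambda>j. C * (of_nat (Suc j) * r ^ j)) summable_on UNIV"
    using C0 r by (subst summable_on_UNIV_nonneg_real_iff) auto
  have "D summable_on range int" "D summable_on range (\<lambda>j. - int j)"
    using s by (auto simp: summable_on_reindex inj_on_def o_def D_def add.commute mult_ac)
  then have "D summable_on (range int \<union> range (\<lambda>j. - int j))" by (rule summable_on_union)
  moreover have "range int \<union> range (\<lambda>j. - int j) = UNIV"
    by (auto simp: image_iff) (metis int_cases2)
  ultimately have "D summable_on UNIV" by simp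
  then show ?thesis by (rule summable_on_comparison_test) (use bound in auto)
qed


lemma unary_theta_sums:
  assumes "0 < N" "0 < Im \<tau>" "linear_growth w"
  shows "(\<lambda>j. (if j = 0 then w 0 else w (int j) + w (- int j)) * q_pow \<tau> (of_int ((int j)\<^sup>2) / (4 * real N)))
           sums unary_theta N w \<tau>"
proof -
  let ?f = "\<lambda>n. w n * q_pow \<tau> (of_int (n\<^sup>2) / (4 * real N))"
  have "(\<lambda>j. if j = 0 then ?f 0 else ?f (int j) + ?f (- int j)) sums unary_theta N w \<tau>"
    unfolding unary_theta_def by (rule int_infsum_symmetric_sums[OF unary_theta_summable[OF assms]])
  moreover have "(\<lambda>j. if j = 0 then ?f 0 else ?f (int j) + ?f (- int j))
     = (\<lambda>j. (if j = 0 then w 0 else w (int j) + w (- int j)) * q_pow \<tau> (of_int ((int j)\<^sup>2) / (4 * real N)))"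
    by (auto simp: ring_distribs)
  ultimately show ?thesis by simp
qed

text \<open>
  The exponent \<open>n^2\<close> is even, so a series depends only on the even part of its
  weights.
\<close>

lemma unary_theta_cong_symmetric:
  assumes "0 < N" "0 < Im \<tau>" "linear_growth v" "linear_growth w"
    and "\<And>n. v n + v (- n) = w n + w (- n)"
  shows "unary_theta N v \<tau> = unary_theta N w \<tau>"
proof -
  have "v 0 = w 0" using assms(5)[of 0] by simp
  then have "(if j = 0 then v 0 else v (int j) + v (- int j)) = (if j = 0 then w 0 else w (int j) + w (- int j))" for j
    using assms(5)[of "int j"] by simp
  then show ?thesis
    using sums_unique2[OF unary_theta_sums[OF assms(1,2,3)]] unary_theta_sums[OF assms(1,2,4)] by simp
qed

lemma unary_theta_cmult:
  assumes "0 < N" "0 < Im \<tau>" "linear_growth w"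
  shows "unary_theta N (\<lambda>n. c * w n) \<tau> = c * unary_theta N w \<tau>"
  unfolding unary_theta_def by (simp add: mult.assoc infsum_cmult_right')

lemma unary_theta_sum:
  assumes "0 < N" "0 < Im \<tau>" "finite I" "\<And>i. i \<in> I \<Longrightarrow> linear_growth (w i)"
  shows "unary_theta N (\<lambda>n. \<Sum>i\<in>I. w i n) \<tau> = (\<Sum>i\<in>I. unary_theta N (w i) \<tau>)"
  using assms(3,4)
proof (induction I rule: finite_induct)
  case (insert i I)
  have lg: "linear_growth (w i)" "linear_growth (\<lambda>n. \<Sum>i\<in>I. w i n)"
    using insert.prems by (auto intro: linear_growth_sum)
  have "unary_theta N (\<lambda>n. w i n + (\<Sum>i\<in>I. w i n)) \<tau> = unary_theta N (w i) \<tau> + unary_theta N (\<lambda>n. \<Sum>i\<in>I. w i n) \<tau>"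
    unfolding unary_theta_def ring_distribs
    by (rule infsum_add[OF unary_theta_summable[OF assms(1,2) lg(1), THEN abs_summable_summable]
          unary_theta_summable[OF assms(1,2) lg(2), THEN abs_summable_summable]])
  then show ?case using insert by simp
qed (simp add: unary_theta_def)

text \<open>
  In the variable \<open>x = exp(\<pi> i \<tau> / 2N)\<close> the series is a power series
  supported on squares, and \<open>x\<close> runs through the punctured unit disc. Holomorphy and
  uniqueness of the coefficients are then facts about power series.
\<close>

lemma unary_theta_power_series:
  assumes N: "0 < N" and w: "linear_growth w"
  defines "a \<equiv> \<lambda>i. \<Sum>j | j\<^sup>2 = i. if j = 0 then w 0 else w (int j) + w (- int j)"
  obtains P where "P holomorphic_on ball 0 1"
    and "\<And>z. norm z < 1 \<Longrightarrow> (\<lambda>i. a i * z ^ i) sums P z"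
    and "\<And>\<tau>. 0 < Im \<tau> \<Longrightarrow> unary_theta N w \<tau> = P (exp (2 * of_real pi * \<i> * \<tau> / (4 * of_nat N)))"
proof -
  define q where "q = (\<lambda>\<tau>. exp (2 * of_real pi * \<i> * \<tau> / (4 * of_nat N)))"
  define e where "e = (\<lambda>j::nat. if j = 0 then w 0 else w (int j) + w (- int j))"
  have a_sq: "a (j\<^sup>2) = e j" for j
  proof -
    have "{i. i\<^sup>2 = j\<^sup>2} = {j}" by auto
    then show ?thesis by (simp add: a_def e_def)
  qed
  have a_nsq: "a i = 0" if "i \<notin> range (\<lambda>j. j\<^sup>2)" for i
  proof -
    have "{j. j\<^sup>2 = i} = {}" using that by auto
    then show ?thesis by (simp only: a_def sum.empty)
  qed
  have mono: "strict_mono (\<lambda>j::nat. j\<^sup>2)" by (auto intro!: strict_monoI power_strict_mono)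
  have sums: "(\<lambda>i. a i * q \<tau> ^ i) sums unary_theta N w \<tau>" if "0 < Im \<tau>" for \<tau>
  proof -
    have "(\<lambda>j. a (j\<^sup>2) * q \<tau> ^ (j\<^sup>2)) sums unary_theta N w \<tau>"
    proof -
      have nat_sq: "nat ((int j)\<^sup>2) = j\<^sup>2" for j by (simp add: nat_power_eq)
      show ?thesis
        using unary_theta_sums[OF N that w] unfolding q_pow_eq_power a_sq e_def q_def nat_sq .
    qed
    then show ?thesis
      using sums_mono_reindex[OF mono, of "\<lambda>i. a i * q \<tau> ^ i"] a_nsq by simp
  qed
  define P where "P = (\<lambda>z. \<Sum>i. a i * z ^ i)"
  have P: "(\<lambda>i. a i * z ^ i) sums P z" if "norm z < 1" for z
  proof (cases "z = 0")
    case True then show ?thesis using powser_sums_zero[of a] by (simp add: P_def sums_iff)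
  next
    case False
    define \<tau> where "\<tau> = 4 * of_nat N * Ln z / (2 * of_real pi * \<i>)"
    have "q \<tau> = exp (Ln z)" using N by (simp add: q_def \<tau>_def)
    then have "q \<tau> = z" using False by simp
    moreover have "Im \<tau> = - (4 * real N * ln (norm z)) / (2 * pi)"
      using False by (simp add: \<tau>_def Im_divide power2_eq_square)
    then have "0 < Im \<tau>" using that False N by (simp add: mult_neg_pos mult_pos_neg divide_neg_pos)
    ultimately show ?thesis using sums[of \<tau>] by (simp add: P_def sums_iff)
  qed
  show ?thesis
  proof
    show "P holomorphic_on ball 0 1"
      by (rule power_series_holomorphic[where a = a]) (use P in simp)
    show "(\<lambda>i. a i * z ^ i) sums P z" if "norm z < 1" for z by (rule P[OF that])
    show "unary_theta N w \<tau> = P (exp (2 * of_real pi * \<i> * \<tau> / (4 * of_nat N)))" if "0 < Im \<tau>" for \<tau>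
    proof -
      have "norm (q \<tau>) < 1" unfolding q_def by (rule norm_q_lt_1[OF N that])
      from sums_unique2[OF sums[OF that] P[OF this]] show ?thesis by (simp only: q_def)
    qed
  qed
qed

lemma unary_theta_holomorphic:
  assumes "0 < N" "linear_growth w"
  shows "unary_theta N w holomorphic_on upper_half_plane"
proof -
  define a where "a = (\<lambda>i. \<Sum>j | j\<^sup>2 = i. if j = 0 then w 0 else w (int j) + w (- int j))"
  obtain P where P: "P holomorphic_on ball 0 1" "\<And>z. norm z < 1 \<Longrightarrow> (\<lambda>i. a i * z ^ i) sums P z"
    "\<And>\<tau>. 0 < Im \<tau> \<Longrightarrow> unary_theta N w \<tau> = P (exp (2 * of_real pi * \<i> * \<tau> / (4 * of_nat N)))"
    using unary_theta_power_series[OF assms] unfolding a_def by blast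
  have "(\<lambda>\<tau>. P (exp (2 * of_real pi * \<i> * \<tau> / (4 * of_nat N)))) holomorphic_on upper_half_plane"
    using norm_q_lt_1[OF assms(1)] assms(1)
    by (intro holomorphic_on_compose_gen[OF _ P(1), unfolded o_def] holomorphic_intros)
       (auto simp: upper_half_plane_def)
  then show ?thesis by (rule holomorphic_transform) (auto simp: P(3) upper_half_plane_def)
qed

text \<open>
  Linear independence of the theta functions will follow from this.
\<close>

lemma unary_theta_eq_0D:
  assumes N: "0 < N" and w: "linear_growth w"
    and zero: "\<And>\<tau>. 0 < Im \<tau> \<Longrightarrow> unary_theta N w \<tau> = 0"
  shows "w n + w (- n) = 0"
proof -
  define a where "a = (\<lambda>i. \<Sum>j | j\<^sup>2 = i. if j = 0 then w 0 else w (int j) + w (- int j))"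
  obtain P where P: "P holomorphic_on ball 0 1" "\<And>z. norm z < 1 \<Longrightarrow> (\<lambda>i. a i * z ^ i) sums P z"
    "\<And>\<tau>. 0 < Im \<tau> \<Longrightarrow> unary_theta N w \<tau> = P (exp (2 * of_real pi * \<i> * \<tau> / (4 * of_nat N)))"
    using unary_theta_power_series[OF N w] unfolding a_def by blast
  have P0: "P z = 0" if "norm z < 1" "z \<noteq> 0" for z
  proof -
    define \<tau> where "\<tau> = 4 * of_nat N * Ln z / (2 * of_real pi * \<i>)"
    have "exp (2 * of_real pi * \<i> * \<tau> / (4 * of_nat N)) = exp (Ln z)" using N by (simp add: \<tau>_def)
    then have "exp (2 * of_real pi * \<i> * \<tau> / (4 * of_nat N)) = z" using that by simp
    moreover have "Im \<tau> = - (4 * real N * ln (norm z)) / (2 * pi)"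
      using that by (simp add: \<tau>_def Im_divide power2_eq_square)
    then have "0 < Im \<tau>" using that N by (simp add: mult_neg_pos mult_pos_neg divide_neg_pos)
    ultimately show ?thesis using P(3)[of \<tau>] zero[of \<tau>] by simp
  qed
  have "isCont P 0"
    by (rule continuous_on_interior[OF holomorphic_on_imp_continuous_on[OF P(1)]]) simp
  then have "(P \<longlongrightarrow> P 0) (at 0)" by (simp add: isCont_def)
  moreover have "(P \<longlongrightarrow> 0) (at 0)"
  proof (rule tendsto_eventually)
    show "eventually (\<lambda>z. P z = 0) (at 0)"
      unfolding eventually_at using P0 by (intro exI[of _ 1]) auto
  qed
  ultimately have P00: "P 0 = 0" by (intro tendsto_unique[of "at (0::complex)"]) auto
  have a0: "a i = 0" for i
  proof (rule ccontr)
    assume ai: "a i \<noteq> 0"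
    show False
    proof (cases "i = 0")
      case True
      then show False using ai P00 sums_unique2[OF P(2)[of 0] powser_sums_zero[of a]] by simp
    next
      case False
      obtain s where s: "0 < s" "\<And>z. z \<in> cball 0 s - {0} \<Longrightarrow> P z \<noteq> 0"
        using powser_0_nonzero[of 1 0 a P i] P(2) P00 False ai by auto
      define z where "z = complex_of_real (min s (1/2))"
      have "norm z \<le> s" "norm z < 1" "z \<noteq> 0" using s(1) by (auto simp: z_def)
      then show False using s(2)[of z] P0[of z] by simp
    qed
  qed
  have e0: "(if j = 0 then w 0 else w (int j) + w (- int j)) = 0" for j
  proof -
    have "{i. i\<^sup>2 = j\<^sup>2} = {j}" by auto
    from a0[of "j\<^sup>2", unfolded a_def this] show ?thesis by simp
  qed
  show ?thesis
    using e0[of "nat \<bar>n\<bar>"] by (cases n "0::int" rule: linorder_cases) (auto simp: add.commute)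
qed

section \<open>Poisson summation with and without signs\<close>

definition shifted_gaussian :: "real \<Rightarrow> nat \<Rightarrow> real \<Rightarrow> complex \<Rightarrow> complex" where
  "shifted_gaussian A p \<kappa> s = (s + of_real \<kappa>) ^ p * exp (- of_real A * (s + of_real \<kappa>)\<^sup>2)"

text \<open>
  The Fourier coefficient of \<open>shifted_gaussian A p \<kappa>\<close> at the integer
  \<open>m\<close>.
\<close>

definition gaussian_coeff :: "real \<Rightarrow> nat \<Rightarrow> real \<Rightarrow> int \<Rightarrow> complex" where
  "gaussian_coeff A p \<kappa> m = exp (- 2 * of_real pi * \<i> * of_int m * of_real \<kappa>) *
     ((\<i> * of_real (pi * of_int m / A)) ^ p * of_real (sqrt (pi / A) * exp (- (pi * of_int m)\<^sup>2 / A)))"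

text \<open>
  A Gaussian decays in every cone of half-angle less than 45 degrees around the real axis.
\<close>

lemma shifted_gaussian_cone_bound:
  fixes A \<kappa> :: real and u :: complex
  assumes A: "0 < A" and p: "p \<le> 1" and u: "0 < Im u" "Im u < Re u"
  obtains C where "\<And>s. \<bar>Im s\<bar> * Re u \<le> Im u * \<bar>Re s\<bar> \<Longrightarrow> norm (shifted_gaussian A p \<kappa> s) \<le> C / (1 + (Re s)\<^sup>2)"
proof -
  define \<beta> where "\<beta> = Im u / Re u"
  have \<beta>: "0 < \<beta>" "\<beta> < 1" using u by (auto simp: \<beta>_def)
  have \<beta>2: "\<beta>\<^sup>2 < 1" using \<beta> by (simp add: power_less_one_iff abs_square_less_1)
  obtain C where C: "\<And>t. (1 + \<bar>t\<bar>) * exp (- (A * (1 - \<beta>\<^sup>2)) * t\<^sup>2 + (2 * A * \<bar>\<kappa>\<bar>) * \<bar>t\<bar> + 0) \<le> C / (1 + t\<^sup>2)" "0 \<le> C"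
    using gaussian_growth_bound[of "A * (1 - \<beta>\<^sup>2)" "2 * A * \<bar>\<kappa>\<bar>" 0] A \<beta>2 by auto
  have "norm (shifted_gaussian A p \<kappa> s) \<le> ((2 + \<bar>\<kappa>\<bar>) * C) / (1 + (Re s)\<^sup>2)"
    if "\<bar>Im s\<bar> * Re u \<le> Im u * \<bar>Re s\<bar>" for s
  proof -
    define x where "x = Re s"
    have Im: "\<bar>Im s\<bar> \<le> \<beta> * \<bar>x\<bar>" using that u by (simp add: \<beta>_def x_def field_simps)
    have "\<beta> * \<bar>x\<bar> \<le> 1 * \<bar>x\<bar>" using \<beta> by (intro mult_right_mono) auto
    then have Im1: "\<bar>Im s\<bar> \<le> \<bar>x\<bar>" using Im by simp
    have "norm (s + of_real \<kappa>) \<le> \<bar>x\<bar> + \<bar>x\<bar> + \<bar>\<kappa>\<bar>"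
      using norm_triangle_ineq[of s "of_real \<kappa>"] cmod_le[of s] Im1 by (simp add: x_def)
    also have "\<dots> \<le> (2 + \<bar>\<kappa>\<bar>) * (1 + \<bar>x\<bar>)" by (simp add: algebra_simps)
    finally have n1: "norm (s + of_real \<kappa>) \<le> (2 + \<bar>\<kappa>\<bar>) * (1 + \<bar>x\<bar>)" .
    have n0: "1 \<le> (2 + \<bar>\<kappa>\<bar>) * (1 + \<bar>x\<bar>)" by (simp add: algebra_simps add_increasing)
    have np: "norm ((s + of_real \<kappa>) ^ p) \<le> (2 + \<bar>\<kappa>\<bar>) * (1 + \<bar>x\<bar>)"
      using p n0 n1 by (cases p) auto
    have "(Im s)\<^sup>2 \<le> \<beta>\<^sup>2 * x\<^sup>2"
      using Im power_mono[of "\<bar>Im s\<bar>" "\<beta> * \<bar>x\<bar>" 2] by (simp add: power_mult_distrib)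
    then have "A * (Im s)\<^sup>2 \<le> A * (\<beta>\<^sup>2 * x\<^sup>2)" using A by (intro mult_left_mono) auto
    moreover have "- (A * (2 * x * \<kappa>)) \<le> A * (2 * (\<bar>x\<bar> * \<bar>\<kappa>\<bar>))"
    proof -
      have "A * (- (2 * x * \<kappa>)) \<le> A * (2 * (\<bar>x\<bar> * \<bar>\<kappa>\<bar>))"
        using A abs_ge_minus_self[of "x * \<kappa>"] by (intro mult_left_mono) (auto simp: abs_mult mult.commute)
      then show ?thesis by simp
    qed
    moreover have "0 \<le> A * \<kappa>\<^sup>2" using A by simp
    ultimately have "- A * ((x + \<kappa>)\<^sup>2 - (Im s)\<^sup>2) \<le> - (A * (1 - \<beta>\<^sup>2)) * x\<^sup>2 + (2 * A * \<bar>\<kappa>\<bar>) * \<bar>x\<bar> + 0"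
      by (simp add: power2_sum algebra_simps)
    then have ne: "norm (exp (- of_real A * (s + of_real \<kappa>)\<^sup>2))
        \<le> exp (- (A * (1 - \<beta>\<^sup>2)) * x\<^sup>2 + (2 * A * \<bar>\<kappa>\<bar>) * \<bar>x\<bar> + 0)"
      by (simp add: x_def power2_eq_square algebra_simps)
    have "norm (shifted_gaussian A p \<kappa> s)
        \<le> ((2 + \<bar>\<kappa>\<bar>) * (1 + \<bar>x\<bar>)) * exp (- (A * (1 - \<beta>\<^sup>2)) * x\<^sup>2 + (2 * A * \<bar>\<kappa>\<bar>) * \<bar>x\<bar> + 0)"
      unfolding shifted_gaussian_def norm_mult using np ne n0 by (intro mult_mono) auto
    also have "\<dots> = (2 + \<bar>\<kappa>\<bar>) * ((1 + \<bar>x\<bar>) * exp (- (A * (1 - \<beta>\<^sup>2)) * x\<^sup>2 + (2 * A * \<bar>\<kappa>\<bar>) * \<bar>x\<bar> + 0))"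
      by (simp only: mult.assoc)
    also have "\<dots> \<le> (2 + \<bar>\<kappa>\<bar>) * (C / (1 + x\<^sup>2))" by (intro mult_left_mono C) simp
    finally show ?thesis by (simp add: x_def)
  qed
  then show ?thesis using that by blast
qed

lemma shifted_gaussian_integrals:
  fixes A \<kappa> h :: real and m :: int
  assumes A: "0 < A" and p: "p \<le> 1"
  shows "integrable lborel (\<lambda>x. shifted_gaussian A p \<kappa> (of_real x + \<i> * of_real h))"
    and "(LINT x|lborel. shifted_gaussian A p \<kappa> (of_real x + \<i> * of_real h)
           * exp (2 * of_real pi * \<i> * of_int m * (of_real x + \<i> * of_real h))) = gaussian_coeff A p \<kappa> m"
proof -
  define g where "g = (\<lambda>l x. (of_real x + \<i> * of_real h) ^ p *
      (gaussian_wave A l (of_real x + \<i> * of_real h)))"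
  have shift: "of_real (\<kappa> + 1 * x) + \<i> * of_real h = (of_real x + \<i> * of_real h) + of_real \<kappa>" for x
    by simp
  have g0: "g 0 (\<kappa> + 1 * x) = shifted_gaussian A p \<kappa> (of_real x + \<i> * of_real h)" for x
    unfolding g_def shift shifted_gaussian_def by simp
  have gint: "integrable lborel (g l)" for l unfolding g_def by (rule gaussian_integrable[OF A p])
  from lborel_integrable_real_affine[OF gint[of 0], of 1 \<kappa>]
  show "integrable lborel (\<lambda>x. shifted_gaussian A p \<kappa> (of_real x + \<i> * of_real h))"
    unfolding g0 by simp
  define l where "l = 2 * pi * of_int m"
  have gl: "shifted_gaussian A p \<kappa> (of_real x + \<i> * of_real h)
           * exp (2 * of_real pi * \<i> * of_int m * (of_real x + \<i> * of_real h))
      = exp (- 2 * of_real pi * \<i> * of_int m * of_real \<kappa>) * g l (\<kappa> + 1 * x)" for x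
  proof -
    define s where "s = of_real x + \<i> * of_real h"
    have "exp (2 * of_real pi * \<i> * of_int m * s)
        = exp (- 2 * of_real pi * \<i> * of_int m * of_real \<kappa>) * exp (\<i> * of_real l * (s + of_real \<kappa>))"
      by (subst exp_add[symmetric]) (simp add: l_def algebra_simps)
    then show ?thesis unfolding g_def shift s_def[symmetric] shifted_gaussian_def by simp
  qed
  have "(LINT x|lborel. g l x) = \<bar>1\<bar> *\<^sub>R (LINT x|lborel. g l (\<kappa> + 1 * x))"
    by (rule lborel_integral_real_affine) simp
  then have "(LINT x|lborel. g l (\<kappa> + 1 * x)) = (LINT x|lborel. g l x)" by simp
  also have "\<dots> = (\<i> * of_real (l / (2 * A))) ^ p * of_real (sqrt (pi / A) * exp (- l\<^sup>2 / (4 * A)))"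
    unfolding g_def by (rule gaussian_moment_fourier[OF A p])
  also have "l / (2 * A) = pi * of_int m / A" by (simp add: l_def)
  also have "- l\<^sup>2 / (4 * A) = - (pi * of_int m)\<^sup>2 / A" by (simp add: l_def power_mult_distrib)
  finally show "(LINT x|lborel. shifted_gaussian A p \<kappa> (of_real x + \<i> * of_real h)
           * exp (2 * of_real pi * \<i> * of_int m * (of_real x + \<i> * of_real h))) = gaussian_coeff A p \<kappa> m"
    unfolding gl integral_mult_right_zero gaussian_coeff_def by (simp only:)
qed

lemma shifted_gaussian_left_poles:
  fixes A \<kappa> :: real and u :: complex
  assumes A: "0 < A" and p: "p \<le> 1" and u: "0 < Im u" "Im u < Re u"
    and S: "(\<lambda>m. (if m = 0 then 1 else 2) * (-1) ^ m * gaussian_coeff A p \<kappa> (int m)) sums S"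
  shows "(\<lambda>j. shifted_gaussian A p \<kappa> (- (of_nat j + 1/2))) sums
     ((S - (LINT t|lborel. shifted_gaussian A p \<kappa> (of_real t * u) * tan_kernel (of_real t * u) * u)) / 2)"
proof -
  obtain C where C: "\<And>s. \<bar>Im s\<bar> * Re u \<le> Im u * \<bar>Re s\<bar> \<Longrightarrow> norm (shifted_gaussian A p \<kappa> s) \<le> C / (1 + (Re s)\<^sup>2)"
    using shifted_gaussian_cone_bound[OF A p u] by blast
  have "(\<lambda>j. shifted_gaussian A p \<kappa> (- (of_nat j + 1/2))) sums
     (((\<Sum>m. (if m = 0 then 1 else 2) * (-1) ^ m * gaussian_coeff A p \<kappa> (int m))
      - (LINT t|lborel. shifted_gaussian A p \<kappa> (of_real t * u) * tan_kernel (of_real t * u) * u)) / 2)"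
  proof (rule tan_kernel_rotated_line)
    show "shifted_gaussian A p \<kappa> holomorphic_on UNIV"
      unfolding shifted_gaussian_def by (intro holomorphic_intros)
    show "0 < Re u" "0 < Im u" using u by auto
    show "(LINT x|lborel. shifted_gaussian A p \<kappa> (of_real x + \<i> * of_real h)
          * exp (2 * of_real pi * \<i> * of_nat m * (of_real x + \<i> * of_real h))) = gaussian_coeff A p \<kappa> (int m)" for h m
      using shifted_gaussian_integrals(2)[OF A p, of \<kappa> h "int m"] by simp
  qed (rule C shifted_gaussian_integrals(1)[OF A p], assumption?)+
  then show ?thesis using sums_unique[OF S] by simp
qed

lemma shifted_gaussian_minus:
  "shifted_gaussian A p (- \<kappa>) (- s) = (- 1) ^ p * shifted_gaussian A p \<kappa> s"
proof -
  have "- s + of_real (- \<kappa>) = (- 1) * (s + of_real \<kappa>)" by simp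
  then show ?thesis unfolding shifted_gaussian_def by (simp only: power_mult_distrib) simp
qed

lemma gaussian_coeff_minus:
  "gaussian_coeff A p (- \<kappa>) m = (- 1) ^ p * gaussian_coeff A p \<kappa> (- m)"
proof -
  have "\<i> * of_real (pi * of_int m / A) = (- 1) * (\<i> * of_real (pi * of_int (- m) / A))" by simp
  then have "(\<i> * of_real (pi * of_int m / A)) ^ p = (- 1) ^ p * (\<i> * of_real (pi * of_int (- m) / A)) ^ p"
    by (simp only: power_mult_distrib)
  then show ?thesis unfolding gaussian_coeff_def by simp
qed

text \<open>
  Apply the result for the negative poles to \<open>s \<mapsto> \<phi>(-s)\<close>. The kernel is
  odd, so the tilted integral changes its sign.
\<close>

lemma shifted_gaussian_right_poles:
  fixes A \<kappa> :: real and u :: complex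
  assumes A: "0 < A" and p: "p \<le> 1" and u: "0 < Im u" "Im u < Re u"
    and S: "(\<lambda>m. (if m = 0 then 1 else 2) * (-1) ^ m * gaussian_coeff A p \<kappa> (- int m)) sums S"
  shows "(\<lambda>j. shifted_gaussian A p \<kappa> (of_nat j + 1/2)) sums
     ((S + (LINT t|lborel. shifted_gaussian A p \<kappa> (of_real t * u) * tan_kernel (of_real t * u) * u)) / 2)"
proof -
  define F where "F = (\<lambda>\<kappa> t. shifted_gaussian A p \<kappa> (of_real t * u) * tan_kernel (of_real t * u) * u)"
  \<comment> \<open>The parity of the Gaussian with its polynomial factor.\<close>
  define e where "e = ((- 1) ^ p :: complex)"
  have ee: "e * e = 1" by (simp add: e_def power_mult_distrib[symmetric])
  have F: "F (- \<kappa>) (0 + (- 1) * t) = - (e * F \<kappa> t)" for t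
    using shifted_gaussian_minus[of A p \<kappa> "of_real t * u"] tan_kernel_minus[of "of_real t * u"]
    by (simp add: F_def e_def)
  have "(LINT t|lborel. F (- \<kappa>) t) = \<bar>- 1\<bar> *\<^sub>R (LINT t|lborel. F (- \<kappa>) (0 + (- 1) * t))"
    by (rule lborel_integral_real_affine) simp
  then have G: "(LINT t|lborel. F (- \<kappa>) t) = - (e * (LINT t|lborel. F \<kappa> t))"
    unfolding F by simp
  have "(\<lambda>m. (if m = 0 then 1 else 2) * (-1) ^ m * gaussian_coeff A p (- \<kappa>) (int m)) sums (e * S)"
    using sums_mult[OF S, of e] by (simp add: gaussian_coeff_minus e_def mult_ac)
  from shifted_gaussian_left_poles[OF A p u this]
  have "(\<lambda>j. shifted_gaussian A p (- \<kappa>) (- (of_nat j + 1/2))) sums ((e * S - (LINT t|lborel. F (- \<kappa>) t)) / 2)"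
    by (simp add: F_def)
  then have "(\<lambda>j. e * shifted_gaussian A p \<kappa> (of_nat j + 1/2)) sums ((e * S + e * (LINT t|lborel. F \<kappa> t)) / 2)"
    unfolding shifted_gaussian_minus e_def[symmetric] G by simp
  from sums_mult[OF this, of e]
  have "(\<lambda>j. (e * e) * shifted_gaussian A p \<kappa> (of_nat j + 1/2)) sums (((e * e) * S + (e * e) * (LINT t|lborel. F \<kappa> t)) / 2)"
    by (simp add: ring_distribs mult.assoc)
  then show ?thesis by (simp add: ee F_def)
qed

text \<open>
  The factor \<open>if m = 0 then 1 else 2\<close> is the one with which Fourier coefficients
  leave the geometric series of the kernel. Half the sum of the two one-sided sums is the full
  sum, half their difference is the sum with signs.
\<close>

lemma int_infsum_one_sided:
  fixes f :: "int \<Rightarrow> complex"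
  assumes f: "(\<lambda>n. norm (f n)) summable_on UNIV"
  obtains Sp Sm where "(\<lambda>m. (if m = 0 then 1 else 2) * f (int m)) sums Sp"
    "(\<lambda>m. (if m = 0 then 1 else 2) * f (- int m)) sums Sm"
    "infsum f UNIV = (Sp + Sm) / 2" "(\<Sum>\<^sub>\<infinity>n. of_int (sgn n) * f n) = (Sp - Sm) / 2"
proof -
  have f': "(\<lambda>n. norm (f (- n))) summable_on UNIV"
  proof -
    have "(\<lambda>n. norm (f n)) summable_on range uminus" by (rule summable_on_subset[OF f]) simp
    then have "((\<lambda>n. norm (f n)) \<circ> uminus) summable_on UNIV" by (subst (asm) summable_on_reindex) auto
    then show ?thesis by (simp only: o_def)
  qed
  have fs: "(\<lambda>n. norm (of_int (sgn n) * f n)) summable_on UNIV"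
    by (rule summable_on_comparison_test[OF f]) (auto simp: norm_mult sgn_if)
  have two: "\<exists>S. (\<lambda>m. (if m = 0 then 1 else 2) * g (int m)) sums S" if "(\<lambda>n. norm (g n)) summable_on UNIV"
    for g :: "int \<Rightarrow> complex"
  proof -
    have "summable (\<lambda>m. 2 * g (int m))" by (intro summable_mult int_infsum_sums(1)[OF that])
    moreover have "summable (\<lambda>m. if m \<in> {0} then g (int m) else 0)" by (rule summable_If_finite_set) simp
    ultimately have "summable (\<lambda>m. 2 * g (int m) - (if m \<in> {0} then g (int m) else 0))" by (rule summable_diff)
    moreover have "(\<lambda>m. 2 * g (int m) - (if m \<in> {0} then g (int m) else 0)) = (\<lambda>m. (if m = 0 then 1 else 2) * g (int m))"
      by auto
    ultimately show ?thesis by (auto dest: summable_sums)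
  qed
  obtain Sp where Sp: "(\<lambda>m. (if m = 0 then 1 else 2) * f (int m)) sums Sp" using two[OF f] by blast
  obtain Sm where Sm: "(\<lambda>m. (if m = 0 then 1 else 2) * f (- int m)) sums Sm" using two[OF f'] by blast
  have "(\<lambda>m. ((if m = 0 then 1 else 2) * f (int m) + (if m = 0 then 1 else 2) * f (- int m)) / 2) sums ((Sp + Sm) / 2)"
    by (intro sums_divide sums_add Sp Sm)
  moreover have "(\<lambda>m. ((if m = 0 then 1 else 2) * f (int m) + (if m = 0 then 1 else 2) * f (- int m)) / 2)
      = (\<lambda>m. if m = 0 then f 0 else f (int m) + f (- int m))" by (auto simp: fun_eq_iff)
  ultimately have 1: "infsum f UNIV = (Sp + Sm) / 2"
    using sums_unique2[OF int_infsum_symmetric_sums[OF f]] by simp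
  have "(\<lambda>m. ((if m = 0 then 1 else 2) * f (int m) - (if m = 0 then 1 else 2) * f (- int m)) / 2) sums ((Sp - Sm) / 2)"
    by (intro sums_divide sums_diff Sp Sm)
  moreover have "(\<lambda>m. ((if m = 0 then 1 else 2) * f (int m) - (if m = 0 then 1 else 2) * f (- int m)) / 2)
      = (\<lambda>m. if m = 0 then of_int (sgn 0) * f 0 else of_int (sgn (int m)) * f (int m) + of_int (sgn (- int m)) * f (- int m))"
    by (auto simp: fun_eq_iff)
  ultimately have 2: "(\<Sum>\<^sub>\<infinity>n. of_int (sgn n) * f n) = (Sp - Sm) / 2"
    using sums_unique2[OF int_infsum_symmetric_sums[OF fs]] by simp
  show ?thesis using that[OF Sp Sm 1 2] .
qed

lemma infsum_residue_class:
  fixes f :: "int \<Rightarrow> complex"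
  assumes m: "0 < m" and f: "(\<lambda>n. norm (delta k n m * f n)) summable_on UNIV"
  shows "summable (\<lambda>j. f (k + int m * int j))" "summable (\<lambda>j. f (k - int m * (int j + 1)))"
    "(\<Sum>\<^sub>\<infinity>n. delta k n m * f n) = (\<Sum>j. f (k + int m * int j)) + (\<Sum>j. f (k - int m * (int j + 1)))"
proof -
  define r where "r = (\<lambda>i. k + int m * i)"
  have inj: "inj r" using m by (auto simp: inj_on_def r_def)
  have delta_r: "delta k (r i) m = 1" for i by (simp add: delta_def r_def cong_def)
  have delta_nr: "delta k n m = 0" if "n \<notin> range r" for n
  proof -
    have "\<not> [n = k] (mod int m)"
    proof
      assume "[n = k] (mod int m)"
      then have "[k = n] (mod int m)" by (rule cong_sym)
      then obtain i where "n = k + int m * i" unfolding cong_iff_lin by blast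
      with that show False by (auto simp: r_def)
    qed
    then show ?thesis by (simp add: delta_def)
  qed
  have "(\<lambda>n. norm (delta k n m * f n)) summable_on range r" by (rule summable_on_subset[OF f]) simp
  then have fr: "(\<lambda>i. norm (f (r i))) summable_on UNIV"
    using inj by (simp add: summable_on_reindex o_def delta_r)
  show "summable (\<lambda>j. f (k + int m * int j))" "summable (\<lambda>j. f (k - int m * (int j + 1)))"
    using int_infsum_sums(1,2)[OF fr] by (simp_all add: r_def algebra_simps)
  have "(\<Sum>\<^sub>\<infinity>n. delta k n m * f n) = (\<Sum>\<^sub>\<infinity>n\<in>range r. delta k n m * f n)"
    by (rule infsum_cong_neutral) (auto simp: delta_nr)
  also have "\<dots> = (\<Sum>\<^sub>\<infinity>i. f (r i))" using infsum_reindex[OF inj, of "\<lambda>n. delta k n m * f n"] by (simp add: o_def delta_r)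
  also have "\<dots> = (\<Sum>j. f (r (int j))) + (\<Sum>j. f (r (- int j - 1)))" by (rule int_infsum_sums(3)[OF fr])
  finally show "(\<Sum>\<^sub>\<infinity>n. delta k n m * f n) = (\<Sum>j. f (k + int m * int j)) + (\<Sum>j. f (k - int m * (int j + 1)))"
    by (simp add: r_def algebra_simps)
qed

text \<open>
  With \<open>p = \<nu>\<close> these are the weights of the theta functions; with \<open>p = 1 -
  \<nu>\<close> and an additional sign they are those of the Eichler integrals.
\<close>

definition class_weight :: "nat \<Rightarrow> nat \<Rightarrow> int \<Rightarrow> int \<Rightarrow> complex" where
  "class_weight N p k n = delta k n (2 * N) * of_int (n ^ p)"

definition character_weight :: "nat \<Rightarrow> nat \<Rightarrow> int \<Rightarrow> int \<Rightarrow> complex" where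
  "character_weight N p k n = exp (- (of_real pi * \<i> * of_int (n * k) / of_nat N)) * of_int (n ^ p)"

lemma class_weight_growth: "p \<le> 1 \<Longrightarrow> linear_growth (class_weight N p k)"
  unfolding class_weight_def
  by (rule linear_growth_bounded_mult[OF linear_growth_power, where K = 1]) (auto simp: delta_def)

lemma character_weight_growth: "p \<le> 1 \<Longrightarrow> linear_growth (character_weight N p k)"
  unfolding character_weight_def
proof (rule linear_growth_bounded_mult[OF linear_growth_power, where K = 1])
  fix n
  have "exp (- (of_real pi * \<i> * of_int (n * k) / of_nat N)) = exp (\<i> * of_real (- (pi * of_int (n * k) / real N)))"
    by (simp add: mult_ac)
  then show "norm (exp (- (of_real pi * \<i> * of_int (n * k) / of_nat N))) \<le> 1"
    by (simp only: norm_exp_i_times)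
qed

abbreviation signed :: "(int \<Rightarrow> complex) \<Rightarrow> int \<Rightarrow> complex" where
  "signed w \<equiv> \<lambda>n. of_int (sgn n) * w n"

lemma sgn_growth: "linear_growth w \<Longrightarrow> linear_growth (\<lambda>n. of_int (sgn n) * w n)"
  by (rule linear_growth_bounded_mult[where K = 1]) (auto simp: sgn_if)

text \<open>
  The substitution \<open>n = 2N (s + \<kappa>)\<close> maps the poles \<open>s\<close>, the
  half-integers, to the residue class of \<open>k\<close>. For \<open>0 \<le> k \<le> N\<close>
  the signs of \<open>s\<close> and \<open>n\<close> agree, except at \<open>n = 0\<close>, where
  \<open>p = 1\<close> makes the term vanish. The sum of the identities for the left and the right
  poles gives the first claim, their difference the second one.
\<close>

lemma inversion_on_imaginary_axis:
  fixes N p :: nat and k :: int and y :: real and u :: complex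
  assumes N: "0 < N" and p: "p \<le> 1" and y: "0 < y" and u: "0 < Im u" "Im u < Re u"
  defines "\<kappa> \<equiv> of_int (k - int N) / (2 * real N)"
    and "C \<equiv> (\<i> / of_real y) ^ p / of_real (sqrt (2 * real N * y))"
  shows "unary_theta N (class_weight N p k) (\<i> * of_real y)
           = C * unary_theta N (character_weight N p k) (\<i> / of_real y)" (is ?theta)
    and "0 \<le> k \<Longrightarrow> k \<le> int N \<Longrightarrow> (k = 0 \<longrightarrow> p = 1) \<Longrightarrow>
      unary_theta N (signed (class_weight N p k)) (\<i> * of_real y)
       = - C * unary_theta N (signed (character_weight N p k)) (\<i> / of_real y)
         + (LINT t|lborel. (2 * of_nat N * (of_real t * u + of_real \<kappa>)) ^ p
             * exp (2 * of_real pi * \<i> * of_nat N * (\<i> * of_real y) * (of_real t * u + of_real \<kappa>)\<^sup>2)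
             * tan_kernel (of_real t * u) * u)" (is "_ \<Longrightarrow> _ \<Longrightarrow> _ \<Longrightarrow> ?EI")
proof -
  define A where "A = 2 * pi * real N * y"
  have A: "0 < A" using N y by (simp add: A_def)
  define a where "a = (2 * of_nat N :: complex) ^ p"
  have a0: "a \<noteq> 0" using N by (simp add: a_def)
  define F where "F = (\<lambda>n. of_int (n ^ p) * q_pow (\<i> * of_real y) (of_int (n\<^sup>2) / (4 * real N)))"
  define f where "f = (\<lambda>n. character_weight N p k n * q_pow (\<i> / of_real y) (of_int (n\<^sup>2) / (4 * real N)))"
  have Im: "0 < Im (\<i> * of_real y)" "0 < Im (\<i> / of_real y)" using y by (auto simp: Im_divide)
  have f_sum: "(\<lambda>n. norm (f n)) summable_on UNIV"
    unfolding f_def by (rule unary_theta_summable[OF N Im(2) character_weight_growth[OF p]])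
  have F_sum: "(\<lambda>n. norm (delta k n (2 * N) * F n)) summable_on UNIV"
    using unary_theta_summable[OF N Im(1) class_weight_growth[OF p]]
    by (simp add: class_weight_def F_def mult.assoc)
  have Fs_sum: "(\<lambda>n. norm (delta k n (2 * N) * (of_int (sgn n) * F n))) summable_on UNIV"
    using unary_theta_summable[OF N Im(1) sgn_growth[OF class_weight_growth[OF p]]]
    by (simp add: class_weight_def F_def mult_ac)
  have F_eq: "F n = a * shifted_gaussian A p \<kappa> s" if "of_int n = 2 * of_nat N * (s + of_real \<kappa>)" for n s
  proof -
    have "of_int (n ^ p) = a * (s + of_real \<kappa>) ^ p"
      unfolding a_def power_mult_distrib[symmetric] that[symmetric] by simp
    moreover have "q_pow (\<i> * of_real y) (of_int (n\<^sup>2) / (4 * real N)) = exp (- of_real A * (s + of_real \<kappa>)\<^sup>2)"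
    proof -
      have "2 * of_real pi * \<i> * (\<i> * of_real y) * of_real (of_int (n\<^sup>2) / (4 * real N))
         = - (of_real pi * of_real y * (of_int n)\<^sup>2 / (2 * of_nat N))"
        using N by (simp add: field_simps)
      also have "\<dots> = - of_real A * (s + of_real \<kappa>)\<^sup>2"
        unfolding that A_def using N by (simp add: power2_eq_square)
      finally show ?thesis by (simp only: q_pow_def)
    qed
    ultimately show ?thesis unfolding F_def shifted_gaussian_def by simp
  qed
  have \<kappa>: "2 * of_nat N * of_real \<kappa> = (of_int (k - int N) :: complex)" using N by (simp add: \<kappa>_def)
  have F_right: "F (k + int (2 * N) * int j) = a * shifted_gaussian A p \<kappa> (of_nat j + 1/2)" for j
  proof (rule F_eq)
    have "2 * of_nat N * (of_nat j + 1/2 + of_real \<kappa> :: complex) = 2 * of_nat N * of_nat j + of_nat N + 2 * of_nat N * of_real \<kappa>"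
      by (simp add: algebra_simps)
    then show "(of_int (k + int (2 * N) * int j) :: complex) = 2 * of_nat N * (of_nat j + 1/2 + of_real \<kappa>)"
      unfolding \<kappa> by simp
  qed
  have F_left: "F (k - int (2 * N) * (int j + 1)) = a * shifted_gaussian A p \<kappa> (- (of_nat j + 1/2))" for j
  proof (rule F_eq)
    have "2 * of_nat N * (- (of_nat j + 1/2) + of_real \<kappa> :: complex) = - (2 * of_nat N * of_nat j) - of_nat N + 2 * of_nat N * of_real \<kappa>"
      by (simp add: algebra_simps)
    then show "(of_int (k - int (2 * N) * (int j + 1)) :: complex) = 2 * of_nat N * (- (of_nat j + 1/2) + of_real \<kappa>)"
      unfolding \<kappa> by (simp add: algebra_simps)
  qed
  have coeff: "(-1) ^ nat \<bar>m\<bar> * gaussian_coeff A p \<kappa> m = C / a * f m" for m :: int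
  proof -
    have 1: "(-1) ^ nat \<bar>m\<bar> * exp (- 2 * of_real pi * \<i> * of_int m * of_real \<kappa>)
       = exp (- (of_real pi * \<i> * of_int (m * k) / of_nat N))"
    proof -
      have e: "exp (of_real pi * \<i> * of_int m) = (-1 :: complex) ^ nat \<bar>m\<bar>"
      proof (cases "0 \<le> m")
        case True
        then have "exp (of_real pi * \<i> * of_int m) = exp (of_nat (nat m) * (of_real pi * \<i>))" by (simp add: mult.commute)
        also have "\<dots> = (-1) ^ nat m" unfolding exp_of_nat_mult exp_pi_i ..
        finally show ?thesis using True by simp
      next
        case False
        then have "exp (of_real pi * \<i> * of_int m) = exp (of_nat (nat (- m)) * (of_real (- pi) * \<i>))" by (simp add: mult.commute)
        also have "\<dots> = exp (of_real (- pi) * \<i>) ^ nat (- m)" unfolding exp_of_nat_mult ..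
        also have "exp (of_real (- pi) * \<i>) = -1" by (simp add: exp_minus exp_pi_i)
        finally show ?thesis using False by simp
      qed
      have "exp (- (of_real pi * \<i> * of_int m)) = (-1 :: complex) ^ nat \<bar>m\<bar>"
        unfolding exp_minus e power_inverse[symmetric] by simp
      moreover have "- (of_real pi * \<i> * of_int m) + (- 2 * of_real pi * \<i> * of_int m * of_real \<kappa>)
         = - (of_real pi * \<i> * of_int (m * k) / of_nat N)"
        using N by (simp add: \<kappa>_def field_simps)
      ultimately show ?thesis by (metis exp_add)
    qed
    have 2: "(\<i> * of_real (pi * of_int m / A)) ^ p = (\<i> / of_real y) ^ p / a * of_int (m ^ p)"
    proof -
      have "\<i> * of_real (pi * of_int m / A) = (\<i> / of_real y) / (2 * of_nat N) * of_int m"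
        using N y by (simp add: A_def field_simps)
      then show ?thesis by (simp add: a_def power_mult_distrib power_divide)
    qed
    have 3: "sqrt (pi / A) = 1 / sqrt (2 * real N * y)"
      by (simp add: A_def real_sqrt_divide real_sqrt_mult mult.assoc)
    have 4: "of_real (exp (- (pi * of_int m)\<^sup>2 / A)) = q_pow (\<i> / of_real y) (of_int (m\<^sup>2) / (4 * real N))"
    proof -
      have "of_real (- (pi * of_int m)\<^sup>2 / A) = 2 * of_real pi * \<i> * (\<i> / of_real y) * of_real (of_int (m\<^sup>2) / (4 * real N))"
        using N y by (simp add: A_def field_simps power2_eq_square)
      then show ?thesis by (simp only: q_pow_def exp_of_real[symmetric])
    qed
    have "(-1) ^ nat \<bar>m\<bar> * gaussian_coeff A p \<kappa> m
       = ((-1) ^ nat \<bar>m\<bar> * exp (- 2 * of_real pi * \<i> * of_int m * of_real \<kappa>)) *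
         ((\<i> * of_real (pi * of_int m / A)) ^ p * (of_real (sqrt (pi / A)) * of_real (exp (- (pi * of_int m)\<^sup>2 / A))))"
      by (simp add: gaussian_coeff_def)
    also have "\<dots> = C / a * f m"
      unfolding 1 2 3 4 C_def f_def character_weight_def by (simp add: mult_ac)
    finally show ?thesis .
  qed
  obtain Sp Sm where S: "(\<lambda>m. (if m = 0 then 1 else 2) * f (int m)) sums Sp"
    "(\<lambda>m. (if m = 0 then 1 else 2) * f (- int m)) sums Sm"
    "infsum f UNIV = (Sp + Sm) / 2" "(\<Sum>\<^sub>\<infinity>n. of_int (sgn n) * f n) = (Sp - Sm) / 2"
    using int_infsum_one_sided[OF f_sum] by blast
  have "(\<lambda>m. C / a * ((if m = 0 then 1 else 2) * f (int m))) sums (C / a * Sp)" by (rule sums_mult[OF S(1)])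
  then have Sp: "(\<lambda>m. (if m = 0 then 1 else 2) * (-1) ^ m * gaussian_coeff A p \<kappa> (int m)) sums (C / a * Sp)"
  proof (rule sums_cong[THEN iffD1, rotated])
    fix m
    have "(-1) ^ m * gaussian_coeff A p \<kappa> (int m) = C / a * f (int m)" using coeff[of "int m"] by simp
    then show "C / a * ((if m = 0 then 1 else 2) * f (int m)) = (if m = 0 then 1 else 2) * (-1) ^ m * gaussian_coeff A p \<kappa> (int m)"
      by (simp only: mult.assoc) (simp only: mult.left_commute)
  qed
  have "(\<lambda>m. C / a * ((if m = 0 then 1 else 2) * f (- int m))) sums (C / a * Sm)" by (rule sums_mult[OF S(2)])
  then have Sm: "(\<lambda>m. (if m = 0 then 1 else 2) * (-1) ^ m * gaussian_coeff A p \<kappa> (- int m)) sums (C / a * Sm)"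
  proof (rule sums_cong[THEN iffD1, rotated])
    fix m
    have "(-1) ^ m * gaussian_coeff A p \<kappa> (- int m) = C / a * f (- int m)" using coeff[of "- int m"] by simp
    then show "C / a * ((if m = 0 then 1 else 2) * f (- int m)) = (if m = 0 then 1 else 2) * (-1) ^ m * gaussian_coeff A p \<kappa> (- int m)"
      by (simp only: mult.assoc) (simp only: mult.left_commute)
  qed
  define G where "G = (LINT t|lborel. shifted_gaussian A p \<kappa> (of_real t * u) * tan_kernel (of_real t * u) * u)"
  have left: "(\<lambda>j. F (k - int (2 * N) * (int j + 1))) sums (a * ((C / a * Sp - G) / 2))"
    unfolding F_left G_def by (rule sums_mult[OF shifted_gaussian_left_poles[OF A p u Sp]])
  have right: "(\<lambda>j. F (k + int (2 * N) * int j)) sums (a * ((C / a * Sm + G) / 2))"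
    unfolding F_right G_def by (rule sums_mult[OF shifted_gaussian_right_poles[OF A p u Sm]])
  have "unary_theta N (class_weight N p k) (\<i> * of_real y) = (\<Sum>\<^sub>\<infinity>n. delta k n (2 * N) * F n)"
    by (simp add: unary_theta_def class_weight_def F_def mult.assoc)
  also have "\<dots> = a * ((C / a * Sm + G) / 2) + a * ((C / a * Sp - G) / 2)"
    using infsum_residue_class(3)[OF _ F_sum] N sums_unique[OF left] sums_unique[OF right] by simp
  also have "\<dots> = C * ((Sp + Sm) / 2)" using a0 by (simp add: field_simps)
  also have "(Sp + Sm) / 2 = unary_theta N (character_weight N p k) (\<i> / of_real y)"
    unfolding S(3)[symmetric] unary_theta_def f_def ..
  finally show ?theta .
  assume k: "0 \<le> k" "k \<le> int N" "k = 0 \<longrightarrow> p = 1"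
  have sF_right: "of_int (sgn (k + int (2 * N) * int j)) * F (k + int (2 * N) * int j) = F (k + int (2 * N) * int j)" for j
  proof (cases "k + int (2 * N) * int j = 0")
    case True
    then have "k = 0" using k(1) by (metis add_nonneg_eq_0_iff of_nat_0_le_iff mult_nonneg_nonneg)
    then have "F 0 = 0" using k(3) by (simp add: F_def)
    then show ?thesis unfolding True by simp
  next
    case False
    moreover have "0 \<le> k + int (2 * N) * int j" using k(1) by simp
    ultimately show ?thesis by simp
  qed
  have sF_left: "of_int (sgn (k - int (2 * N) * (int j + 1))) * F (k - int (2 * N) * (int j + 1))
      = - F (k - int (2 * N) * (int j + 1))" for j
  proof -
    have "int (2 * N) * 1 \<le> int (2 * N) * (int j + 1)" by (intro mult_left_mono) auto
    then have "k - int (2 * N) * (int j + 1) < 0" using k(2) N by linarith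
    then show ?thesis by simp
  qed
  have "unary_theta N (signed (class_weight N p k)) (\<i> * of_real y)
      = (\<Sum>\<^sub>\<infinity>n. delta k n (2 * N) * (of_int (sgn n) * F n))"
    by (simp add: unary_theta_def class_weight_def F_def mult_ac)
  also have "\<dots> = a * ((C / a * Sm + G) / 2) + - (a * ((C / a * Sp - G) / 2))"
  proof -
    have "(\<Sum>\<^sub>\<infinity>n. delta k n (2 * N) * (of_int (sgn n) * F n))
       = (\<Sum>j. F (k + int (2 * N) * int j)) + (\<Sum>j. - F (k - int (2 * N) * (int j + 1)))"
      using infsum_residue_class(3)[OF _ Fs_sum] N unfolding sF_left sF_right by simp
    then show ?thesis using sums_unique[OF right] sums_unique[OF sums_minus[OF left]] by simp
  qed
  also have "\<dots> = - C * ((Sp - Sm) / 2) + a * G"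
  proof -
    have "a * ((C / a * x + y) / 2) = (C * x + a * y) / 2" for x y using a0 by (simp add: ring_distribs)
    from this[of Sm G] this[of Sp "- G"] show ?thesis by (simp add: diff_divide_distrib add_divide_distrib right_diff_distrib)
  qed
  finally have total: "unary_theta N (signed (class_weight N p k)) (\<i> * of_real y)
      = - C * ((Sp - Sm) / 2) + a * G" .
  have dual: "(Sp - Sm) / 2 = unary_theta N (signed (character_weight N p k)) (\<i> / of_real y)"
    unfolding S(4)[symmetric] unary_theta_def f_def mult.assoc ..
  have integral: "a * G = (LINT t|lborel. (2 * of_nat N * (of_real t * u + of_real \<kappa>)) ^ p
             * exp (2 * of_real pi * \<i> * of_nat N * (\<i> * of_real y) * (of_real t * u + of_real \<kappa>)\<^sup>2)
             * tan_kernel (of_real t * u) * u)"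
  proof -
    have exponent: "2 * of_real pi * \<i> * of_nat N * (\<i> * of_real y) * X = - of_real A * X" for X
    proof -
      have "2 * of_real pi * \<i> * of_nat N * (\<i> * of_real y) = (\<i> * \<i>) * of_real A"
        unfolding A_def of_real_mult of_real_numeral of_real_of_nat_eq by (simp only: mult_ac)
      then show ?thesis by simp
    qed
    have "a * (shifted_gaussian A p \<kappa> s * tan_kernel s * u) = (2 * of_nat N * (s + of_real \<kappa>)) ^ p
             * exp (2 * of_real pi * \<i> * of_nat N * (\<i> * of_real y) * (s + of_real \<kappa>)\<^sup>2) * tan_kernel s * u" for s
      unfolding exponent a_def shifted_gaussian_def power_mult_distrib[of "2 * of_nat N"] by (simp only: mult.assoc)
    then show ?thesis unfolding G_def integral_mult_right_zero[symmetric] by (simp only:)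
  qed
  show ?EI using total unfolding dual integral .
qed

section \<open>The Mordell integral on the slit plane\<close>

text \<open>
  Cauchy's estimate turns a local majorant of the integrand into a majorant of its difference
  quotients, so dominated convergence gives the complex derivative.
\<close>

lemma holomorphic_lborel_integral:
  fixes f :: "complex \<Rightarrow> real \<Rightarrow> complex"
  assumes S: "open S"
    and hol: "\<And>t. (\<lambda>z. f z t) holomorphic_on S"
    and meas: "\<And>z. z \<in> S \<Longrightarrow> f z \<in> borel_measurable lborel"
    and dom: "\<And>z0. z0 \<in> S \<Longrightarrow> \<exists>g. integrable lborel g \<and> (\<forall>\<^sub>F z in nhds z0. \<forall>t. norm (f z t) \<le> g t)"
  shows "(\<lambda>z. LINT t|lborel. f z t) holomorphic_on S"
proof -
  have "\<exists>D. ((\<lambda>z. LINT t|lborel. f z t) has_field_derivative D) (at z0)" if z0: "z0 \<in> S" for z0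
  proof -
    obtain g where g: "integrable lborel g" "\<forall>\<^sub>F z in nhds z0. \<forall>t. norm (f z t) \<le> g t"
      using dom[OF z0] by blast
    from g(2) obtain d1 where d1: "0 < d1" "\<And>z t. dist z z0 < d1 \<Longrightarrow> norm (f z t) \<le> g t"
      unfolding eventually_nhds_metric by blast
    obtain d2 where d2: "0 < d2" "ball z0 d2 \<subseteq> S" using S z0 open_contains_ball by blast
    \<comment> \<open>Difference quotients are taken within distance \<open>r\<close> of \<open>z0\<close> and
         Cauchy's estimate reaches another \<open>r\<close> further.\<close>
    define r where "r = min d1 d2 / 3"
    have r: "0 < r" using d1 d2 by (simp add: r_def)
    have in_ball: "z \<in> S \<and> (\<forall>t. norm (f z t) \<le> g t)" if "dist z z0 < 3 * r" for z
      using that d1 d2 by (auto simp: r_def dist_commute subset_iff)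
    have g0: "0 \<le> g t" for t using in_ball[of z0] r by (auto intro: order_trans[OF norm_ge_zero])
    have int: "integrable lborel (f z)" if "dist z z0 < 3 * r" for z
      using in_ball[OF that] g0
      by (intro Bochner_Integration.integrable_bound[OF g(1)] meas) auto
    define D where "D = (\<lambda>t. deriv (\<lambda>z. f z t) z0)"
    have der: "((\<lambda>z. f z t) has_field_derivative deriv (\<lambda>z. f z t) z) (at z)" if "z \<in> S" for z t
      using holomorphic_derivI[OF hol S that] by simp
    have deriv_le: "norm (deriv (\<lambda>z. f z t) z) \<le> g t / r" if z: "dist z z0 < r" for z t
    proof -
      have sub: "cball z r \<subseteq> S"
      proof
        fix y assume "y \<in> cball z r"
        then have "dist y z0 < 3 * r" using z r dist_triangle[of y z0 z] by (simp add: dist_commute)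
        then show "y \<in> S" using in_ball by blast
      qed
      have "norm ((deriv ^^ 1) (\<lambda>z. f z t) z) \<le> fact 1 * g t / r ^ 1"
      proof (rule Cauchy_inequality)
        show "(\<lambda>z. f z t) holomorphic_on ball z r"
          using hol sub by (meson ball_subset_cball holomorphic_on_subset order_trans)
        show "continuous_on (cball z r) (\<lambda>z. f z t)"
          using hol sub by (meson holomorphic_on_imp_continuous_on holomorphic_on_subset)
        show "norm (f y t) \<le> g t" if "norm (z - y) = r" for y
        proof -
          have "dist y z0 < 3 * r" using z r that dist_triangle[of y z0 z] by (simp add: dist_norm norm_minus_commute)
          then show ?thesis using in_ball by blast
        qed
      qed (use r in simp)
      then show ?thesis by simp
    qed
    have quot_le: "norm ((f z t - f z0 t) / (z - z0)) \<le> g t / r" if z: "dist z z0 < r" "z \<noteq> z0" for z t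
    proof -
      have "norm (f z t - f z0 t) \<le> g t / r * norm (z - z0)"
      proof (rule field_differentiable_bound[of "ball z0 r"])
        show "((\<lambda>z. f z t) has_field_derivative deriv (\<lambda>z. f z t) y) (at y within ball z0 r)"
          if "y \<in> ball z0 r" for y
        proof (rule has_field_derivative_at_within[OF der])
          have "dist y z0 < 3 * r" using that r by (simp add: dist_commute)
          then show "y \<in> S" using in_ball by blast
        qed
        show "norm (deriv (\<lambda>z. f z t) y) \<le> g t / r" if "y \<in> ball z0 r" for y
          using deriv_le[of y t] that by (simp add: dist_commute)
      qed (use z r in \<open>auto simp: dist_commute\<close>)
      then show ?thesis using z by (simp add: norm_divide pos_divide_le_eq)
    qed
    have "((\<lambda>z. ((LINT t|lborel. f z t) - (LINT t|lborel. f z0 t)) / (z - z0)) \<longlongrightarrow> (LINT t|lborel. D t)) (at z0)"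
      unfolding tendsto_at_iff_sequentially o_def
    proof (intro allI impI)
      fix X :: "nat \<Rightarrow> complex"
      assume X: "\<forall>i. X i \<in> UNIV - {z0}" "X \<longlonglongrightarrow> z0"
      have ev: "\<forall>\<^sub>F n in sequentially. dist (X n) z0 < r" using X(2) r by (rule tendstoD)
      then obtain K where K: "\<And>n. K \<le> n \<Longrightarrow> dist (X n) z0 < r" unfolding eventually_sequentially by blast
      let ?q = "\<lambda>n t. (f (X (n + K)) t - f z0 t) / (X (n + K) - z0)"
      have near: "dist (X (n + K)) z0 < r" "X (n + K) \<noteq> z0" for n using K X(1) by auto
      have intX: "integrable lborel (f (X (n + K)))" "integrable lborel (f z0)" for n
        using near(1)[of n] r by (auto intro!: int)
      have "(\<lambda>n. LINT t|lborel. ?q n t) \<longlonglongrightarrow> (LINT t|lborel. D t)"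
      proof (rule integral_dominated_convergence[where w = "\<lambda>t. g t / r"])
        have lim: "(\<lambda>n. ?q n t) \<longlonglongrightarrow> D t" for t
        proof -
          have "((\<lambda>z. (f z t - f z0 t) / (z - z0)) \<longlongrightarrow> D t) (at z0)"
            using der[OF z0, of t] unfolding D_def has_field_derivative_iff .
          moreover have "filterlim (\<lambda>n. X (n + K)) (at z0) sequentially"
            using LIMSEQ_ignore_initial_segment[OF X(2), where k = K] near(2) by (auto simp: filterlim_at)
          ultimately show ?thesis by (rule filterlim_compose)
        qed
        then show "AE t in lborel. (\<lambda>n. ?q n t) \<longlonglongrightarrow> D t" by simp
        show q_meas: "?q n \<in> borel_measurable lborel" for n using intX(1)[of n] intX(2) by simp
        show "D \<in> borel_measurable lborel" by (rule borel_measurable_LIMSEQ_metric[OF q_meas lim])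
        show "integrable lborel (\<lambda>t. g t / r)" using g(1) by simp
        show "AE t in lborel. norm (?q n t) \<le> g t / r" for n
          using quot_le[OF near] by (rule AE_I2)
      qed
      moreover have "(LINT t|lborel. ?q n t)
          = ((LINT t|lborel. f (X (n + K)) t) - (LINT t|lborel. f z0 t)) / (X (n + K) - z0)" for n
        using intX(1)[of n] intX(2) by simp
      ultimately have "(\<lambda>n. ((LINT t|lborel. f (X (n + K)) t) - (LINT t|lborel. f z0 t)) / (X (n + K) - z0))
          \<longlonglongrightarrow> (LINT t|lborel. D t)" by (simp only:)
      then show "(\<lambda>n. ((LINT t|lborel. f (X n) t) - (LINT t|lborel. f z0 t)) / (X n - z0)) \<longlonglongrightarrow> (LINT t|lborel. D t)"
        by (rule LIMSEQ_offset)
    qed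
    then show ?thesis unfolding has_field_derivative_iff by blast
  qed
  then show ?thesis using S by (simp add: holomorphic_on_open)
qed

text \<open>
  The direction of the line of integration. It satisfies \<open>\<tau> = -1 /
  rotation(\<tau>)^4\<close>; halving the angle twice keeps it in the open first quadrant, while
  \<open>\<tau> rotation(\<tau>)^2 = i sqrt \<tau>\<close> has positive imaginary part for all
  \<open>\<tau>\<close> in the slit plane.
\<close>

definition rotation :: "complex \<Rightarrow> complex" where
  "rotation \<tau> = exp (of_real (pi / 4) * \<i> - Ln \<tau> / 4)"

text \<open>
  For \<open>\<tau>\<close> on the positive imaginary axis this is the tilted integral in the
  inversion law of the Eichler integrals.
\<close>

definition mordell_integral :: "nat \<Rightarrow> nat \<Rightarrow> real \<Rightarrow> complex \<Rightarrow> complex" where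
  "mordell_integral N p \<kappa> \<tau> = (LINT t|lborel.
     (2 * of_nat N * (of_real t * rotation \<tau> + of_real \<kappa>)) ^ p
     * exp (2 * of_real pi * \<i> * of_nat N * \<tau> * (of_real t * rotation \<tau> + of_real \<kappa>)\<^sup>2)
     * tan_kernel (of_real t * rotation \<tau>) * rotation \<tau>)"

lemma rotation_quadrant:
  assumes "\<tau> \<notin> \<real>\<^sub>\<le>\<^sub>0"
  shows "0 < Re (rotation \<tau>)" "0 < Im (rotation \<tau>)"
proof -
  have "\<tau> \<noteq> 0" using assms by auto
  have "Im (Ln \<tau>) < pi"
  proof (rule ccontr)
    assume "\<not> Im (Ln \<tau>) < pi"
    then have "Im (Ln \<tau>) = pi" using Im_Ln_le_pi[OF \<open>\<tau> \<noteq> 0\<close>] by simp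
    then show False using Im_Ln_eq_pi[OF \<open>\<tau> \<noteq> 0\<close>] assms by (auto simp: complex_nonpos_Reals_iff)
  qed
  moreover have "- pi < Im (Ln \<tau>)" by (rule mpi_less_Im_Ln[OF \<open>\<tau> \<noteq> 0\<close>])
  ultimately have a: "0 < pi / 4 - Im (Ln \<tau>) / 4" "pi / 4 - Im (Ln \<tau>) / 4 < pi / 2" by auto
  have "Re (rotation \<tau>) = exp (- (Re (Ln \<tau>) / 4)) * cos (pi / 4 - Im (Ln \<tau>) / 4)"
    by (simp add: rotation_def Re_exp)
  moreover have "0 < cos (pi / 4 - Im (Ln \<tau>) / 4)" using a by (intro cos_gt_zero) auto
  ultimately show "0 < Re (rotation \<tau>)" by simp
  have "Im (rotation \<tau>) = exp (- (Re (Ln \<tau>) / 4)) * sin (pi / 4 - Im (Ln \<tau>) / 4)"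
    by (simp add: rotation_def Im_exp)
  moreover have "0 < sin (pi / 4 - Im (Ln \<tau>) / 4)" using a by (intro sin_gt_zero2) auto
  ultimately show "0 < Im (rotation \<tau>)" by simp
qed

lemma rotation_holomorphic: "rotation holomorphic_on - \<real>\<^sub>\<le>\<^sub>0"
  unfolding rotation_def by (intro holomorphic_intros) auto

lemma mult_rotation_square:
  assumes "\<tau> \<noteq> 0"
  shows "\<tau> * (rotation \<tau>)\<^sup>2 = \<i> * csqrt \<tau>"
proof -
  have "(rotation \<tau>)\<^sup>2 = exp (of_real (pi / 2) * \<i> - Ln \<tau> / 2)"
    unfolding rotation_def by (simp add: exp_double[symmetric] algebra_simps)
  moreover have "\<tau> = exp (Ln \<tau>)" using assms by simp
  ultimately have "\<tau> * (rotation \<tau>)\<^sup>2 = exp (Ln \<tau> + (of_real (pi / 2) * \<i> - Ln \<tau> / 2))"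
    by (metis exp_add)
  also have "\<dots> = exp (of_real (pi / 2) * \<i>) * exp (Ln \<tau> / 2)"
    by (subst exp_add[symmetric]) (rule arg_cong[of _ _ exp], simp add: field_simps)
  also have "exp (of_real (pi / 2) * \<i>) = \<i>"
    by (metis cis_conv_exp cis_pi_half mult.commute)
  finally show ?thesis using assms by (simp add: csqrt_exp_Ln)
qed

text \<open>
  The line avoids the poles since it has positive slope, and the Gaussian decays like \<open>exp
  (- 2 \<pi> N Re (sqrt \<tau>) t^2)\<close>. All quantities in the majorant depend continuously
  on \<open>\<tau>\<close>, so it can be chosen locally uniformly.
\<close>

lemma mordell_integral_holomorphic:
  assumes N: "0 < N" and p: "p \<le> 1"
  shows "mordell_integral N p \<kappa> holomorphic_on - \<real>\<^sub>\<le>\<^sub>0"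
proof -
  define f where "f = (\<lambda>\<tau> t. (2 * of_nat N * (of_real t * rotation \<tau> + of_real \<kappa>)) ^ p
     * exp (2 * of_real pi * \<i> * of_nat N * \<tau> * (of_real t * rotation \<tau> + of_real \<kappa>)\<^sup>2)
     * tan_kernel (of_real t * rotation \<tau>) * rotation \<tau>)"
  have S: "open (- \<real>\<^sub>\<le>\<^sub>0 :: complex set)" by (simp add: open_Compl)
  have nz: "1 + exp (2 * of_real pi * \<i> * (of_real t * rotation \<tau>)) \<noteq> 0" if "\<tau> \<in> - \<real>\<^sub>\<le>\<^sub>0" for t \<tau>
  proof (rule tan_kernel_denominator_nonzero)
    show "Im (of_real t * rotation \<tau>) \<noteq> 0 \<or> (\<exists>m::int. Re (of_real t * rotation \<tau>) = of_int m)
       \<or> \<bar>Re (of_real t * rotation \<tau>)\<bar> < 1/2"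
      using rotation_quadrant[of \<tau>] that by (cases "t = 0") auto
  qed
  have "(\<lambda>\<tau>. LINT t|lborel. f \<tau> t) holomorphic_on - \<real>\<^sub>\<le>\<^sub>0"
  proof (rule holomorphic_lborel_integral[OF S])
    show "(\<lambda>\<tau>. f \<tau> t) holomorphic_on - \<real>\<^sub>\<le>\<^sub>0" for t
      unfolding f_def tan_kernel_def using nz
      by (intro holomorphic_intros rotation_holomorphic) auto
    show "f \<tau> \<in> borel_measurable lborel" if "\<tau> \<in> - \<real>\<^sub>\<le>\<^sub>0" for \<tau>
      unfolding f_def tan_kernel_def measurable_lborel2 using nz[OF that]
      by (intro borel_measurable_continuous_onI continuous_intros) auto
    fix \<tau>0 :: complex assume \<tau>0: "\<tau>0 \<in> - \<real>\<^sub>\<le>\<^sub>0"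
    then have "\<tau>0 \<noteq> 0" by auto
    define a where "a = Re (csqrt \<tau>0) / 2"
    define b where "b = Im (rotation \<tau>0) / 2"
    define R where "R = 1 + norm (rotation \<tau>0)"
    define Q where "Q = 1 + norm (\<tau>0 * rotation \<tau>0)"
    define Q2 where "Q2 = 1 + norm \<tau>0"
    have a: "0 < a"
    proof -
      have "\<bar>Im (Ln \<tau>0) / 2\<bar> < pi / 2"
        using mpi_less_Im_Ln[OF \<open>\<tau>0 \<noteq> 0\<close>] Im_Ln_le_pi[OF \<open>\<tau>0 \<noteq> 0\<close>] Im_Ln_eq_pi[OF \<open>\<tau>0 \<noteq> 0\<close>] \<tau>0
        by (auto simp: complex_nonpos_Reals_iff abs_less_iff less_le)
      then have "0 < cos (Im (Ln \<tau>0) / 2)" by (intro cos_gt_zero_pi) auto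
      then show ?thesis using \<open>\<tau>0 \<noteq> 0\<close> by (simp add: a_def csqrt_exp_Ln Re_exp)
    qed
    have b: "0 < b" using rotation_quadrant[of \<tau>0] \<tau>0 by (simp add: b_def)
    have R: "1 \<le> R" and Q: "1 \<le> Q" "1 \<le> Q2" by (simp_all add: R_def Q_def Q2_def)
    have crot: "(rotation \<longlongrightarrow> rotation \<tau>0) (nhds \<tau>0)"
      using continuous_on_eq_continuous_at[OF S] holomorphic_on_imp_continuous_on[OF rotation_holomorphic] \<tau>0
      by (metis continuous_at_imp_continuous_at_within isCont_def tendsto_nhds_iff)
    have csq: "(csqrt \<longlongrightarrow> csqrt \<tau>0) (nhds \<tau>0)"
      using \<tau>0 continuous_at_csqrt[of \<tau>0] by (simp add: isCont_def tendsto_nhds_iff)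
    have id: "((\<lambda>z. z) \<longlongrightarrow> \<tau>0) (nhds \<tau>0)" by (simp add: filterlim_ident)
    have "\<forall>\<^sub>F \<tau> in nhds \<tau>0. \<tau> \<in> - \<real>\<^sub>\<le>\<^sub>0" using S \<tau>0 by (rule eventually_nhds_in_open)
    moreover have "\<forall>\<^sub>F \<tau> in nhds \<tau>0. a < Re (csqrt \<tau>)"
      using a by (intro order_tendstoD(1)[OF tendsto_Re[OF csq]]) (simp add: a_def)
    moreover have "\<forall>\<^sub>F \<tau> in nhds \<tau>0. b < Im (rotation \<tau>)"
      using b by (intro order_tendstoD(1)[OF tendsto_Im[OF crot]]) (simp add: b_def)
    moreover have "\<forall>\<^sub>F \<tau> in nhds \<tau>0. norm (rotation \<tau>) < R"
      by (intro order_tendstoD(2)[OF tendsto_norm[OF crot]]) (simp add: R_def)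
    moreover have "\<forall>\<^sub>F \<tau> in nhds \<tau>0. norm (\<tau> * rotation \<tau>) < Q"
      by (intro order_tendstoD(2)[OF tendsto_norm[OF tendsto_mult[OF id crot]]]) (simp add: Q_def)
    moreover have "\<forall>\<^sub>F \<tau> in nhds \<tau>0. norm \<tau> < Q2"
      by (intro order_tendstoD(2)[OF tendsto_norm[OF id]]) (simp add: Q2_def)
    ultimately have ev: "\<forall>\<^sub>F \<tau> in nhds \<tau>0. \<tau> \<in> - \<real>\<^sub>\<le>\<^sub>0 \<and> a < Re (csqrt \<tau>) \<and> b < Im (rotation \<tau>)
        \<and> norm (rotation \<tau>) < R \<and> norm (\<tau> * rotation \<tau>) < Q \<and> norm \<tau> < Q2"
      by eventually_elim blast
    define n where "n = 2 * pi * real N"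
    have n: "0 < n" using N by (simp add: n_def)
    obtain C where C: "\<And>t. (1 + \<bar>t\<bar>) * exp (- (n * a) * t\<^sup>2 + (n * (2 * Q * \<bar>\<kappa>\<bar>)) * \<bar>t\<bar> + n * (Q2 * \<kappa>\<^sup>2)) \<le> C / (1 + t\<^sup>2)" "0 \<le> C"
      using gaussian_growth_bound[of "n * a" "n * (2 * Q * \<bar>\<kappa>\<bar>)" "n * (Q2 * \<kappa>\<^sup>2)"] n a Q by auto
    define B where "B = max 1 (2 / (1 - exp (- 2 * pi * (b / (4 * R)))))"
    define L where "L = 2 * real N * (R + \<bar>\<kappa>\<bar>) + 1"
    show "\<exists>g. integrable lborel g \<and> (\<forall>\<^sub>F \<tau> in nhds \<tau>0. \<forall>t. norm (f \<tau> t) \<le> g t)"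
    proof (intro exI conjI)
      show "integrable lborel (\<lambda>t. (L * B * R * C) / (1 + (1 * t)\<^sup>2))" by (rule integrable_inverse_quadratic) simp
      show "\<forall>\<^sub>F \<tau> in nhds \<tau>0. \<forall>t. norm (f \<tau> t) \<le> (L * B * R * C) / (1 + (1 * t)\<^sup>2)"
        using ev
      proof (eventually_elim, intro allI)
        fix \<tau> :: complex and t :: real
        assume *: "\<tau> \<in> - \<real>\<^sub>\<le>\<^sub>0 \<and> a < Re (csqrt \<tau>) \<and> b < Im (rotation \<tau>)
          \<and> norm (rotation \<tau>) < R \<and> norm (\<tau> * rotation \<tau>) < Q \<and> norm \<tau> < Q2"
        then have "\<tau> \<noteq> 0" by auto
        let ?u = "rotation \<tau>"
        have K: "norm (tan_kernel (of_real t * ?u)) \<le> B"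
        proof (cases "\<bar>Re (of_real t * ?u)\<bar> \<le> 1/4")
          case True
          then show ?thesis using norm_tan_kernel_le_1_vertical[of "of_real t * ?u"] by (simp add: B_def le_max_iff_disj)
        next
          case False
          have "\<bar>Re (of_real t * ?u)\<bar> = \<bar>t\<bar> * \<bar>Re ?u\<bar>" by (simp add: abs_mult)
          also have "\<dots> \<le> \<bar>t\<bar> * R" using abs_Re_le_cmod[of ?u] * by (intro mult_left_mono) auto
          finally have "1 / (4 * R) \<le> \<bar>t\<bar>" using False R by (simp add: field_simps)
          then have "1 / (4 * R) * b \<le> \<bar>t\<bar> * Im ?u" using * b R by (intro mult_mono) auto
          then have "b / (4 * R) \<le> \<bar>Im (of_real t * ?u)\<bar>" using * b by (simp add: abs_mult)
          then show ?thesis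
            using norm_tan_kernel_le_height[of "b / (4 * R)" "of_real t * ?u"] b R by (simp add: B_def le_max_iff_disj)
        qed
        have "norm (of_real t * ?u + of_real \<kappa>) \<le> \<bar>t\<bar> * R + \<bar>\<kappa>\<bar>"
        proof -
          have "\<bar>t\<bar> * norm ?u \<le> \<bar>t\<bar> * R" using * by (intro mult_left_mono) auto
          then show ?thesis using norm_triangle_ineq[of "of_real t * ?u" "of_real \<kappa>"] by (simp add: norm_mult)
        qed
        also have "\<dots> \<le> (R + \<bar>\<kappa>\<bar>) * (1 + \<bar>t\<bar>)" using R by (simp add: algebra_simps)
        finally have "2 * real N * norm (of_real t * ?u + of_real \<kappa>) \<le> 2 * real N * ((R + \<bar>\<kappa>\<bar>) * (1 + \<bar>t\<bar>))"
          by (intro mult_left_mono) auto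
        also have "\<dots> \<le> L * (1 + \<bar>t\<bar>)" by (simp add: L_def algebra_simps)
        finally have n1: "norm (2 * of_nat N * (of_real t * ?u + of_real \<kappa>)) \<le> L * (1 + \<bar>t\<bar>)"
          by (simp add: norm_mult)
        have L1: "1 \<le> L" using R by (simp add: L_def)
        then have n0: "1 \<le> L * (1 + \<bar>t\<bar>)" using mult_mono[of 1 L 1 "1 + \<bar>t\<bar>"] by simp
        have np: "norm ((2 * of_nat N * (of_real t * ?u + of_real \<kappa>)) ^ p) \<le> L * (1 + \<bar>t\<bar>)"
          using p n0 n1 by (cases p) auto
        define W where "W = \<tau> * (of_real t * ?u + of_real \<kappa>)\<^sup>2"
        have "W = of_real (t\<^sup>2) * (\<tau> * ?u\<^sup>2) + of_real (2 * t * \<kappa>) * (\<tau> * ?u) + of_real (\<kappa>\<^sup>2) * \<tau>"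
          by (simp add: W_def power2_eq_square algebra_simps)
        then have "W = of_real (t\<^sup>2) * (\<i> * csqrt \<tau>) + of_real (2 * t * \<kappa>) * (\<tau> * ?u) + of_real (\<kappa>\<^sup>2) * \<tau>"
          using mult_rotation_square[OF \<open>\<tau> \<noteq> 0\<close>] by simp
        then have "Im W
           = t\<^sup>2 * Re (csqrt \<tau>) + (2 * t * \<kappa>) * Im (\<tau> * ?u) + \<kappa>\<^sup>2 * Im \<tau>" by simp
        moreover have "t\<^sup>2 * a \<le> t\<^sup>2 * Re (csqrt \<tau>)" using * by (intro mult_left_mono) auto
        moreover have "- ((2 * t * \<kappa>) * Im (\<tau> * ?u)) \<le> (2 * Q * \<bar>\<kappa>\<bar>) * \<bar>t\<bar>"
        proof -
          have "\<bar>(2 * t * \<kappa>) * Im (\<tau> * ?u)\<bar> = 2 * \<bar>t\<bar> * \<bar>\<kappa>\<bar> * \<bar>Im (\<tau> * ?u)\<bar>" by (simp add: abs_mult)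
          also have "\<dots> \<le> 2 * \<bar>t\<bar> * \<bar>\<kappa>\<bar> * Q"
            using * abs_Im_le_cmod[of "\<tau> * ?u"] by (intro mult_left_mono) auto
          finally show ?thesis by (simp add: mult_ac abs_le_iff)
        qed
        moreover have "- (\<kappa>\<^sup>2 * Im \<tau>) \<le> Q2 * \<kappa>\<^sup>2"
        proof -
          have "\<kappa>\<^sup>2 * (- Im \<tau>) \<le> \<kappa>\<^sup>2 * Q2" using * abs_Im_le_cmod[of \<tau>] by (intro mult_left_mono) auto
          then show ?thesis by (simp add: mult.commute)
        qed
        ultimately have "- Im W \<le> - a * t\<^sup>2 + (2 * Q * \<bar>\<kappa>\<bar>) * \<bar>t\<bar> + Q2 * \<kappa>\<^sup>2"
          by (simp only: mult.commute[of a] mult_minus_left)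
        then have "n * (- Im W) \<le> n * (- a * t\<^sup>2 + (2 * Q * \<bar>\<kappa>\<bar>) * \<bar>t\<bar> + Q2 * \<kappa>\<^sup>2)"
          using n by (intro mult_left_mono) auto
        moreover have "norm (exp (2 * of_real pi * \<i> * of_nat N * \<tau> * (of_real t * ?u + of_real \<kappa>)\<^sup>2))
          = exp (n * (- Im W))"
        proof -
          have "2 * of_real pi * \<i> * of_nat N * \<tau> * (of_real t * ?u + of_real \<kappa>)\<^sup>2
             = \<i> * of_real n * W" by (simp add: n_def W_def)
          then show ?thesis unfolding norm_exp_eq_Re by (simp only:) simp
        qed
        ultimately have ne: "norm (exp (2 * of_real pi * \<i> * of_nat N * \<tau> * (of_real t * ?u + of_real \<kappa>)\<^sup>2))
           \<le> exp (- (n * a) * t\<^sup>2 + (n * (2 * Q * \<bar>\<kappa>\<bar>)) * \<bar>t\<bar> + n * (Q2 * \<kappa>\<^sup>2))"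
          by (simp add: algebra_simps)
        have Bnn: "0 \<le> B" by (simp add: B_def)
        have "norm (f \<tau> t) \<le> (L * (1 + \<bar>t\<bar>)) * exp (- (n * a) * t\<^sup>2 + (n * (2 * Q * \<bar>\<kappa>\<bar>)) * \<bar>t\<bar> + n * (Q2 * \<kappa>\<^sup>2)) * B * R"
          unfolding f_def norm_mult[of _ "rotation \<tau>"] norm_mult[of _ "tan_kernel _"] norm_mult[of "_ ^ p"]
          using np ne K * n0 Bnn L1 R by (intro mult_mono mult_nonneg_nonneg) auto
        also have "\<dots> = (L * B * R) * ((1 + \<bar>t\<bar>) * exp (- (n * a) * t\<^sup>2 + (n * (2 * Q * \<bar>\<kappa>\<bar>)) * \<bar>t\<bar> + n * (Q2 * \<kappa>\<^sup>2)))"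
          by (simp only: mult_ac)
        also have "\<dots> \<le> (L * B * R) * (C / (1 + t\<^sup>2))"
          using L1 R by (intro mult_left_mono C) (auto simp: B_def intro!: mult_nonneg_nonneg)
        finally show "norm (f \<tau> t) \<le> (L * B * R * C) / (1 + (1 * t)\<^sup>2)" by simp
      qed
    qed
  qed
  then show ?thesis by (simp only: mordell_integral_def[abs_def] f_def)
qed

section \<open>The inversion law on the upper half-plane\<close>

lemma upper_half_plane_iff: "\<tau> \<in> upper_half_plane \<longleftrightarrow> 0 < Im \<tau>"
  by (simp add: upper_half_plane_def)

lemma upper_half_plane_eq: "upper_half_plane = {\<tau>. Im \<tau> > 0}"
  by (simp add: upper_half_plane_def)

lemma open_upper_half_plane: "open upper_half_plane"
  unfolding upper_half_plane_eq by (rule open_halfspace_Im_gt)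

lemma inversion_in_upper_half_plane:
  assumes "0 < Im \<tau>" shows "0 < Im (- 1 / \<tau>)"
proof -
  have "Im (- 1 / \<tau>) = Im \<tau> / ((Re \<tau>)\<^sup>2 + (Im \<tau>)\<^sup>2)" by (simp add: Im_divide)
  moreover have "0 < (Re \<tau>)\<^sup>2 + (Im \<tau>)\<^sup>2" using assms by (simp add: sum_power2_gt_zero_iff)
  ultimately show ?thesis using assms by simp
qed

lemma holomorphic_eq_from_imaginary_axis:
  assumes f: "f holomorphic_on upper_half_plane" and g: "g holomorphic_on upper_half_plane"
    and eq: "\<And>y. 0 < y \<Longrightarrow> f (\<i> * of_real y) = g (\<i> * of_real y)" and \<tau>: "0 < Im \<tau>"
  shows "f \<tau> = g \<tau>"
proof -
  let ?U = "{\<i> * of_real y | y. 0 < (y::real)}"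
  have "(\<lambda>z. f z - g z) \<tau> = 0"
  proof (rule analytic_continuation[where f = "\<lambda>z. f z - g z" and w = \<tau> and S = upper_half_plane and U = ?U and \<xi> = \<i>])
    show "connected upper_half_plane"
      unfolding upper_half_plane_eq by (intro convex_connected convex_halfspace_Im_gt)
    show "\<i> islimpt ?U"
      unfolding islimpt_approachable
    proof (intro allI impI)
      fix e :: real assume e: "0 < e"
      have "\<i> * of_real (1 + e / 2) \<noteq> \<i>" using e by (simp add: complex_eq_iff)
      moreover have "dist (\<i> * of_real (1 + e / 2)) \<i> < e"
      proof -
        have "\<i> * of_real (1 + e / 2) - \<i> = \<i> * of_real (e / 2)" by (simp add: algebra_simps)
        then show ?thesis using e by (simp only: dist_norm norm_mult norm_ii norm_of_real)
      qed
      moreover have "\<i> * of_real (1 + e / 2) \<in> ?U" using e by (intro CollectI exI[of _ "1 + e / 2"]) auto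
      ultimately show "\<exists>x'\<in>?U. x' \<noteq> \<i> \<and> dist x' \<i> < e" by blast
    qed
    show "(\<lambda>z. f z - g z) holomorphic_on upper_half_plane" by (rule holomorphic_on_diff[OF f g])
    show "?U \<subseteq> upper_half_plane" by (auto simp: upper_half_plane_iff)
    show "f z - g z = 0" if "z \<in> ?U" for z using that eq by auto
  qed (use \<tau> open_upper_half_plane in \<open>simp_all add: upper_half_plane_iff\<close>)
  then show ?thesis by simp
qed

definition inversion_factor :: "nat \<Rightarrow> nat \<Rightarrow> complex \<Rightarrow> complex" where
  "inversion_factor N p \<tau> =
     (- 1 / \<tau>) ^ p * (exp (of_real (pi / 4) * \<i>) / of_real (sqrt (2 * real N))) * \<tau> powr (- 1 / 2)"

lemma upper_half_plane_slit: "0 < Im \<tau> \<Longrightarrow> \<tau> \<notin> \<real>\<^sub>\<le>\<^sub>0"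
  by (auto simp: complex_nonpos_Reals_iff)

lemma Ln_imaginary:
  assumes "0 < y"
  shows "Ln (\<i> * of_real y) = of_real (ln y) + of_real (pi / 2) * \<i>"
proof -
  have "Ln (of_real y * \<i>) = of_real (ln y) + Ln \<i>"
    using assms Ln_times_of_real[of y \<i>] by (simp add: Ln_of_real)
  then show ?thesis by (simp add: mult.commute)
qed

lemma inversion_factor_imaginary:
  assumes "0 < y"
  shows "inversion_factor N p (\<i> * of_real y) = (\<i> / of_real y) ^ p / of_real (sqrt (2 * real N * y))"
proof -
  note Ln = Ln_imaginary[OF assms]
  have "exp (of_real (pi / 4) * \<i>) * (\<i> * of_real y) powr (- 1 / 2)
      = exp (of_real (pi / 4) * \<i> + (- 1 / 2) * (of_real (ln y) + of_real (pi / 2) * \<i>))"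
    using assms unfolding exp_add by (simp add: powr_def Ln)
  also have "of_real (pi / 4) * \<i> + (- 1 / 2) * (of_real (ln y) + of_real (pi / 2) * \<i>) = of_real (- (ln y / 2))"
    by (simp add: algebra_simps)
  also have "exp (of_real (- (ln y / 2))) = (1 / of_real (sqrt y) :: complex)"
  proof -
    have "exp (- (ln y / 2)) = 1 / sqrt y"
      using assms by (simp add: exp_minus inverse_eq_divide ln_sqrt[symmetric])
    then show ?thesis unfolding exp_of_real by simp
  qed
  finally have e: "exp (of_real (pi / 4) * \<i>) * (\<i> * of_real y) powr (- 1 / 2) = 1 / of_real (sqrt y)" .
  have "- 1 / (\<i> * of_real y) = \<i> / of_real y" using assms by (simp add: field_simps)
  then have "inversion_factor N p (\<i> * of_real y)
      = (\<i> / of_real y) ^ p * (exp (of_real (pi / 4) * \<i>) * (\<i> * of_real y) powr (- 1 / 2)) / of_real (sqrt (2 * real N))"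
    by (simp add: inversion_factor_def)
  then show ?thesis unfolding e by (simp add: real_sqrt_mult)
qed

lemma inversion_factor_holomorphic: "0 < N \<Longrightarrow> inversion_factor N p holomorphic_on upper_half_plane"
  unfolding inversion_factor_def
  by (intro holomorphic_intros) (auto simp: upper_half_plane_iff upper_half_plane_slit)

lemma unary_theta_inversion_holomorphic:
  assumes "0 < N" "linear_growth w"
  shows "(\<lambda>\<tau>. unary_theta N w (- 1 / \<tau>)) holomorphic_on upper_half_plane"
  by (rule holomorphic_on_compose_gen[OF _ unary_theta_holomorphic[OF assms], unfolded o_def])
     (use inversion_in_upper_half_plane in \<open>auto intro!: holomorphic_intros simp: upper_half_plane_iff\<close>)

text \<open>
  On the imaginary axis the direction has the angle \<open>\<pi>/8\<close>, which is less than 45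
  degrees, as the decay of the real Gaussian in a cone demands.
\<close>

lemma rotation_imaginary:
  assumes "0 < y"
  shows "0 < Im (rotation (\<i> * of_real y))" "Im (rotation (\<i> * of_real y)) < Re (rotation (\<i> * of_real y))"
proof -
  have "rotation (\<i> * of_real y) = exp (of_real (- (ln y / 4)) + of_real (pi / 8) * \<i>)"
    unfolding rotation_def Ln_imaginary[OF assms] by (simp add: field_simps)
  then have "Re (rotation (\<i> * of_real y)) = exp (- (ln y / 4)) * cos (pi / 8)"
    "Im (rotation (\<i> * of_real y)) = exp (- (ln y / 4)) * sin (pi / 8)"
    by (simp_all add: Re_exp Im_exp)
  moreover have "0 < sin (pi / 8)" by (rule sin_gt_zero) auto
  moreover have "sin (pi / 8) < cos (pi / 8)"
  proof -
    have "sin (pi / 8) = cos (pi / 2 - pi / 8)" by (simp add: sin_cos_eq)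
    also have "\<dots> < cos (pi / 8)" by (rule cos_monotone_0_pi) auto
    finally show ?thesis .
  qed
  ultimately show "0 < Im (rotation (\<i> * of_real y))" "Im (rotation (\<i> * of_real y)) < Re (rotation (\<i> * of_real y))"
    by simp_all
qed

lemma unary_theta_inversion:
  assumes N: "0 < N" and p: "p \<le> 1" and \<tau>: "0 < Im \<tau>"
  shows "unary_theta N (class_weight N p k) \<tau>
     = inversion_factor N p \<tau> * unary_theta N (character_weight N p k) (- 1 / \<tau>)"
proof (rule holomorphic_eq_from_imaginary_axis[OF _ _ _ \<tau>])
  show "unary_theta N (class_weight N p k) holomorphic_on upper_half_plane"
    by (rule unary_theta_holomorphic[OF N class_weight_growth[OF p]])
  show "(\<lambda>\<tau>. inversion_factor N p \<tau> * unary_theta N (character_weight N p k) (- 1 / \<tau>)) holomorphic_on upper_half_plane"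
    by (intro holomorphic_intros inversion_factor_holomorphic unary_theta_inversion_holomorphic N character_weight_growth p)
  fix y :: real assume y: "0 < y"
  have "- 1 / (\<i> * of_real y) = \<i> / of_real y" using y by (simp add: field_simps)
  then show "unary_theta N (class_weight N p k) (\<i> * of_real y)
      = inversion_factor N p (\<i> * of_real y) * unary_theta N (character_weight N p k) (- 1 / (\<i> * of_real y))"
    using inversion_on_imaginary_axis(1)[OF N p y rotation_imaginary[OF y]] inversion_factor_imaginary[OF y] by simp
qed

lemma false_theta_inversion:
  assumes N: "0 < N" and p: "p \<le> 1" and k: "0 \<le> k" "k \<le> int N" "k = 0 \<longrightarrow> p = 1" and \<tau>: "0 < Im \<tau>"
  shows "unary_theta N (signed (class_weight N p k)) \<tau>
     = - inversion_factor N p \<tau> * unary_theta N (signed (character_weight N p k)) (- 1 / \<tau>)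
       + mordell_integral N p (of_int (k - int N) / (2 * real N)) \<tau>"
proof (rule holomorphic_eq_from_imaginary_axis[OF _ _ _ \<tau>])
  show "unary_theta N (signed (class_weight N p k)) holomorphic_on upper_half_plane"
    by (rule unary_theta_holomorphic[OF N sgn_growth[OF class_weight_growth[OF p]]])
  have "mordell_integral N p \<kappa> holomorphic_on upper_half_plane" for \<kappa>
    by (rule holomorphic_on_subset[OF mordell_integral_holomorphic[OF N p]])
       (auto simp: upper_half_plane_iff upper_half_plane_slit)
  then show "(\<lambda>\<tau>. - inversion_factor N p \<tau> * unary_theta N (signed (character_weight N p k)) (- 1 / \<tau>)
       + mordell_integral N p (of_int (k - int N) / (2 * real N)) \<tau>) holomorphic_on upper_half_plane"
    by (intro holomorphic_on_add holomorphic_on_mult holomorphic_on_minus inversion_factor_holomorphic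
          unary_theta_inversion_holomorphic N sgn_growth character_weight_growth p)
  fix y :: real assume y: "0 < y"
  have "- 1 / (\<i> * of_real y) = \<i> / of_real y" using y by (simp add: field_simps)
  then show "unary_theta N (signed (class_weight N p k)) (\<i> * of_real y)
     = - inversion_factor N p (\<i> * of_real y)
         * unary_theta N (signed (character_weight N p k)) (- 1 / (\<i> * of_real y))
       + mordell_integral N p (of_int (k - int N) / (2 * real N)) (\<i> * of_real y)"
    using inversion_on_imaginary_axis(2)[OF N p y rotation_imaginary[OF y] k]
    unfolding inversion_factor_imaginary[OF y] mordell_integral_def by (simp only:)
qed

text \<open>
  The part of \<open>n \<mapsto> exp(- \<pi> i n k / N)\<close> with the parity of
  \<open>\<nu>\<close>: a cosine for \<open>\<nu> = 0\<close> and \<open>-i\<close> times a sine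
  for \<open>\<nu> = 1\<close>.
\<close>

definition parity_character :: "nat \<Rightarrow> nat \<Rightarrow> int \<Rightarrow> int \<Rightarrow> complex" where
  "parity_character N \<nu> k n = (exp (- (of_real pi * \<i> * of_int (n * k) / of_nat N))
      + (- 1) ^ \<nu> * exp (of_real pi * \<i> * of_int (n * k) / of_nat N)) / 2"

text \<open>
  The number of residue classes modulo \<open>2N\<close> in the orbit of \<open>k\<close> under
  negation.
\<close>

definition orbit_size :: "nat \<Rightarrow> nat \<Rightarrow> complex" where
  "orbit_size N k = (if k = 0 \<or> k = N then 1 else 2)"

lemma parity_character_minus: "parity_character N \<nu> k (- n) = (- 1) ^ \<nu> * parity_character N \<nu> k n"
proof -
  have "(- 1) ^ \<nu> * (- 1 :: complex) ^ \<nu> = 1" by (simp add: power_mult_distrib[symmetric])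
  then have "(- 1) ^ \<nu> * ((- 1) ^ \<nu> * z) = z" for z :: complex by (simp add: mult.assoc[symmetric])
  then show ?thesis by (simp add: parity_character_def ring_distribs add.commute)
qed

lemma parity_character_add_period:
  assumes "0 < N"
  shows "parity_character N \<nu> k (n + 2 * int N * i) = parity_character N \<nu> k n"
proof -
  have e: "of_real pi * \<i> * of_int ((n + 2 * int N * i) * k) / of_nat N
     = of_real pi * \<i> * of_int (n * k) / of_nat N + of_int (2 * (i * k)) * (of_real pi * \<i>)"
    using assms by (simp add: field_simps)
  have one: "exp (of_int (2 * m) * (of_real pi * \<i>)) = (1 :: complex)" for m :: int
    using exp_eq_1[of "of_int (2 * m) * (of_real pi * \<i>)"] by (auto intro: exI[of _ m])
  have "exp (of_real pi * \<i> * of_int ((n + 2 * int N * i) * k) / of_nat N)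
     = exp (of_real pi * \<i> * of_int (n * k) / of_nat N)"
    unfolding e exp_add one by simp
  then show ?thesis unfolding parity_character_def exp_minus by simp
qed

lemma delta_add_period: "delta k (n + 2 * int N * i) (2 * N) = delta k n (2 * N)"
proof -
  have "[n + 2 * int N * i = n] (mod int (2 * N))" by (simp add: cong_def)
  then show ?thesis unfolding delta_def by (meson cong_sym cong_trans)
qed

lemma delta_fundamental_range:
  assumes "0 < N" "k \<le> N" "n \<le> N"
  shows "delta (int k) (int n) (2 * N) = (if k = n then 1 else 0)"
    and "delta (int k) (- int n) (2 * N) = (if k = n \<and> (n = 0 \<or> n = N) then 1 else 0)"
proof -
  have "[int n = int k] (mod int (2 * N)) \<longleftrightarrow> k = n"
    using assms by (auto simp: cong_int_iff cong_def)
  then show "delta (int k) (int n) (2 * N) = (if k = n then 1 else 0)" by (simp add: delta_def)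
  have "[- int n = int k] (mod int (2 * N)) \<longleftrightarrow> int (2 * N) dvd int (n + k)"
    by (simp add: cong_iff_dvd_diff) (metis dvd_minus_iff minus_diff_eq add.commute diff_minus_eq_add of_nat_add of_nat_mult of_nat_numeral)
  also have "\<dots> \<longleftrightarrow> 2 * N dvd n + k" by (rule int_dvd_int_iff)
  also have "\<dots> \<longleftrightarrow> k = n \<and> (n = 0 \<or> n = N)"
  proof
    assume "2 * N dvd n + k"
    then obtain q where q: "n + k = 2 * N * q" by (elim dvdE)
    have "q = 0 \<or> q = 1"
    proof (rule ccontr)
      assume "\<not> (q = 0 \<or> q = 1)"
      then have "2 * N * 2 \<le> 2 * N * q" by (intro mult_left_mono) auto
      then show False using q assms by linarith
    qed
    then show "k = n \<and> (n = 0 \<or> n = N)" using q assms by auto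
  qed (auto simp: mult_2)
  finally show "delta (int k) (- int n) (2 * N) = (if k = n \<and> (n = 0 \<or> n = N) then 1 else 0)" by (simp add: delta_def)
qed

lemma int_reduce_mod_sign:
  fixes n :: int
  assumes "0 < N"
  obtains n0 i where "n0 \<le> N" "n = int n0 + 2 * int N * i \<or> n = - int n0 + 2 * int N * i"
proof -
  define r where "r = n mod (2 * int N)"
  have r: "0 \<le> r" "r < 2 * int N" using assms by (simp_all add: r_def)
  have n: "n = r + 2 * int N * (n div (2 * int N))" by (simp add: r_def)
  show ?thesis
  proof (cases "r \<le> int N")
    case True
    show ?thesis by (rule that[of "nat r" "n div (2 * int N)"]) (use True r n in auto)
  next
    case False
    show ?thesis
      by (rule that[of "nat (2 * int N - r)" "n div (2 * int N) + 1"]) (use False r n in \<open>auto simp: algebra_simps\<close>)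
  qed
qed

text \<open>
  Every residue class modulo \<open>2N\<close> is plus or minus exactly one \<open>k\<close> with
  \<open>0 \<le> k \<le> N\<close>. For \<open>\<nu> = 1\<close> the classes 0 and
  \<open>N\<close> are missing on the right, and the character vanishes there.
\<close>

lemma parity_character_expansion:
  assumes N: "0 < N" and \<nu>: "\<nu> \<in> {0, 1}"
  shows "2 * parity_character N \<nu> k n = (\<Sum>i<theta_dim \<nu> N. orbit_size N (i + \<nu>) * parity_character N \<nu> k (int (i + \<nu>))
       * (delta (int (i + \<nu>)) n (2 * N) + (- 1) ^ \<nu> * delta (int (i + \<nu>)) (- n) (2 * N)))" (is "_ = ?R n")
proof -
  have base: "2 * parity_character N \<nu> k (int n) = ?R (int n)" if n: "n \<le> N" for n
  proof -
    have summand: "orbit_size N (i + \<nu>) * parity_character N \<nu> k (int (i + \<nu>))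
       * (delta (int (i + \<nu>)) (int n) (2 * N) + (- 1) ^ \<nu> * delta (int (i + \<nu>)) (- int n) (2 * N))
      = (if i + \<nu> = n then orbit_size N n * (1 + (- 1) ^ \<nu> * (if n = 0 \<or> n = N then 1 else 0)) * parity_character N \<nu> k (int n) else 0)"
      if "i < theta_dim \<nu> N" for i
    proof -
      have "i + \<nu> \<le> N" using that \<nu> N by (auto simp: theta_dim_def)
      from delta_fundamental_range[OF N this n] show ?thesis
        by (cases "i + \<nu> = n") (simp_all del: of_nat_add)
    qed
    have "?R (int n) = (\<Sum>i<theta_dim \<nu> N. if i + \<nu> = n then
        orbit_size N n * (1 + (- 1) ^ \<nu> * (if n = 0 \<or> n = N then 1 else 0)) * parity_character N \<nu> k (int n) else 0)"
      by (rule sum.cong[OF refl], rule summand) simp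
    also have "\<dots> = 2 * parity_character N \<nu> k (int n)"
    proof (cases "\<nu> \<le> n \<and> n - \<nu> < theta_dim \<nu> N")
      case True
      then have "i + \<nu> = n \<longleftrightarrow> i = n - \<nu>" for i by auto
      then have "(\<Sum>i<theta_dim \<nu> N. if i + \<nu> = n then
        orbit_size N n * (1 + (- 1) ^ \<nu> * (if n = 0 \<or> n = N then 1 else 0)) * parity_character N \<nu> k (int n) else 0)
        = orbit_size N n * (1 + (- 1) ^ \<nu> * (if n = 0 \<or> n = N then 1 else 0)) * parity_character N \<nu> k (int n)"
        using True by simp
      also have "\<dots> = 2 * parity_character N \<nu> k (int n)"
        using True \<nu> N by (auto simp: orbit_size_def theta_dim_def)
      finally show ?thesis .
    next
      case False
      then have "\<nu> = 1" "n = 0 \<or> n = N" using n \<nu> N by (auto simp: theta_dim_def)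
      moreover have "parity_character N 1 k (int N) = 0"
      proof -
        have "exp (of_real pi * \<i> * of_int k) = exp (- (of_real pi * \<i> * of_int k))"
          unfolding exp_eq by (intro exI[of _ k]) simp
        moreover have "of_real pi * \<i> * of_int (int N * k) / of_nat N = of_real pi * \<i> * of_int k" using N by simp
        ultimately show ?thesis unfolding parity_character_def by simp
      qed
      moreover have "parity_character N 1 k 0 = 0" by (simp add: parity_character_def)
      ultimately have "parity_character N \<nu> k (int n) = 0" by auto
      then show ?thesis by (simp only: mult_zero_right if_cancel sum.neutral_const)
    qed
    finally show ?thesis ..
  qed
  have R_minus: "?R (- m) = (- 1) ^ \<nu> * ?R m" for m
  proof -
    have "delta (int (i + \<nu>)) (- m) (2 * N) + (- 1) ^ \<nu> * delta (int (i + \<nu>)) (- (- m)) (2 * N)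
       = (- 1) ^ \<nu> * (delta (int (i + \<nu>)) m (2 * N) + (- 1) ^ \<nu> * delta (int (i + \<nu>)) (- m) (2 * N))" for i
      using \<nu> by auto
    then show ?thesis unfolding sum_distrib_left by (intro sum.cong refl) (simp only: mult.left_commute)
  qed
  have R_period: "?R (m + 2 * int N * i) = ?R m" for m i
  proof -
    have "- (m + 2 * int N * i) = - m + 2 * int N * (- i)" by simp
    then show ?thesis by (simp only: delta_add_period)
  qed
  obtain n0 i where n0: "n0 \<le> N" "n = int n0 + 2 * int N * i \<or> n = - int n0 + 2 * int N * i"
    using int_reduce_mod_sign[OF N] by blast
  from n0(2) show ?thesis
  proof
    assume "n = int n0 + 2 * int N * i"
    then show ?thesis using base[OF n0(1)] by (simp only: R_period parity_character_add_period[OF N])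
  next
    assume n: "n = - int n0 + 2 * int N * i"
    have "2 * parity_character N \<nu> k n = (- 1) ^ \<nu> * (2 * parity_character N \<nu> k (int n0))"
      unfolding n parity_character_add_period[OF N] parity_character_minus by simp
    also have "\<dots> = ?R n" unfolding n R_period R_minus base[OF n0(1)] ..
    finally show ?thesis .
  qed
qed

lemma unary_theta_character_expansion:
  assumes N: "0 < N" and \<nu>: "\<nu> \<in> {0, 1}" and \<tau>: "0 < Im \<tau>" and a: "linear_growth a"
    and parity: "\<And>n. a (- n) = (- 1) ^ \<nu> * a n"
  shows "unary_theta N (\<lambda>n. exp (- (of_real pi * \<i> * of_int (n * k) / of_nat N)) * a n) \<tau>
    = (\<Sum>i<theta_dim \<nu> N. orbit_size N (i + \<nu>) * parity_character N \<nu> k (int (i + \<nu>))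
        * unary_theta N (\<lambda>n. delta (int (i + \<nu>)) n (2 * N) * a n) \<tau>)"
proof -
  define c where "c = (\<lambda>i. orbit_size N (i + \<nu>) * parity_character N \<nu> k (int (i + \<nu>)))"
  have g1: "linear_growth (\<lambda>n. exp (- (of_real pi * \<i> * of_int (n * k) / of_nat N)) * a n)"
  proof (rule linear_growth_bounded_mult[OF a, where K = 1])
    fix n
    have "exp (- (of_real pi * \<i> * of_int (n * k) / of_nat N)) = exp (\<i> * of_real (- (pi * of_int (n * k) / real N)))"
      by (simp add: mult_ac)
    then show "norm (exp (- (of_real pi * \<i> * of_int (n * k) / of_nat N))) \<le> 1"
      by (simp only: norm_exp_i_times)
  qed
  have g2: "linear_growth (\<lambda>n. delta (int (i + \<nu>)) n (2 * N) * a n)" for i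
    by (rule linear_growth_bounded_mult[OF a, where K = 1]) (auto simp: delta_def)
  have g3: "linear_growth (\<lambda>n. c i * (delta (int (i + \<nu>)) n (2 * N) * a n))" for i
    by (rule linear_growth_cmult[OF g2])
  have "unary_theta N (\<lambda>n. exp (- (of_real pi * \<i> * of_int (n * k) / of_nat N)) * a n) \<tau>
      = unary_theta N (\<lambda>n. \<Sum>i<theta_dim \<nu> N. c i * (delta (int (i + \<nu>)) n (2 * N) * a n)) \<tau>"
  proof (rule unary_theta_cong_symmetric[OF N \<tau> g1 linear_growth_sum])
    fix n
    have "exp (- (of_real pi * \<i> * of_int (n * k) / of_nat N)) * a n
        + exp (- (of_real pi * \<i> * of_int (- n * k) / of_nat N)) * a (- n)
        = (2 * parity_character N \<nu> k n) * a n"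
      by (simp add: parity_character_def parity ring_distribs)
    also have "\<dots> = (\<Sum>i<theta_dim \<nu> N. c i * (delta (int (i + \<nu>)) n (2 * N) * a n))
        + (\<Sum>i<theta_dim \<nu> N. c i * (delta (int (i + \<nu>)) (- n) (2 * N) * a (- n)))"
      unfolding parity_character_expansion[OF N \<nu>] sum_distrib_right sum.distrib[symmetric] parity c_def
      by (intro sum.cong refl) (simp add: ring_distribs mult_ac)
    finally show "exp (- (of_real pi * \<i> * of_int (n * k) / of_nat N)) * a n
        + exp (- (of_real pi * \<i> * of_int (- n * k) / of_nat N)) * a (- n)
       = (\<Sum>i<theta_dim \<nu> N. c i * (delta (int (i + \<nu>)) n (2 * N) * a n))
        + (\<Sum>i<theta_dim \<nu> N. c i * (delta (int (i + \<nu>)) (- n) (2 * N) * a (- n)))" .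
  qed (rule g3)
  also have "\<dots> = (\<Sum>i<theta_dim \<nu> N. unary_theta N (\<lambda>n. c i * (delta (int (i + \<nu>)) n (2 * N) * a n)) \<tau>)"
    by (rule unary_theta_sum[OF N \<tau> _ g3]) simp
  also have "\<dots> = (\<Sum>i<theta_dim \<nu> N. c i * unary_theta N (\<lambda>n. delta (int (i + \<nu>)) n (2 * N) * a n) \<tau>)"
    by (simp only: unary_theta_cmult[OF N \<tau> g2])
  finally show ?thesis unfolding c_def .
qed

section \<open>The theta vector and the vector of Eichler integrals under inversion\<close>

lemma index_mult_mat_vec_sum:
  assumes "A \<in> carrier_mat n n" "v \<in> carrier_vec n" "i < n"
  shows "vec_index (A *\<^sub>v v) i = (\<Sum>j<n. A $$ (i, j) * vec_index v j)"
  using assms by (simp add: scalar_prod_def atLeast0LessThan)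

lemma smult_mat_mult_vec:
  assumes "A \<in> carrier_mat n n" "v \<in> carrier_vec n"
  shows "(k \<cdot>\<^sub>m A) *\<^sub>v v = k \<cdot>\<^sub>v (A *\<^sub>v v)"
  using assms by (intro eq_vecI) (auto simp: scalar_prod_def sum_distrib_left mult.assoc)

lemma theta_vec_carrier [simp]: "theta_vec \<nu> N \<tau> \<in> carrier_vec (theta_dim \<nu> N)"
  by (simp add: theta_vec_def)

lemma EI_vec_carrier [simp]: "EI_vec \<nu> N \<tau> \<in> carrier_vec (theta_dim \<nu> N)"
  by (simp add: EI_vec_def)

lemma theta_eq_unary_theta: "theta \<nu> N k \<tau> = unary_theta N (class_weight N \<nu> k) \<tau>"
  by (simp add: theta_def unary_theta_def class_weight_def mult.commute[of "delta _ _ _"])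

lemma EI_theta_eq_unary_theta:
  "EI_theta \<nu> N k \<tau> = unary_theta N (signed (class_weight N (1 - \<nu>) k)) \<tau>"
  by (simp add: EI_theta_def unary_theta_def class_weight_def mult.assoc mult.commute[of "delta _ _ _"])

definition inversion_constant :: "nat \<Rightarrow> nat \<Rightarrow> complex" where
  "inversion_constant N \<nu> = (- 1) ^ \<nu> * (exp (of_real (pi / 4) * \<i>) / of_real (sqrt (2 * real N)))"

definition inversion_matrix :: "nat \<Rightarrow> nat \<Rightarrow> complex mat" where
  "inversion_matrix N \<nu> = Matrix.mat (theta_dim \<nu> N) (theta_dim \<nu> N) (\<lambda>(i, j).
     inversion_constant N \<nu> * (orbit_size N (j + \<nu>) * parity_character N \<nu> (int (i + \<nu>)) (int (j + \<nu>))))"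

definition mordell_vec :: "nat \<Rightarrow> nat \<Rightarrow> complex \<Rightarrow> complex Matrix.vec" where
  "mordell_vec \<nu> N \<tau> = Matrix.vec (theta_dim \<nu> N)
     (\<lambda>i. mordell_integral N (1 - \<nu>) (of_int (int (i + \<nu>) - int N) / (2 * real N)) \<tau>)"

lemma inversion_matrix_carrier [simp]:
  "inversion_matrix N \<nu> \<in> carrier_mat (theta_dim \<nu> N) (theta_dim \<nu> N)"
  by (simp add: inversion_matrix_def)

lemma mordell_vec_carrier [simp]: "mordell_vec \<nu> N \<tau> \<in> carrier_vec (theta_dim \<nu> N)"
  by (simp add: mordell_vec_def)

text \<open>
  The two automorphy factors belong to the weights \<open>1/2 + \<nu>\<close> and \<open>3/2 -
  \<nu>\<close>; the sign in front of the second one makes the constants equal, so that both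
  vectors transform by the same matrix.
\<close>

lemma inversion_factor_powr:
  assumes "\<tau> \<noteq> 0" and "\<nu> \<in> {0, 1}"
  shows "inversion_factor N \<nu> \<tau> = inversion_constant N \<nu> * \<tau> powr of_real (- (1/2 + real \<nu>))"
    and "- inversion_factor N (1 - \<nu>) \<tau> = inversion_constant N \<nu> * \<tau> powr of_real (- (3/2 - real \<nu>))"
proof -
  have half: "\<tau> powr of_real (- (1/2)) = \<tau> powr (- 1 / 2)" by simp
  have powr_add': "\<tau> powr (a + b) = \<tau> powr a * \<tau> powr b" for a b
    using assms(1) by (simp add: powr_def distrib_right exp_add)
  have "\<tau> powr of_real (- (3/2)) = \<tau> powr (- 1 / 2 + (- 1))" by simp
  also have "\<dots> = \<tau> powr (- 1 / 2) * \<tau> powr (- 1)" by (rule powr_add')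
  also have "\<tau> powr (- 1) = 1 / \<tau>" using assms by (simp add: powr_def exp_minus inverse_eq_divide)
  finally have three_half: "\<tau> powr of_real (- (3/2)) = \<tau> powr (- 1 / 2) * (1 / \<tau>)" .
  show "inversion_factor N \<nu> \<tau> = inversion_constant N \<nu> * \<tau> powr of_real (- (1/2 + real \<nu>))"
  proof (cases "\<nu> = 0")
    case True then show ?thesis using half by (simp add: inversion_factor_def inversion_constant_def)
  next
    case False
    then have "\<nu> = 1" using assms by auto
    then have "- (1/2 + real \<nu>) = - (3/2)" by simp
    then show ?thesis using \<open>\<nu> = 1\<close>
      by (simp only: three_half inversion_factor_def inversion_constant_def) simp
  qed
  show "- inversion_factor N (1 - \<nu>) \<tau> = inversion_constant N \<nu> * \<tau> powr of_real (- (3/2 - real \<nu>))"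
  proof (cases "\<nu> = 0")
    case True
    then have "- (3/2 - real \<nu>) = - (3/2)" by simp
    then show ?thesis using True
      by (simp only: three_half inversion_factor_def inversion_constant_def) simp
  next
    case False
    then have "\<nu> = 1" using assms by auto
    then show ?thesis using half by (simp add: inversion_factor_def inversion_constant_def)
  qed
qed

lemma theta_vec_inversion:
  assumes N: "0 < N" and \<nu>: "\<nu> \<in> {0, 1}" and \<tau>: "0 < Im \<tau>"
  shows "theta_vec \<nu> N \<tau> = (\<tau> powr of_real (- (1/2 + real \<nu>))) \<cdot>\<^sub>v (inversion_matrix N \<nu> *\<^sub>v theta_vec \<nu> N (- 1 / \<tau>))"
proof (rule eq_vecI)
  fix i assume "i < dim_vec ((\<tau> powr of_real (- (1/2 + real \<nu>))) \<cdot>\<^sub>v (inversion_matrix N \<nu> *\<^sub>v theta_vec \<nu> N (- 1 / \<tau>)))"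
  then have i: "i < theta_dim \<nu> N" by (simp add: inversion_matrix_def)
  have p: "\<nu> \<le> 1" and \<tau>0: "\<tau> \<noteq> 0" using \<nu> \<tau> by auto
  have "theta \<nu> N (int (i + \<nu>)) \<tau>
      = inversion_factor N \<nu> \<tau> * unary_theta N (character_weight N \<nu> (int (i + \<nu>))) (- 1 / \<tau>)"
    unfolding theta_eq_unary_theta by (rule unary_theta_inversion[OF N p \<tau>])
  also have "unary_theta N (character_weight N \<nu> (int (i + \<nu>))) (- 1 / \<tau>)
      = (\<Sum>j<theta_dim \<nu> N. orbit_size N (j + \<nu>) * parity_character N \<nu> (int (i + \<nu>)) (int (j + \<nu>))
          * theta \<nu> N (int (j + \<nu>)) (- 1 / \<tau>))"
    unfolding theta_eq_unary_theta character_weight_def class_weight_def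
    by (rule unary_theta_character_expansion[OF N \<nu> inversion_in_upper_half_plane[OF \<tau>] linear_growth_power[OF p]])
       (use \<nu> in auto)
  finally show "vec_index (theta_vec \<nu> N \<tau>) i
      = vec_index ((\<tau> powr of_real (- (1/2 + real \<nu>))) \<cdot>\<^sub>v (inversion_matrix N \<nu> *\<^sub>v theta_vec \<nu> N (- 1 / \<tau>))) i"
    using i unfolding inversion_factor_powr(1)[OF \<tau>0 \<nu>]
    by (simp add: theta_vec_def inversion_matrix_def scalar_prod_def atLeast0LessThan sum_distrib_left mult_ac)
qed (simp add: inversion_matrix_def theta_vec_def)

lemma EI_vec_inversion:
  assumes N: "0 < N" and \<nu>: "\<nu> \<in> {0, 1}" and \<tau>: "0 < Im \<tau>"
  shows "EI_vec \<nu> N \<tau> = (\<tau> powr of_real (- (3/2 - real \<nu>))) \<cdot>\<^sub>v (inversion_matrix N \<nu> *\<^sub>v EI_vec \<nu> N (- 1 / \<tau>))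
     + mordell_vec \<nu> N \<tau>"
proof (rule eq_vecI)
  fix i assume "i < dim_vec ((\<tau> powr of_real (- (3/2 - real \<nu>))) \<cdot>\<^sub>v (inversion_matrix N \<nu> *\<^sub>v EI_vec \<nu> N (- 1 / \<tau>))
     + mordell_vec \<nu> N \<tau>)"
  then have i: "i < theta_dim \<nu> N" by (simp add: mordell_vec_def)
  define k where "k = int (i + \<nu>)"
  have k: "0 \<le> k" "k \<le> int N" "k = 0 \<longrightarrow> 1 - \<nu> = 1"
    using i \<nu> N by (auto simp: k_def theta_dim_def)
  have p: "1 - \<nu> \<le> 1" and \<tau>0: "\<tau> \<noteq> 0" using \<tau> by auto
  have "EI_theta \<nu> N k \<tau> = - inversion_factor N (1 - \<nu>) \<tau>
        * unary_theta N (signed (character_weight N (1 - \<nu>) k)) (- 1 / \<tau>)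
       + mordell_integral N (1 - \<nu>) (of_int (k - int N) / (2 * real N)) \<tau>"
    unfolding EI_theta_eq_unary_theta by (rule false_theta_inversion[OF N p k \<tau>])
  moreover have "unary_theta N (signed (character_weight N (1 - \<nu>) k)) (- 1 / \<tau>)
      = unary_theta N (\<lambda>n. exp (- (of_real pi * \<i> * of_int (n * k) / of_nat N)) * (of_int (sgn n) * of_int (n ^ (1 - \<nu>)))) (- 1 / \<tau>)"
    unfolding character_weight_def by (simp only: mult.left_commute)
  moreover have "\<dots> = (\<Sum>j<theta_dim \<nu> N. orbit_size N (j + \<nu>) * parity_character N \<nu> k (int (j + \<nu>))
          * unary_theta N (\<lambda>n. delta (int (j + \<nu>)) n (2 * N) * (of_int (sgn n) * of_int (n ^ (1 - \<nu>)))) (- 1 / \<tau>))"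
    by (rule unary_theta_character_expansion[OF N \<nu> inversion_in_upper_half_plane[OF \<tau>] sgn_growth[OF linear_growth_power[OF p]]])
       (use \<nu> in auto)
  moreover have "unary_theta N (\<lambda>n. delta (int (j + \<nu>)) n (2 * N) * (of_int (sgn n) * of_int (n ^ (1 - \<nu>)))) (- 1 / \<tau>)
     = EI_theta \<nu> N (int (j + \<nu>)) (- 1 / \<tau>)" for j
    unfolding EI_theta_eq_unary_theta class_weight_def by (simp only: mult.left_commute)
  ultimately have "EI_theta \<nu> N k \<tau> = - inversion_factor N (1 - \<nu>) \<tau>
      * (\<Sum>j<theta_dim \<nu> N. orbit_size N (j + \<nu>) * parity_character N \<nu> k (int (j + \<nu>)) * EI_theta \<nu> N (int (j + \<nu>)) (- 1 / \<tau>))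
       + mordell_integral N (1 - \<nu>) (of_int (k - int N) / (2 * real N)) \<tau>" by (simp only:)
  then show "vec_index (EI_vec \<nu> N \<tau>) i = vec_index ((\<tau> powr of_real (- (3/2 - real \<nu>)))
      \<cdot>\<^sub>v (inversion_matrix N \<nu> *\<^sub>v EI_vec \<nu> N (- 1 / \<tau>)) + mordell_vec \<nu> N \<tau>) i"
    using i unfolding inversion_factor_powr(2)[OF \<tau>0 \<nu>] k_def
    by (simp add: mordell_vec_def EI_vec_def inversion_matrix_def scalar_prod_def atLeast0LessThan sum_distrib_left mult_ac)
qed (simp add: EI_vec_def mordell_vec_def)

text \<open>
  A relation between the theta functions is a vanishing series of the kind above; its coefficient
  at \<open>n = k\<close> isolates the component \<open>k\<close>. This makes the multiplier
  system unique.
\<close>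

lemma theta_vec_cancel:
  assumes N: "0 < N" and \<nu>: "\<nu> \<in> {0, 1}"
    and A: "A \<in> carrier_mat (theta_dim \<nu> N) (theta_dim \<nu> N)" and B: "B \<in> carrier_mat (theta_dim \<nu> N) (theta_dim \<nu> N)"
    and eq: "\<And>\<tau>. 0 < Im \<tau> \<Longrightarrow> A *\<^sub>v theta_vec \<nu> N \<tau> = B *\<^sub>v theta_vec \<nu> N \<tau>"
  shows "A = B"
proof (rule eq_matI)
  fix i j assume "i < dim_row B" "j < dim_col B"
  then have i: "i < theta_dim \<nu> N" and j: "j < theta_dim \<nu> N" using B by auto
  have p: "\<nu> \<le> 1" using \<nu> by auto
  define c where "c = (\<lambda>l. A $$ (i, l) - B $$ (i, l))"
  define w where "w = (\<lambda>n. \<Sum>l<theta_dim \<nu> N. c l * class_weight N \<nu> (int (l + \<nu>)) n)"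
  have g: "linear_growth (\<lambda>n. c l * class_weight N \<nu> (int (l + \<nu>)) n)" for l
    by (rule linear_growth_cmult[OF class_weight_growth[OF p]])
  have "unary_theta N w \<tau> = 0" if \<tau>: "0 < Im \<tau>" for \<tau>
  proof -
    have "unary_theta N w \<tau> = (\<Sum>l<theta_dim \<nu> N. c l * theta \<nu> N (int (l + \<nu>)) \<tau>)"
      unfolding w_def theta_eq_unary_theta unary_theta_cmult[OF N \<tau> class_weight_growth[OF p], symmetric]
      by (rule unary_theta_sum[OF N \<tau> _ g]) simp
    also have "\<dots> = vec_index (A *\<^sub>v theta_vec \<nu> N \<tau>) i - vec_index (B *\<^sub>v theta_vec \<nu> N \<tau>) i"
      unfolding index_mult_mat_vec_sum[OF A theta_vec_carrier i] index_mult_mat_vec_sum[OF B theta_vec_carrier i]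
      by (simp add: c_def theta_vec_def left_diff_distrib sum_subtractf)
    finally show ?thesis using eq[OF \<tau>] by simp
  qed
  moreover have "linear_growth w" unfolding w_def by (rule linear_growth_sum[OF g])
  ultimately have 0: "w (int (j + \<nu>)) + w (- int (j + \<nu>)) = 0" by (intro unary_theta_eq_0D[OF N])
  define n where "n = j + \<nu>"
  have n: "n \<le> N" using j \<nu> N by (auto simp: n_def theta_dim_def)
  have "w (int n) + w (- int n)
     = (\<Sum>l<theta_dim \<nu> N. if l = j then c j * (of_nat n ^ \<nu> * (1 + (if n = 0 \<or> n = N then (- 1) ^ \<nu> else 0))) else 0)"
    unfolding w_def sum.distrib[symmetric]
  proof (rule sum.cong[OF refl])
    fix l assume "l \<in> {..<theta_dim \<nu> N}"
    then have l: "l + \<nu> \<le> N" using \<nu> N by (auto simp: theta_dim_def)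
    \<comment> \<open>At \<open>n = 0\<close> and \<open>n = N\<close> the classes of \<open>n\<close> and
         \<open>-n\<close> coincide, so the coefficient doubles there.\<close>
    have m: "of_int ((- int n) ^ \<nu>) = (- 1 :: complex) ^ \<nu> * of_nat n ^ \<nu>" using \<nu> by auto
    have p1: "of_int (int n ^ \<nu>) = (of_nat n ^ \<nu> :: complex)" by simp
    have ln: "l + \<nu> = n \<longleftrightarrow> l = j" by (auto simp: n_def)
    show "c l * class_weight N \<nu> (int (l + \<nu>)) (int n) + c l * class_weight N \<nu> (int (l + \<nu>)) (- int n)
       = (if l = j then c j * (of_nat n ^ \<nu> * (1 + (if n = 0 \<or> n = N then (- 1) ^ \<nu> else 0))) else 0)"
      unfolding class_weight_def delta_fundamental_range[OF N l n] m p1 ln by (auto simp: algebra_simps)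
  qed
  also have "\<dots> = c j * (of_nat n ^ \<nu> * (1 + (if n = 0 \<or> n = N then (- 1) ^ \<nu> else 0)))" using j by simp
  finally have "c j * (of_nat n ^ \<nu> * (1 + (if n = 0 \<or> n = N then (- 1) ^ \<nu> else 0))) = 0" using 0 by (simp add: n_def)
  moreover have "of_nat n ^ \<nu> * (1 + (if n = 0 \<or> n = N then (- 1) ^ \<nu> else 0)) \<noteq> (0 :: complex)"
  proof (cases "\<nu> = 0")
    case False
    then have "\<nu> = 1" "n \<noteq> 0" "n \<noteq> N" using \<nu> j N by (auto simp: n_def theta_dim_def)
    then show ?thesis by simp
  qed simp
  ultimately have "c j = 0" using mult_eq_0_iff by blast
  then show "A $$ (i, j) = B $$ (i, j)" by (simp add: c_def)
qed (use A B in auto)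

lemma Ln_minus_inverse:
  assumes "0 < Im \<tau>"
  shows "Ln (- 1 / \<tau>) = of_real pi * \<i> - Ln \<tau>"
proof (rule Ln_unique)
  have "\<tau> \<noteq> 0" using assms by auto
  then show "exp (of_real pi * \<i> - Ln \<tau>) = - 1 / \<tau>" by (simp add: exp_diff)
  show "- pi < Im (of_real pi * \<i> - Ln \<tau>)" "Im (of_real pi * \<i> - Ln \<tau>) \<le> pi"
    using Im_Ln_pos_lt[OF \<open>\<tau> \<noteq> 0\<close>] assms by auto
qed

text \<open>
  Inverting twice is the identity, so the square of the matrix is a scalar by linear independence.
\<close>

lemma inversion_matrix_invertible:
  assumes N: "0 < N" and \<nu>: "\<nu> \<in> {0, 1}"
  obtains K where "K \<in> carrier_mat (theta_dim \<nu> N) (theta_dim \<nu> N)"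
    "inversion_matrix N \<nu> * K = 1\<^sub>m (theta_dim \<nu> N)" "K * inversion_matrix N \<nu> = 1\<^sub>m (theta_dim \<nu> N)"
proof -
  define d where "d = theta_dim \<nu> N"
  define A where "A = inversion_matrix N \<nu>"
  define x where "x = complex_of_real (- (1/2 + real \<nu>))"
  define z where "z = exp (x * (of_real pi * \<i>))"
  have A: "A \<in> carrier_mat d d" by (simp add: A_def d_def)
  have "z \<cdot>\<^sub>m (A * A) = 1\<^sub>m d"
  proof (rule theta_vec_cancel[OF N \<nu>, folded d_def])
    fix \<tau> :: complex assume \<tau>: "0 < Im \<tau>"
    let ?v = "theta_vec \<nu> N \<tau>"
    have v: "?v \<in> carrier_vec d" by (simp add: d_def)
    have \<tau>0: "\<tau> \<noteq> 0" using \<tau> by auto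
    have "theta_vec \<nu> N (- 1 / \<tau>) = ((- 1 / \<tau>) powr x) \<cdot>\<^sub>v (A *\<^sub>v ?v)"
      using theta_vec_inversion[OF N \<nu> inversion_in_upper_half_plane[OF \<tau>]] \<tau>0 by (simp add: A_def x_def)
    then have "?v = (\<tau> powr x) \<cdot>\<^sub>v (A *\<^sub>v (((- 1 / \<tau>) powr x) \<cdot>\<^sub>v (A *\<^sub>v ?v)))"
      using theta_vec_inversion[OF N \<nu> \<tau>] by (simp add: A_def x_def)
    also have "A *\<^sub>v (((- 1 / \<tau>) powr x) \<cdot>\<^sub>v (A *\<^sub>v ?v)) = ((- 1 / \<tau>) powr x) \<cdot>\<^sub>v (A *\<^sub>v (A *\<^sub>v ?v))"
      using A v by (intro mult_mat_vec) auto
    also have "A *\<^sub>v (A *\<^sub>v ?v) = (A * A) *\<^sub>v ?v" using A v by (simp add: assoc_mult_mat_vec)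
    also have "(\<tau> powr x) \<cdot>\<^sub>v (((- 1 / \<tau>) powr x) \<cdot>\<^sub>v ((A * A) *\<^sub>v ?v)) = (\<tau> powr x * (- 1 / \<tau>) powr x) \<cdot>\<^sub>v ((A * A) *\<^sub>v ?v)"
      by (rule smult_smult_assoc)
    also have "\<tau> powr x * (- 1 / \<tau>) powr x = z"
    proof -
      have "\<tau> powr x * (- 1 / \<tau>) powr x = exp (x * Ln \<tau>) * exp (x * (of_real pi * \<i> - Ln \<tau>))"
        using \<tau>0 unfolding powr_def Ln_minus_inverse[OF \<tau>] by simp
      then show ?thesis by (simp add: z_def exp_add[symmetric] algebra_simps)
    qed
    also have "z \<cdot>\<^sub>v ((A * A) *\<^sub>v ?v) = (z \<cdot>\<^sub>m (A * A)) *\<^sub>v ?v"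
      using A v by (intro smult_mat_mult_vec[symmetric]) auto
    finally show "(z \<cdot>\<^sub>m (A * A)) *\<^sub>v ?v = 1\<^sub>m d *\<^sub>v ?v" using v by simp
  qed (use A in auto)
  then have "A * (z \<cdot>\<^sub>m A) = 1\<^sub>m d" "(z \<cdot>\<^sub>m A) * A = 1\<^sub>m d"
    using A by (simp_all add: mult_smult_distrib mult_smult_assoc_mat)
  then show ?thesis using that[of "z \<cdot>\<^sub>m A"] A by (simp add: A_def d_def)
qed

section \<open>Extendability of the cocycle for a single matrix\<close>

definition cocycle_base :: "int \<Rightarrow> int \<Rightarrow> complex \<Rightarrow> complex" where
  "cocycle_base c d \<tau> = of_int c * \<tau> + of_int d"

definition moebius_map :: "int \<Rightarrow> int \<Rightarrow> int \<Rightarrow> int \<Rightarrow> complex \<Rightarrow> complex" where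
  "moebius_map a b c d \<tau> = (of_int a * \<tau> + of_int b) / cocycle_base c d \<tau>"

definition extension_domain :: "int \<Rightarrow> int \<Rightarrow> complex set" where
  "extension_domain c d = {\<tau>. 0 < Im \<tau> \<or> cocycle_base c d \<tau> \<notin> \<real>\<^sub>\<le>\<^sub>0}"

text \<open>
  The claim for one matrix with rows \<open>(a, b)\<close> and \<open>(c, d)\<close>, including
  the existence of its multiplier \<open>M\<close>. It is stated with the inverse
  \<open>M'\<close> of the multiplier, as it occurs in the cocycle, and with the cocycle
  \<open>g\<close> moved to the other side.
\<close>

definition quantum_at :: "nat \<Rightarrow> nat \<Rightarrow> int \<Rightarrow> int \<Rightarrow> int \<Rightarrow> int \<Rightarrow> bool" where
  "quantum_at \<nu> N a b c d \<longleftrightarrow> a * d - b * c = 1 \<and>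
     (\<exists>M M' g. M \<in> carrier_mat (theta_dim \<nu> N) (theta_dim \<nu> N) \<and> M' \<in> carrier_mat (theta_dim \<nu> N) (theta_dim \<nu> N)
       \<and> M * M' = 1\<^sub>m (theta_dim \<nu> N) \<and> M' * M = 1\<^sub>m (theta_dim \<nu> N)
       \<and> (\<forall>\<tau>. 0 < Im \<tau> \<longrightarrow> theta_vec \<nu> N \<tau> =
            (cocycle_base c d \<tau> powr of_real (- (1/2 + real \<nu>))) \<cdot>\<^sub>v (M' *\<^sub>v theta_vec \<nu> N (moebius_map a b c d \<tau>)))
       \<and> holomorphic_vec_on (theta_dim \<nu> N) g (extension_domain c d)
       \<and> (\<forall>\<tau>. 0 < Im \<tau> \<longrightarrow> EI_vec \<nu> N \<tau> + g \<tau> =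
            (cocycle_base c d \<tau> powr of_real (- (3/2 - real \<nu>))) \<cdot>\<^sub>v (M' *\<^sub>v EI_vec \<nu> N (moebius_map a b c d \<tau>))))"

lemma cocycle_base_nonzero:
  assumes "a * d - b * c = (1 :: int)" "0 < Im \<tau>"
  shows "cocycle_base c d \<tau> \<noteq> 0"
proof
  assume "cocycle_base c d \<tau> = 0"
  then have "Im (cocycle_base c d \<tau>) = 0" "Re (cocycle_base c d \<tau>) = 0" by simp_all
  then have "c = 0" "d = 0" using assms(2) by (auto simp: cocycle_base_def)
  then show False using assms(1) by simp
qed

lemma moebius_in_upper_half_plane:
  assumes det: "a * d - b * c = (1 :: int)" and \<tau>: "0 < Im \<tau>"
  shows "0 < Im (moebius_map a b c d \<tau>)"
proof -
  let ?J = "cocycle_base c d \<tau>"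
  have J: "?J \<noteq> 0" by (rule cocycle_base_nonzero[OF det \<tau>])
  have "Im ((of_int a * \<tau> + of_int b) * cnj ?J) = of_int (a * d - b * c) * Im \<tau>"
    by (simp add: cocycle_base_def algebra_simps)
  then have "Im ((of_int a * \<tau> + of_int b) * cnj ?J) = Im \<tau>" by (simp add: det)
  moreover have "moebius_map a b c d \<tau> = (of_int a * \<tau> + of_int b) * cnj ?J / of_real ((norm ?J)\<^sup>2)"
    unfolding moebius_map_def using complex_div_cnj[of _ ?J] by simp
  ultimately have "Im (moebius_map a b c d \<tau>) = Im \<tau> / (norm ?J)\<^sup>2" by (simp only: Im_divide_of_real)
  then show ?thesis using J \<tau> by simp
qed

lemma moebius_compose:
  fixes a1 b1 c1 d1 a2 b2 c2 d2 :: int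
  assumes "cocycle_base c2 d2 \<tau> \<noteq> 0"
  shows "cocycle_base (c1 * a2 + d1 * c2) (c1 * b2 + d1 * d2) \<tau>
      = cocycle_base c1 d1 (moebius_map a2 b2 c2 d2 \<tau>) * cocycle_base c2 d2 \<tau>"
    and "moebius_map (a1 * a2 + b1 * c2) (a1 * b2 + b1 * d2) (c1 * a2 + d1 * c2) (c1 * b2 + d1 * d2) \<tau>
      = moebius_map a1 b1 c1 d1 (moebius_map a2 b2 c2 d2 \<tau>)"
proof -
  have lin: "of_int x * (of_int a2 * \<tau> + of_int b2) + of_int y * cocycle_base c2 d2 \<tau>
      = (of_int x * moebius_map a2 b2 c2 d2 \<tau> + of_int y) * cocycle_base c2 d2 \<tau>" for x y :: int
  proof -
    have "moebius_map a2 b2 c2 d2 \<tau> * cocycle_base c2 d2 \<tau> = of_int a2 * \<tau> + of_int b2"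
      using assms by (simp add: moebius_map_def)
    then show ?thesis by (simp only: distrib_right mult.assoc)
  qed
  have lin': "of_int (x * a2 + y * c2) * \<tau> + of_int (x * b2 + y * d2)
      = (of_int x * moebius_map a2 b2 c2 d2 \<tau> + of_int y) * cocycle_base c2 d2 \<tau>" for x y :: int
    unfolding lin[symmetric] by (simp add: cocycle_base_def algebra_simps)
  show J: "cocycle_base (c1 * a2 + d1 * c2) (c1 * b2 + d1 * d2) \<tau>
      = cocycle_base c1 d1 (moebius_map a2 b2 c2 d2 \<tau>) * cocycle_base c2 d2 \<tau>"
    using lin'[of c1 d1] by (simp only: cocycle_base_def)
  show "moebius_map (a1 * a2 + b1 * c2) (a1 * b2 + b1 * d2) (c1 * a2 + d1 * c2) (c1 * b2 + d1 * d2) \<tau>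
      = moebius_map a1 b1 c1 d1 (moebius_map a2 b2 c2 d2 \<tau>)"
    unfolding moebius_map_def[of "a1 * a2 + b1 * c2"] J lin' using assms by (simp add: moebius_map_def)
qed

lemma holomorphic_vec_on_componentI:
  assumes "\<And>\<tau>. \<tau> \<in> X \<Longrightarrow> f \<tau> \<in> carrier_vec r"
    and "\<And>i. i < r \<Longrightarrow> (\<lambda>\<tau>. vec_index (f \<tau>) i) holomorphic_on X"
  shows "holomorphic_vec_on r f X"
  using assms by (simp add: holomorphic_vec_on_def)

lemma holomorphic_vec_on_subset:
  "holomorphic_vec_on r f X \<Longrightarrow> Y \<subseteq> X \<Longrightarrow> holomorphic_vec_on r f Y"
  unfolding holomorphic_vec_on_def using holomorphic_on_subset by blast

lemma holomorphic_vec_on_add: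
  assumes "holomorphic_vec_on r f X" "holomorphic_vec_on r g X"
  shows "holomorphic_vec_on r (\<lambda>\<tau>. f \<tau> + g \<tau>) X"
proof (rule holomorphic_vec_on_componentI)
  show "f \<tau> + g \<tau> \<in> carrier_vec r" if "\<tau> \<in> X" for \<tau>
    using assms that by (auto simp: holomorphic_vec_on_def)
  fix i assume i: "i < r"
  have "(\<lambda>\<tau>. vec_index (f \<tau>) i + vec_index (g \<tau>) i) holomorphic_on X"
    using assms i by (intro holomorphic_on_add) (auto simp: holomorphic_vec_on_def)
  then show "(\<lambda>\<tau>. vec_index (f \<tau> + g \<tau>) i) holomorphic_on X"
    by (rule holomorphic_transform) (use assms i in \<open>auto simp: holomorphic_vec_on_def\<close>)
qed

lemma holomorphic_vec_on_smult:
  assumes "h holomorphic_on X" "holomorphic_vec_on r f X"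
  shows "holomorphic_vec_on r (\<lambda>\<tau>. h \<tau> \<cdot>\<^sub>v f \<tau>) X"
proof (rule holomorphic_vec_on_componentI)
  show "h \<tau> \<cdot>\<^sub>v f \<tau> \<in> carrier_vec r" if "\<tau> \<in> X" for \<tau>
    using assms that by (auto simp: holomorphic_vec_on_def)
  fix i assume i: "i < r"
  have "(\<lambda>\<tau>. h \<tau> * vec_index (f \<tau>) i) holomorphic_on X"
    using assms i by (intro holomorphic_on_mult) (auto simp: holomorphic_vec_on_def)
  then show "(\<lambda>\<tau>. vec_index (h \<tau> \<cdot>\<^sub>v f \<tau>) i) holomorphic_on X"
    by (rule holomorphic_transform) (use assms i in \<open>auto simp: holomorphic_vec_on_def\<close>)
qed

lemma holomorphic_vec_on_mult_mat:
  assumes "A \<in> carrier_mat r r" "holomorphic_vec_on r f X"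
  shows "holomorphic_vec_on r (\<lambda>\<tau>. A *\<^sub>v f \<tau>) X"
proof (rule holomorphic_vec_on_componentI)
  show "A *\<^sub>v f \<tau> \<in> carrier_vec r" if "\<tau> \<in> X" for \<tau>
    using assms that by (auto simp: holomorphic_vec_on_def)
  fix i assume i: "i < r"
  have "(\<lambda>\<tau>. \<Sum>j<r. A $$ (i, j) * vec_index (f \<tau>) j) holomorphic_on X"
    using assms by (intro holomorphic_on_sum holomorphic_on_mult) (auto simp: holomorphic_vec_on_def)
  then show "(\<lambda>\<tau>. vec_index (A *\<^sub>v f \<tau>) i) holomorphic_on X"
    by (rule holomorphic_transform)
       (use assms i in \<open>auto simp: holomorphic_vec_on_def index_mult_mat_vec_sum[symmetric]\<close>)
qed

lemma holomorphic_vec_on_compose: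
  assumes "m holomorphic_on X" "m ` X \<subseteq> Y" "holomorphic_vec_on r f Y"
  shows "holomorphic_vec_on r (\<lambda>\<tau>. f (m \<tau>)) X"
proof (rule holomorphic_vec_on_componentI)
  show "f (m \<tau>) \<in> carrier_vec r" if "\<tau> \<in> X" for \<tau>
    using assms that by (auto simp: holomorphic_vec_on_def)
  fix i assume "i < r"
  then have "(\<lambda>\<tau>. vec_index (f \<tau>) i) holomorphic_on Y" using assms by (simp add: holomorphic_vec_on_def)
  from holomorphic_on_compose_gen[OF assms(1) this assms(2)]
  show "(\<lambda>\<tau>. vec_index (f (m \<tau>)) i) holomorphic_on X" by (simp add: o_def)
qed

lemma EI_vec_holomorphic:
  assumes "0 < N"
  shows "holomorphic_vec_on (theta_dim \<nu> N) (EI_vec \<nu> N) upper_half_plane"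
proof (rule holomorphic_vec_on_componentI)
  fix i assume i: "i < theta_dim \<nu> N"
  have "unary_theta N (signed (class_weight N (1 - \<nu>) (int (i + \<nu>)))) holomorphic_on upper_half_plane"
    by (intro unary_theta_holomorphic assms sgn_growth class_weight_growth) simp
  then show "(\<lambda>\<tau>. vec_index (EI_vec \<nu> N \<tau>) i) holomorphic_on upper_half_plane"
    using i by (simp add: EI_vec_def EI_theta_eq_unary_theta)
qed simp

lemma mult_mat_inverse:
  fixes A A' B B' :: "complex mat"
  assumes "A \<in> carrier_mat r r" "A' \<in> carrier_mat r r" "B \<in> carrier_mat r r" "B' \<in> carrier_mat r r"
    and "A * A' = 1\<^sub>m r" "B * B' = 1\<^sub>m r"
  shows "(A * B) * (B' * A') = 1\<^sub>m r"
proof -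
  have "(A * B) * (B' * A') = A * (B * (B' * A'))"
    by (rule assoc_mult_mat[OF assms(1,3) mult_carrier_mat[OF assms(4,2)]])
  also have "B * (B' * A') = (B * B') * A'" by (rule assoc_mult_mat[OF assms(3,4,2), symmetric])
  finally show ?thesis unfolding assms(6) left_mult_one_mat[OF assms(2)] assms(5) .
qed

text \<open>
  The cocycle relation \<open>g12(\<tau>) = g2(\<tau>) + j2(\<tau>)^(-\<eta>) M2' g1(\<gamma>2
  \<tau>)\<close>. The right-hand side makes sense wherever \<open>j2\<close> avoids the branch
  cut and \<open>\<gamma>2 \<tau>\<close> is in the domain of \<open>g1\<close>. The hypothesis on
  branches keeps the principal powers multiplicative for both weights at once.
\<close>

lemma quantum_at_compose:
  fixes a1 b1 c1 d1 a2 b2 c2 d2 :: int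
  assumes 1: "quantum_at \<nu> N a1 b1 c1 d1" and 2: "quantum_at \<nu> N a2 b2 c2 d2"
  defines "a \<equiv> a1 * a2 + b1 * c2" and "b \<equiv> a1 * b2 + b1 * d2"
    and "c \<equiv> c1 * a2 + d1 * c2" and "d \<equiv> c1 * b2 + d1 * d2"
  assumes branch: "\<And>\<tau> x. 0 < Im \<tau> \<Longrightarrow> (cocycle_base c1 d1 (moebius_map a2 b2 c2 d2 \<tau>) * cocycle_base c2 d2 \<tau>) powr x
      = cocycle_base c1 d1 (moebius_map a2 b2 c2 d2 \<tau>) powr x * cocycle_base c2 d2 \<tau> powr x"
    and dom: "\<And>\<tau>. \<tau> \<in> extension_domain c d \<Longrightarrow> cocycle_base c2 d2 \<tau> \<notin> \<real>\<^sub>\<le>\<^sub>0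
      \<and> moebius_map a2 b2 c2 d2 \<tau> \<in> extension_domain c1 d1"
  shows "quantum_at \<nu> N a b c d"
proof -
  define r where "r = theta_dim \<nu> N"
  define J1 where "J1 = cocycle_base c1 d1"
  define J2 where "J2 = cocycle_base c2 d2"
  define m1 where "m1 = moebius_map a1 b1 c1 d1"
  define m2 where "m2 = moebius_map a2 b2 c2 d2"
  define w where "w = complex_of_real (- (1/2 + real \<nu>))"
  define x where "x = complex_of_real (- (3/2 - real \<nu>))"
  note defs = r_def[symmetric] J1_def[symmetric] J2_def[symmetric] m1_def[symmetric] m2_def[symmetric]
    w_def[symmetric] x_def[symmetric]
  from 1 obtain M1 M1' g1 where A1: "a1 * d1 - b1 * c1 = 1" "M1 \<in> carrier_mat r r" "M1' \<in> carrier_mat r r"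
    "M1 * M1' = 1\<^sub>m r" "M1' * M1 = 1\<^sub>m r"
    "\<And>\<tau>. 0 < Im \<tau> \<Longrightarrow> theta_vec \<nu> N \<tau> = (J1 \<tau> powr w) \<cdot>\<^sub>v (M1' *\<^sub>v theta_vec \<nu> N (m1 \<tau>))"
    "holomorphic_vec_on r g1 (extension_domain c1 d1)"
    "\<And>\<tau>. 0 < Im \<tau> \<Longrightarrow> EI_vec \<nu> N \<tau> + g1 \<tau> = (J1 \<tau> powr x) \<cdot>\<^sub>v (M1' *\<^sub>v EI_vec \<nu> N (m1 \<tau>))"
    unfolding quantum_at_def defs by blast
  from 2 obtain M2 M2' g2 where A2: "a2 * d2 - b2 * c2 = 1" "M2 \<in> carrier_mat r r" "M2' \<in> carrier_mat r r"
    "M2 * M2' = 1\<^sub>m r" "M2' * M2 = 1\<^sub>m r"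
    "\<And>\<tau>. 0 < Im \<tau> \<Longrightarrow> theta_vec \<nu> N \<tau> = (J2 \<tau> powr w) \<cdot>\<^sub>v (M2' *\<^sub>v theta_vec \<nu> N (m2 \<tau>))"
    "holomorphic_vec_on r g2 (extension_domain c2 d2)"
    "\<And>\<tau>. 0 < Im \<tau> \<Longrightarrow> EI_vec \<nu> N \<tau> + g2 \<tau> = (J2 \<tau> powr x) \<cdot>\<^sub>v (M2' *\<^sub>v EI_vec \<nu> N (m2 \<tau>))"
    unfolding quantum_at_def defs by blast
  have det: "a * d - b * c = 1"
  proof -
    have "a * d - b * c = (a1 * d1 - b1 * c1) * (a2 * d2 - b2 * c2)"
      by (simp add: a_def b_def c_def d_def algebra_simps)
    then show ?thesis using A1(1) A2(1) by simp
  qed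
  have H: "0 < Im (m2 \<tau>)" "J2 \<tau> \<noteq> 0" "moebius_map a b c d \<tau> = m1 (m2 \<tau>)"
      "\<And>y. cocycle_base c d \<tau> powr y = J2 \<tau> powr y * J1 (m2 \<tau>) powr y" if \<tau>: "0 < Im \<tau>" for \<tau>
  proof -
    show "0 < Im (m2 \<tau>)" unfolding m2_def by (rule moebius_in_upper_half_plane[OF A2(1) \<tau>])
    show J: "J2 \<tau> \<noteq> 0" unfolding J2_def by (rule cocycle_base_nonzero[OF A2(1) \<tau>])
    show "moebius_map a b c d \<tau> = m1 (m2 \<tau>)"
      using moebius_compose(2)[OF J[unfolded J2_def], of a1 a2 b1 b2 c1 d1]
      by (simp only: J2_def a_def b_def c_def d_def m1_def m2_def)
    show "cocycle_base c d \<tau> powr y = J2 \<tau> powr y * J1 (m2 \<tau>) powr y" for y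
      using moebius_compose(1)[OF J[unfolded J2_def], of c1 a2 d1 b2] branch[OF \<tau>, of y]
      by (simp only: J1_def J2_def c_def d_def m2_def mult.commute)
  qed
  define M where "M = M1 * M2"
  define M' where "M' = M2' * M1'"
  define g where "g = (\<lambda>\<tau>. g2 \<tau> + (J2 \<tau> powr x) \<cdot>\<^sub>v (M2' *\<^sub>v g1 (m2 \<tau>)))"
  have dimM: "M \<in> carrier_mat r r" "M' \<in> carrier_mat r r" using A1 A2 by (auto simp: M_def M'_def)
  have MM': "M * M' = 1\<^sub>m r" "M' * M = 1\<^sub>m r"
    unfolding M_def M'_def by (intro mult_mat_inverse A1 A2)+
  have pull: "(p \<cdot>\<^sub>v (M2' *\<^sub>v (q \<cdot>\<^sub>v (M1' *\<^sub>v v)))) = (p * q) \<cdot>\<^sub>v (M' *\<^sub>v v)" if v: "v \<in> carrier_vec r" for p q v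
  proof -
    have "M2' *\<^sub>v (q \<cdot>\<^sub>v (M1' *\<^sub>v v)) = q \<cdot>\<^sub>v (M2' *\<^sub>v (M1' *\<^sub>v v))"
      by (rule mult_mat_vec[OF A2(3)]) (use A1(3) v in auto)
    also have "M2' *\<^sub>v (M1' *\<^sub>v v) = M' *\<^sub>v v"
      unfolding M'_def by (rule assoc_mult_mat_vec[OF A2(3) A1(3) v, symmetric])
    finally show ?thesis by (simp add: smult_smult_assoc)
  qed
  have theta: "theta_vec \<nu> N \<tau> = (cocycle_base c d \<tau> powr w) \<cdot>\<^sub>v (M' *\<^sub>v theta_vec \<nu> N (moebius_map a b c d \<tau>))"
    if \<tau>: "0 < Im \<tau>" for \<tau>
  proof -
    have T: "theta_vec \<nu> N \<tau> \<in> carrier_vec r" for \<tau> by (simp add: r_def)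
    have "theta_vec \<nu> N \<tau> = (J2 \<tau> powr w) \<cdot>\<^sub>v (M2' *\<^sub>v theta_vec \<nu> N (m2 \<tau>))" by (rule A2(6)[OF \<tau>])
    also have "theta_vec \<nu> N (m2 \<tau>) = (J1 (m2 \<tau>) powr w) \<cdot>\<^sub>v (M1' *\<^sub>v theta_vec \<nu> N (m1 (m2 \<tau>)))"
      by (rule A1(6)[OF H(1)[OF \<tau>]])
    finally show ?thesis unfolding H(3,4)[OF \<tau>] by (simp only: pull[OF T])
  qed
  have sub2: "extension_domain c d \<subseteq> extension_domain c2 d2" using dom by (auto simp: extension_domain_def)
  have m2_dom: "m2 ` extension_domain c d \<subseteq> extension_domain c1 d1" using dom by (auto simp: m2_def)
  have J2_slit: "J2 \<tau> \<notin> \<real>\<^sub>\<le>\<^sub>0" if "\<tau> \<in> extension_domain c d" for \<tau> using dom[OF that] by (simp add: J2_def)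
  have J2_hol: "J2 holomorphic_on X" for X
    unfolding J2_def cocycle_base_def by (intro holomorphic_intros)
  have m2_hol: "m2 holomorphic_on extension_domain c d"
    unfolding m2_def moebius_map_def J2_def[symmetric]
    by (intro holomorphic_on_divide J2_hol holomorphic_intros) (use J2_slit in force)
  have pow_hol: "(\<lambda>\<tau>. J2 \<tau> powr x) holomorphic_on extension_domain c d"
    by (intro holomorphic_intros J2_hol J2_slit)
  have g_hol: "holomorphic_vec_on r g (extension_domain c d)"
    unfolding g_def
    by (intro holomorphic_vec_on_add holomorphic_vec_on_smult pow_hol
        holomorphic_vec_on_mult_mat[OF A2(3)] holomorphic_vec_on_compose[OF m2_hol m2_dom A1(7)]
        holomorphic_vec_on_subset[OF A2(7) sub2])
  have EI: "EI_vec \<nu> N \<tau> + g \<tau> = (cocycle_base c d \<tau> powr x) \<cdot>\<^sub>v (M' *\<^sub>v EI_vec \<nu> N (moebius_map a b c d \<tau>))"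
    if \<tau>: "0 < Im \<tau>" for \<tau>
  proof -
    have \<tau>_dom: "\<tau> \<in> extension_domain c d" "\<tau> \<in> extension_domain c2 d2" "m2 \<tau> \<in> extension_domain c1 d1"
      using \<tau> H(1)[OF \<tau>] by (auto simp: extension_domain_def)
    have g2: "g2 \<tau> \<in> carrier_vec r" using A2(7) \<tau>_dom by (auto simp: holomorphic_vec_on_def)
    have g1: "g1 (m2 \<tau>) \<in> carrier_vec r" using A1(7) \<tau>_dom by (auto simp: holomorphic_vec_on_def)
    have E: "EI_vec \<nu> N \<tau> \<in> carrier_vec r" for \<tau> by (simp add: r_def)
    have "EI_vec \<nu> N \<tau> + g \<tau> = (EI_vec \<nu> N \<tau> + g2 \<tau>) + (J2 \<tau> powr x) \<cdot>\<^sub>v (M2' *\<^sub>v g1 (m2 \<tau>))"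
      unfolding g_def using E[of \<tau>] g2 g1 A2(3) by (intro assoc_add_vec[symmetric]) auto
    also have "EI_vec \<nu> N \<tau> + g2 \<tau> = (J2 \<tau> powr x) \<cdot>\<^sub>v (M2' *\<^sub>v EI_vec \<nu> N (m2 \<tau>))" by (rule A2(8)[OF \<tau>])
    also have "(J2 \<tau> powr x) \<cdot>\<^sub>v (M2' *\<^sub>v EI_vec \<nu> N (m2 \<tau>)) + (J2 \<tau> powr x) \<cdot>\<^sub>v (M2' *\<^sub>v g1 (m2 \<tau>))
       = (J2 \<tau> powr x) \<cdot>\<^sub>v (M2' *\<^sub>v EI_vec \<nu> N (m2 \<tau>) + M2' *\<^sub>v g1 (m2 \<tau>))"
      by (rule smult_add_distrib_vec[OF mult_mat_vec_carrier[OF A2(3) E] mult_mat_vec_carrier[OF A2(3) g1], symmetric])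
    also have "M2' *\<^sub>v EI_vec \<nu> N (m2 \<tau>) + M2' *\<^sub>v g1 (m2 \<tau>) = M2' *\<^sub>v (EI_vec \<nu> N (m2 \<tau>) + g1 (m2 \<tau>))"
      by (rule mult_add_distrib_mat_vec[OF A2(3) E g1, symmetric])
    also have "EI_vec \<nu> N (m2 \<tau>) + g1 (m2 \<tau>) = (J1 (m2 \<tau>) powr x) \<cdot>\<^sub>v (M1' *\<^sub>v EI_vec \<nu> N (m1 (m2 \<tau>)))"
      by (rule A1(8)[OF H(1)[OF \<tau>]])
    finally show ?thesis unfolding H(3,4)[OF \<tau>] by (simp only: pull[OF E])
  qed
  show ?thesis
    unfolding quantum_at_def defs using det dimM MM' theta g_hol EI by blast
qed

section \<open>Translations, the inversion and complex conjugation\<close>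

lemma quantum_atI:
  assumes "a * d - b * c = 1"
    and "M \<in> carrier_mat (theta_dim \<nu> N) (theta_dim \<nu> N)" "M' \<in> carrier_mat (theta_dim \<nu> N) (theta_dim \<nu> N)"
    and "M * M' = 1\<^sub>m (theta_dim \<nu> N)" "M' * M = 1\<^sub>m (theta_dim \<nu> N)"
    and "\<And>\<tau>. 0 < Im \<tau> \<Longrightarrow> theta_vec \<nu> N \<tau> =
            (cocycle_base c d \<tau> powr of_real (- (1/2 + real \<nu>))) \<cdot>\<^sub>v (M' *\<^sub>v theta_vec \<nu> N (moebius_map a b c d \<tau>))"
    and "holomorphic_vec_on (theta_dim \<nu> N) g (extension_domain c d)"
    and "\<And>\<tau>. 0 < Im \<tau> \<Longrightarrow> EI_vec \<nu> N \<tau> + g \<tau> =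
            (cocycle_base c d \<tau> powr of_real (- (3/2 - real \<nu>))) \<cdot>\<^sub>v (M' *\<^sub>v EI_vec \<nu> N (moebius_map a b c d \<tau>))"
  shows "quantum_at \<nu> N a b c d"
  unfolding quantum_at_def using assms by blast

text \<open>
  On the class of \<open>k\<close> modulo \<open>2N\<close> the squares agree modulo
  \<open>4N\<close>.
\<close>

lemma unary_theta_translate:
  assumes N: "0 < N" and supp: "\<And>n. w n \<noteq> 0 \<Longrightarrow> [n = k] (mod int (2 * N))"
  shows "unary_theta N w (\<tau> + of_int t) = q_pow (of_int t) (of_int (k\<^sup>2) / (4 * real N)) * unary_theta N w \<tau>"
proof -
  have "w n * q_pow (\<tau> + of_int t) (of_int (n\<^sup>2) / (4 * real N))
     = q_pow (of_int t) (of_int (k\<^sup>2) / (4 * real N)) * (w n * q_pow \<tau> (of_int (n\<^sup>2) / (4 * real N)))" for n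
  proof (cases "w n = 0")
    case False
    from supp[OF this] have "[k = n] (mod int (2 * N))" by (rule cong_sym)
    then obtain i where i: "n = k + int (2 * N) * i" unfolding cong_iff_lin by blast
    define z where "z = t * (k * i + int N * i\<^sup>2)"
    have "n\<^sup>2 = k\<^sup>2 + 4 * int N * (k * i + int N * i\<^sup>2)" by (simp add: i power2_eq_square algebra_simps)
    then have "2 * of_real pi * \<i> * (of_int t :: complex) * of_real (of_int (n\<^sup>2) / (4 * real N))
       = 2 * of_real pi * \<i> * of_int t * of_real (of_int (k\<^sup>2) / (4 * real N)) + of_int (2 * z) * of_real pi * \<i>"
      using N by (simp add: z_def field_simps)
    then have "q_pow (of_int t) (of_int (n\<^sup>2) / (4 * real N)) = q_pow (of_int t) (of_int (k\<^sup>2) / (4 * real N))"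
      unfolding q_pow_def exp_eq by (intro exI[of _ z]) simp
    moreover have "q_pow (\<tau> + of_int t) y = q_pow \<tau> y * q_pow (of_int t) y" for y
      by (simp add: q_pow_def exp_add[symmetric] algebra_simps)
    ultimately show ?thesis by simp
  qed simp
  then show ?thesis unfolding unary_theta_def by (simp only: infsum_cmult_right')
qed

lemma class_weight_support: "class_weight N p k n \<noteq> 0 \<Longrightarrow> [n = k] (mod int (2 * N))"
  by (auto simp: class_weight_def delta_def split: if_splits)

definition diagonal_matrix :: "nat \<Rightarrow> (nat \<Rightarrow> complex) \<Rightarrow> complex mat" where
  "diagonal_matrix r e = Matrix.mat r r (\<lambda>(i, j). if i = j then e i else 0)"

lemma diagonal_matrix_carrier [simp]: "diagonal_matrix r e \<in> carrier_mat r r"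
  by (simp add: diagonal_matrix_def)

lemma diagonal_matrix_mult_vec:
  assumes "v \<in> carrier_vec r"
  shows "diagonal_matrix r e *\<^sub>v v = Matrix.vec r (\<lambda>i. e i * vec_index v i)"
proof (rule eq_vecI)
  fix i assume "i < dim_vec (Matrix.vec r (\<lambda>i. e i * vec_index v i))"
  then have i: "i < r" by simp
  have "vec_index (diagonal_matrix r e *\<^sub>v v) i = (\<Sum>j<r. (if i = j then e i else 0) * vec_index v j)"
    unfolding index_mult_mat_vec_sum[OF diagonal_matrix_carrier assms i]
    by (rule sum.cong) (use i in \<open>auto simp: diagonal_matrix_def\<close>)
  also have "\<dots> = (\<Sum>j<r. if j = i then e i * vec_index v i else 0)" by (rule sum.cong) auto
  finally show "vec_index (diagonal_matrix r e *\<^sub>v v) i = vec_index (Matrix.vec r (\<lambda>i. e i * vec_index v i)) i"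
    using i by simp
qed (simp add: diagonal_matrix_def)

lemma diagonal_matrix_inverse:
  assumes "\<And>i. i < r \<Longrightarrow> e i * e' i = 1"
  shows "diagonal_matrix r e * diagonal_matrix r e' = 1\<^sub>m r"
proof (rule eq_matI)
  fix i j assume "i < dim_row (1\<^sub>m r :: complex mat)" "j < dim_col (1\<^sub>m r :: complex mat)"
  then have ij: "i < r" "j < r" by auto
  have "(diagonal_matrix r e * diagonal_matrix r e') $$ (i, j)
     = (\<Sum>l<r. (if i = l then e i else 0) * (if l = j then e' j else 0))"
    using ij by (auto simp: diagonal_matrix_def scalar_prod_def atLeast0LessThan intro!: sum.cong)
  also have "\<dots> = (\<Sum>l<r. if l = i then (if i = j then e i * e' i else 0) else 0)" by (rule sum.cong) auto
  finally show "(diagonal_matrix r e * diagonal_matrix r e') $$ (i, j) = 1\<^sub>m r $$ (i, j)"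
    using ij assms by simp
qed (auto simp: diagonal_matrix_def)

lemma quantum_at_translation:
  assumes N: "0 < N"
  shows "quantum_at \<nu> N 1 t 0 1"
proof (rule quantum_atI)
  define e where "e = (\<lambda>t i. q_pow (of_int t) (of_int ((int (i + \<nu>))\<^sup>2) / (4 * real N)))"
  have ee: "e t i * e (- t) i = 1" for t i by (simp add: e_def q_pow_def exp_add[symmetric])
  show "diagonal_matrix (theta_dim \<nu> N) (e t) * diagonal_matrix (theta_dim \<nu> N) (e (- t)) = 1\<^sub>m (theta_dim \<nu> N)"
    "diagonal_matrix (theta_dim \<nu> N) (e (- t)) * diagonal_matrix (theta_dim \<nu> N) (e t) = 1\<^sub>m (theta_dim \<nu> N)"
    using ee by (auto intro!: diagonal_matrix_inverse simp: mult.commute)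
  have J: "cocycle_base 0 1 \<tau> = 1" for \<tau> by (simp add: cocycle_base_def)
  have m: "moebius_map 1 t 0 1 \<tau> = \<tau> + of_int t" for \<tau> by (simp add: moebius_map_def J)
  fix \<tau> :: complex
  have cancel: "e (- t) i * (e t i * y) = y" for i y
  proof -
    have "e (- t) i * (e t i * y) = (e t i * e (- t) i) * y" by (simp only: mult_ac)
    then show ?thesis by (simp add: ee)
  qed
  have "theta \<nu> N (int (i + \<nu>)) (\<tau> + of_int t) = e t i * theta \<nu> N (int (i + \<nu>)) \<tau>" for i
    unfolding theta_eq_unary_theta e_def by (rule unary_theta_translate[OF N class_weight_support])
  then have "e (- t) i * theta \<nu> N (int (i + \<nu>)) (\<tau> + of_int t) = theta \<nu> N (int (i + \<nu>)) \<tau>" for i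
    by (simp only: cancel)
  then show "theta_vec \<nu> N \<tau> = (cocycle_base 0 1 \<tau> powr of_real (- (1/2 + real \<nu>)))
      \<cdot>\<^sub>v (diagonal_matrix (theta_dim \<nu> N) (e (- t)) *\<^sub>v theta_vec \<nu> N (moebius_map 1 t 0 1 \<tau>))"
    unfolding J m diagonal_matrix_mult_vec[OF theta_vec_carrier] by (intro eq_vecI) (simp_all add: theta_vec_def)
  have supp: "[n = k] (mod int (2 * N))" if "of_int (sgn n) * class_weight N (1 - \<nu>) k n \<noteq> 0" for n k
    using that class_weight_support by force
  have "EI_theta \<nu> N (int (i + \<nu>)) (\<tau> + of_int t) = e t i * EI_theta \<nu> N (int (i + \<nu>)) \<tau>" for i
    unfolding EI_theta_eq_unary_theta e_def by (rule unary_theta_translate[OF N supp])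
  then have "e (- t) i * EI_theta \<nu> N (int (i + \<nu>)) (\<tau> + of_int t) = EI_theta \<nu> N (int (i + \<nu>)) \<tau>" for i
    by (simp only: cancel)
  then show "EI_vec \<nu> N \<tau> + 0\<^sub>v (theta_dim \<nu> N) = (cocycle_base 0 1 \<tau> powr of_real (- (3/2 - real \<nu>)))
      \<cdot>\<^sub>v (diagonal_matrix (theta_dim \<nu> N) (e (- t)) *\<^sub>v EI_vec \<nu> N (moebius_map 1 t 0 1 \<tau>))"
    unfolding J m diagonal_matrix_mult_vec[OF EI_vec_carrier] by (intro eq_vecI) (simp_all add: EI_vec_def)
  show "holomorphic_vec_on (theta_dim \<nu> N) (\<lambda>_. 0\<^sub>v (theta_dim \<nu> N)) (extension_domain 0 1)"
    by (simp add: holomorphic_vec_on_def)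
qed simp_all

text \<open>
  The two weights differ by an odd integer, so the Eichler integrals pick up a sign and the
  cocycle is a multiple of the vector itself. It need not continue across the real axis, but the
  slit domain is empty here.
\<close>

lemma quantum_at_minus_identity:
  assumes N: "0 < N"
  shows "quantum_at \<nu> N (- 1) 0 0 (- 1)"
proof (rule quantum_atI)
  define z where "z = (- 1 :: complex) powr of_real (- (1/2 + real \<nu>))"
  define y where "y = (- 1 :: complex) powr of_real (- (3/2 - real \<nu>))"
  have z0: "z \<noteq> 0" by (simp add: z_def)
  show "diagonal_matrix (theta_dim \<nu> N) (\<lambda>_. z) * diagonal_matrix (theta_dim \<nu> N) (\<lambda>_. inverse z) = 1\<^sub>m (theta_dim \<nu> N)"
    "diagonal_matrix (theta_dim \<nu> N) (\<lambda>_. inverse z) * diagonal_matrix (theta_dim \<nu> N) (\<lambda>_. z) = 1\<^sub>m (theta_dim \<nu> N)"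
    using z0 by (auto intro!: diagonal_matrix_inverse)
  have J: "cocycle_base 0 (- 1) \<tau> = - 1" for \<tau> by (simp add: cocycle_base_def)
  have m: "moebius_map (- 1) 0 0 (- 1) \<tau> = \<tau>" for \<tau> by (simp add: moebius_map_def J)
  fix \<tau> :: complex
  show "theta_vec \<nu> N \<tau> = (cocycle_base 0 (- 1) \<tau> powr of_real (- (1/2 + real \<nu>)))
      \<cdot>\<^sub>v (diagonal_matrix (theta_dim \<nu> N) (\<lambda>_. inverse z) *\<^sub>v theta_vec \<nu> N (moebius_map (- 1) 0 0 (- 1) \<tau>))"
    unfolding J m z_def[symmetric] diagonal_matrix_mult_vec[OF theta_vec_carrier] using z0
    by (intro eq_vecI) (simp_all add: theta_vec_def)
  show "EI_vec \<nu> N \<tau> + (y * inverse z - 1) \<cdot>\<^sub>v EI_vec \<nu> N \<tau> = (cocycle_base 0 (- 1) \<tau> powr of_real (- (3/2 - real \<nu>)))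
      \<cdot>\<^sub>v (diagonal_matrix (theta_dim \<nu> N) (\<lambda>_. inverse z) *\<^sub>v EI_vec \<nu> N (moebius_map (- 1) 0 0 (- 1) \<tau>))"
    unfolding J m y_def[symmetric] diagonal_matrix_mult_vec[OF EI_vec_carrier]
    by (intro eq_vecI) (simp_all add: EI_vec_def algebra_simps)
  have "extension_domain 0 (- 1) = upper_half_plane"
    by (auto simp: extension_domain_def J upper_half_plane_def)
  then show "holomorphic_vec_on (theta_dim \<nu> N) (\<lambda>\<tau>. (y * inverse z - 1) \<cdot>\<^sub>v EI_vec \<nu> N \<tau>) (extension_domain 0 (- 1))"
    by (simp add: holomorphic_vec_on_smult EI_vec_holomorphic[OF N])
qed simp_all

lemma mordell_vec_holomorphic:
  assumes "0 < N" "\<nu> \<in> {0, 1}"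
  shows "holomorphic_vec_on (theta_dim \<nu> N) (mordell_vec \<nu> N) (- \<real>\<^sub>\<le>\<^sub>0)"
proof (rule holomorphic_vec_on_componentI)
  fix i assume i: "i < theta_dim \<nu> N"
  have "(\<lambda>\<tau>. mordell_integral N (1 - \<nu>) (of_int (int (i + \<nu>) - int N) / (2 * real N)) \<tau>) holomorphic_on - \<real>\<^sub>\<le>\<^sub>0"
    by (rule mordell_integral_holomorphic[OF assms(1)]) simp
  then show "(\<lambda>\<tau>. vec_index (mordell_vec \<nu> N \<tau>) i) holomorphic_on - \<real>\<^sub>\<le>\<^sub>0"
    using i by (simp add: mordell_vec_def)
qed simp

lemma quantum_at_inversion:
  assumes N: "0 < N" and \<nu>: "\<nu> \<in> {0, 1}"
  shows "quantum_at \<nu> N 0 (- 1) 1 0"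
proof -
  obtain K where K: "K \<in> carrier_mat (theta_dim \<nu> N) (theta_dim \<nu> N)"
    "inversion_matrix N \<nu> * K = 1\<^sub>m (theta_dim \<nu> N)" "K * inversion_matrix N \<nu> = 1\<^sub>m (theta_dim \<nu> N)"
    using inversion_matrix_invertible[OF N \<nu>] by blast
  have J: "cocycle_base 1 0 \<tau> = \<tau>" for \<tau> by (simp add: cocycle_base_def)
  have m: "moebius_map 0 (- 1) 1 0 \<tau> = - 1 / \<tau>" for \<tau> by (simp add: moebius_map_def J)
  show ?thesis
  proof (rule quantum_atI[OF _ K(1) inversion_matrix_carrier K(3,2)])
    fix \<tau> :: complex assume \<tau>: "0 < Im \<tau>"
    show "theta_vec \<nu> N \<tau> = (cocycle_base 1 0 \<tau> powr of_real (- (1/2 + real \<nu>)))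
        \<cdot>\<^sub>v (inversion_matrix N \<nu> *\<^sub>v theta_vec \<nu> N (moebius_map 0 (- 1) 1 0 \<tau>))"
      unfolding J m by (rule theta_vec_inversion[OF N \<nu> \<tau>])
    have "EI_vec \<nu> N \<tau> + (- 1) \<cdot>\<^sub>v mordell_vec \<nu> N \<tau>
       = ((\<tau> powr of_real (- (3/2 - real \<nu>))) \<cdot>\<^sub>v (inversion_matrix N \<nu> *\<^sub>v EI_vec \<nu> N (- 1 / \<tau>)) + mordell_vec \<nu> N \<tau>)
          + (- 1) \<cdot>\<^sub>v mordell_vec \<nu> N \<tau>"
      by (simp only: EI_vec_inversion[OF N \<nu> \<tau>, symmetric])
    also have "\<dots> = (\<tau> powr of_real (- (3/2 - real \<nu>))) \<cdot>\<^sub>v (inversion_matrix N \<nu> *\<^sub>v EI_vec \<nu> N (- 1 / \<tau>))"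
      by (intro eq_vecI) (simp_all add: mordell_vec_def inversion_matrix_def)
    finally show "EI_vec \<nu> N \<tau> + (- 1) \<cdot>\<^sub>v mordell_vec \<nu> N \<tau> = (cocycle_base 1 0 \<tau> powr of_real (- (3/2 - real \<nu>)))
        \<cdot>\<^sub>v (inversion_matrix N \<nu> *\<^sub>v EI_vec \<nu> N (moebius_map 0 (- 1) 1 0 \<tau>))"
      unfolding J m .
  next
    have "extension_domain 1 0 = - \<real>\<^sub>\<le>\<^sub>0"
      by (auto simp: extension_domain_def J upper_half_plane_slit)
    then show "holomorphic_vec_on (theta_dim \<nu> N) (\<lambda>\<tau>. (- 1) \<cdot>\<^sub>v mordell_vec \<nu> N \<tau>) (extension_domain 1 0)"
      using holomorphic_vec_on_smult[OF holomorphic_on_const mordell_vec_holomorphic[OF N \<nu>]] by simp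
  qed simp
qed

lemma cnj_mult_mat_vec:
  assumes "A \<in> carrier_mat r r" "v \<in> carrier_vec r"
  shows "map_vec cnj (A *\<^sub>v v) = map_mat cnj A *\<^sub>v map_vec cnj v"
proof (rule eq_vecI)
  fix i assume "i < dim_vec (map_mat cnj A *\<^sub>v map_vec cnj v)"
  then show "vec_index (map_vec cnj (A *\<^sub>v v)) i = vec_index (map_mat cnj A *\<^sub>v map_vec cnj v) i"
    using assms by (simp add: scalar_prod_def)
qed (use assms in simp)

lemma cnj_mult_mat_eq_one:
  assumes "A \<in> carrier_mat r r" "B \<in> carrier_mat r r" "A * B = 1\<^sub>m r"
  shows "map_mat cnj A * map_mat cnj B = 1\<^sub>m r"
proof -
  have "map_mat cnj A * map_mat cnj B = map_mat cnj (A * B)"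
    using assms(1,2) by (intro eq_matI) (auto simp: scalar_prod_def)
  also have "\<dots> = 1\<^sub>m r" unfolding assms(3) by (intro eq_matI) auto
  finally show ?thesis .
qed

lemma cnj_theta_EI:
  shows "cnj (theta \<nu> N k (- cnj \<tau>)) = theta \<nu> N k \<tau>"
    and "cnj (EI_theta \<nu> N k (- cnj \<tau>)) = EI_theta \<nu> N k \<tau>"
proof -
  have d: "cnj (delta k n m) = delta k n m" for n m by (simp add: delta_def)
  have q: "cnj (q_pow (- cnj \<tau>) y) = q_pow \<tau> y" for y by (simp add: q_pow_def exp_cnj)
  show "cnj (theta \<nu> N k (- cnj \<tau>)) = theta \<nu> N k \<tau>"
    unfolding theta_def infsum_cnj[symmetric] by (simp add: d q)
  show "cnj (EI_theta \<nu> N k (- cnj \<tau>)) = EI_theta \<nu> N k \<tau>"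
    unfolding EI_theta_def infsum_cnj[symmetric] by (simp add: d q)
qed

text \<open>
  The series have real coefficients, so \<open>\<tau> \<mapsto> - cnj \<tau>\<close> conjugates
  them; on matrices it changes the signs of \<open>b\<close> and \<open>c\<close>. For \<open>c
  \<noteq> 0\<close> the automorphy factor is never real, so conjugation respects its principal
  powers.
\<close>

lemma quantum_at_reflection:
  assumes Q: "quantum_at \<nu> N a b c d" and c: "c \<noteq> 0"
  shows "quantum_at \<nu> N a (- b) (- c) d"
proof -
  define r where "r = theta_dim \<nu> N"
  define J where "J = cocycle_base c d"
  define w where "w = complex_of_real (- (1/2 + real \<nu>))"
  define x where "x = complex_of_real (- (3/2 - real \<nu>))"
  note defs = r_def[symmetric] J_def[symmetric] w_def[symmetric] x_def[symmetric]
  from Q obtain M M' g where det: "a * d - b * c = 1"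
    and M: "M \<in> carrier_mat r r" "M' \<in> carrier_mat r r" "M * M' = 1\<^sub>m r" "M' * M = 1\<^sub>m r"
    and theta: "\<And>\<tau>. 0 < Im \<tau> \<Longrightarrow> theta_vec \<nu> N \<tau> = (J \<tau> powr w) \<cdot>\<^sub>v (M' *\<^sub>v theta_vec \<nu> N (moebius_map a b c d \<tau>))"
    and g: "holomorphic_vec_on r g (extension_domain c d)"
    and EI: "\<And>\<tau>. 0 < Im \<tau> \<Longrightarrow> EI_vec \<nu> N \<tau> + g \<tau> = (J \<tau> powr x) \<cdot>\<^sub>v (M' *\<^sub>v EI_vec \<nu> N (moebius_map a b c d \<tau>))"
    unfolding quantum_at_def defs by blast
  define g' where "g' = (\<lambda>\<tau>. map_vec cnj (g (- cnj \<tau>)))"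
  have J': "cocycle_base (- c) d \<tau> = cnj (J (- cnj \<tau>))" for \<tau>
    by (simp add: J_def cocycle_base_def)
  have m': "moebius_map a (- b) (- c) d \<tau> = - cnj (moebius_map a b c d (- cnj \<tau>))" for \<tau>
    unfolding moebius_map_def J' J_def[symmetric] by (simp add: minus_divide_left)
  have dom: "\<tau> \<in> extension_domain (- c) d \<longleftrightarrow> - cnj \<tau> \<in> extension_domain c d" for \<tau>
    unfolding extension_domain_def J' J_def[symmetric] by (simp add: complex_nonpos_Reals_iff)
  have V: "map_vec cnj (theta_vec \<nu> N (- cnj \<tau>)) = theta_vec \<nu> N \<tau>"
    "map_vec cnj (EI_vec \<nu> N (- cnj \<tau>)) = EI_vec \<nu> N \<tau>" for \<tau>
    by (intro eq_vecI; simp add: theta_vec_def EI_vec_def cnj_theta_EI)+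
  have V': "map_vec cnj (theta_vec \<nu> N z) = theta_vec \<nu> N (- cnj z)"
    "map_vec cnj (EI_vec \<nu> N z) = EI_vec \<nu> N (- cnj z)" for z
    using V[of "- cnj z"] by simp_all
  have reflect: "map_vec cnj ((J (- cnj \<tau>) powr y) \<cdot>\<^sub>v (M' *\<^sub>v v)) = (cocycle_base (- c) d \<tau> powr y) \<cdot>\<^sub>v (map_mat cnj M' *\<^sub>v map_vec cnj v)"
    if "0 < Im \<tau>" "v \<in> carrier_vec r" "cnj y = y" for \<tau> y v
  proof -
    have "Im (J (- cnj \<tau>)) \<noteq> 0" using c that(1) by (simp add: J_def cocycle_base_def)
    then have "cnj (J (- cnj \<tau>) powr y) = cocycle_base (- c) d \<tau> powr y"
      unfolding J' by (simp add: cnj_powr that(3))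
    moreover have "map_vec cnj (k \<cdot>\<^sub>v v) = cnj k \<cdot>\<^sub>v map_vec cnj v" for k v by (intro eq_vecI) auto
    ultimately show ?thesis by (simp add: cnj_mult_mat_vec[OF M(2) that(2)])
  qed
  have T: "theta_vec \<nu> N \<tau> \<in> carrier_vec r" "EI_vec \<nu> N \<tau> \<in> carrier_vec r" for \<tau> by (simp_all add: r_def)
  show ?thesis
  proof (rule quantum_atI[of _ _ _ _ "map_mat cnj M" _ _ "map_mat cnj M'" g'], unfold defs)
    show "a * d - - b * - c = 1" using det by simp
    show "map_mat cnj M \<in> carrier_mat r r" "map_mat cnj M' \<in> carrier_mat r r" using M by auto
    show "map_mat cnj M * map_mat cnj M' = 1\<^sub>m r" "map_mat cnj M' * map_mat cnj M = 1\<^sub>m r"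
      by (intro cnj_mult_mat_eq_one M)+
    fix \<tau> :: complex assume \<tau>: "0 < Im \<tau>"
    then have \<tau>': "0 < Im (- cnj \<tau>)" by simp
    have "theta_vec \<nu> N \<tau> = map_vec cnj (theta_vec \<nu> N (- cnj \<tau>))" by (rule V(1)[symmetric])
    also have "\<dots> = map_vec cnj ((J (- cnj \<tau>) powr w) \<cdot>\<^sub>v (M' *\<^sub>v theta_vec \<nu> N (moebius_map a b c d (- cnj \<tau>))))"
      by (rule arg_cong[OF theta[OF \<tau>']])
    also have "\<dots> = (cocycle_base (- c) d \<tau> powr w) \<cdot>\<^sub>v (map_mat cnj M' *\<^sub>v map_vec cnj (theta_vec \<nu> N (moebius_map a b c d (- cnj \<tau>))))"
      by (rule reflect[OF \<tau> T(1)]) (simp add: w_def)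
    finally show "theta_vec \<nu> N \<tau> = (cocycle_base (- c) d \<tau> powr w) \<cdot>\<^sub>v (map_mat cnj M' *\<^sub>v theta_vec \<nu> N (moebius_map a (- b) (- c) d \<tau>))"
      by (simp only: m' V')
    have "- cnj \<tau> \<in> extension_domain c d" using \<tau>' by (simp add: extension_domain_def)
    then have gc: "g (- cnj \<tau>) \<in> carrier_vec r" using g by (simp add: holomorphic_vec_on_def)
    have "map_vec cnj (EI_vec \<nu> N (- cnj \<tau>) + g (- cnj \<tau>)) = EI_vec \<nu> N \<tau> + g' \<tau>"
      unfolding V(2)[symmetric, of \<tau>] g'_def using gc T(2)[of "- cnj \<tau>"] by (intro eq_vecI) auto
    then have "EI_vec \<nu> N \<tau> + g' \<tau> = map_vec cnj ((J (- cnj \<tau>) powr x) \<cdot>\<^sub>v (M' *\<^sub>v EI_vec \<nu> N (moebius_map a b c d (- cnj \<tau>))))"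
      unfolding EI[OF \<tau>'] by (rule sym)
    also have "\<dots> = (cocycle_base (- c) d \<tau> powr x) \<cdot>\<^sub>v (map_mat cnj M' *\<^sub>v map_vec cnj (EI_vec \<nu> N (moebius_map a b c d (- cnj \<tau>))))"
      by (rule reflect[OF \<tau> T(2)]) (simp add: x_def)
    finally show "EI_vec \<nu> N \<tau> + g' \<tau> = (cocycle_base (- c) d \<tau> powr x) \<cdot>\<^sub>v (map_mat cnj M' *\<^sub>v EI_vec \<nu> N (moebius_map a (- b) (- c) d \<tau>))"
      by (simp only: m' V')
  next
    define X where "X = extension_domain (- c) d"
    have "X = {\<tau>. 0 < Im \<tau>} \<union> cocycle_base (- c) d -` (- \<real>\<^sub>\<le>\<^sub>0)"
      by (auto simp: X_def extension_domain_def)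
    moreover have "open (cocycle_base (- c) d -` (- \<real>\<^sub>\<le>\<^sub>0))"
      unfolding cocycle_base_def by (intro open_vimage open_Compl continuous_intros) simp
    ultimately have "open X" using open_halfspace_Im_gt[of 0] by auto
    show "holomorphic_vec_on r g' (extension_domain (- c) d)"
      unfolding X_def[symmetric]
    proof (rule holomorphic_vec_on_componentI)
      show "g' \<tau> \<in> carrier_vec r" if "\<tau> \<in> X" for \<tau>
        using that g dom by (simp add: g'_def X_def holomorphic_vec_on_def)
      fix i assume i: "i < r"
      have hol: "(\<lambda>\<tau>. vec_index (g \<tau>) i) holomorphic_on extension_domain c d"
        using g i by (simp add: holomorphic_vec_on_def)
      have minus: "(\<lambda>\<tau>. - \<tau>) holomorphic_on cnj ` X" by (intro holomorphic_on_minus holomorphic_on_ident)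
      have "(\<lambda>\<tau>. - \<tau>) ` cnj ` X \<subseteq> extension_domain c d" using dom by (auto simp: X_def)
      from holomorphic_on_compose_gen[OF minus hol this]
      have "(\<lambda>\<tau>. vec_index (g (- \<tau>)) i) holomorphic_on cnj ` X" by (simp only: o_def)
      from holomorphic_on_compose_cnj_cnj[OF this \<open>open X\<close>]
      show "(\<lambda>\<tau>. vec_index (g' \<tau>) i) holomorphic_on X"
        by (rule holomorphic_transform)
           (use g dom i in \<open>auto simp: g'_def X_def o_def holomorphic_vec_on_def\<close>)
    qed
  qed
qed

section \<open>Descent in the modular group\<close>

text \<open>
  The arguments of \<open>w\<close> and \<open>z\<close> add up to something in \<open>(0, 2
  \<pi>)\<close>, and the product lies in the upper half-plane, so the sum stays below
  \<open>\<pi>\<close>.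
\<close>

lemma Ln_mult_upper:
  assumes "0 < Im w" "0 \<le> Im z" "0 < Re z \<or> 0 < Im z" "0 < Im (w * z)"
  shows "Ln (w * z) = Ln w + Ln z"
proof -
  have nz: "w \<noteq> 0" "z \<noteq> 0" using assms by auto
  have w: "0 < Im (Ln w)" "Im (Ln w) < pi" using Im_Ln_pos_lt[OF nz(1)] assms(1) by auto
  have z: "0 \<le> Im (Ln z)" "Im (Ln z) < pi"
  proof -
    show "0 \<le> Im (Ln z)" using Im_Ln_pos_le[OF nz(2)] assms(2) by blast
    show "Im (Ln z) < pi"
    proof (cases "0 < Im z")
      case True then show ?thesis using Im_Ln_pos_lt[OF nz(2)] by blast
    next
      case False
      then have "\<bar>Im (Ln z)\<bar> < pi / 2" using assms(3) Re_Ln_pos_lt_imp by blast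
      then show ?thesis using pi_gt_zero by linarith
    qed
  qed
  have "Im (Ln w) + Im (Ln z) \<le> pi"
  proof (rule ccontr)
    assume "\<not> Im (Ln w) + Im (Ln z) \<le> pi"
    then have "sin (Im (Ln w) + Im (Ln z)) < 0" using w z by (intro sin_lt_zero) auto
    moreover have "Im (w * z) = exp (Re (Ln w + Ln z)) * sin (Im (Ln w) + Im (Ln z))"
    proof -
      have "w * z = exp (Ln w + Ln z)" using nz by (simp add: exp_add)
      then show ?thesis by (simp only: Im_exp) simp
    qed
    ultimately have "Im (w * z) < 0" by (simp add: mult_pos_neg)
    then show False using assms(4) by simp
  qed
  then show ?thesis using w z nz pi_gt_zero by (intro Ln_times_simple) auto
qed

lemma powr_mult_upper:
  assumes "0 < Im w" "0 \<le> Im z" "0 < Re z \<or> 0 < Im z" "0 < Im (w * z)"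
  shows "(w * z) powr x = w powr x * z powr x"
proof -
  have "w \<noteq> 0" "z \<noteq> 0" using assms by auto
  then show ?thesis by (simp add: powr_def Ln_mult_upper[OF assms] distrib_left exp_add)
qed

lemma quantum_at_mult_translation:
  assumes N: "0 < N" and "quantum_at \<nu> N a b c d"
  shows "quantum_at \<nu> N a (a * t + b) c (c * t + d)"
proof -
  have J: "cocycle_base 0 1 \<tau> = 1" and m: "moebius_map 1 t 0 1 \<tau> = \<tau> + of_int t" for \<tau>
    by (simp_all add: cocycle_base_def moebius_map_def)
  have shift: "cocycle_base c (c * t + d) \<tau> = cocycle_base c d (\<tau> + of_int t)" for \<tau>
    by (simp add: cocycle_base_def algebra_simps)
  have "quantum_at \<nu> N (a * 1 + b * 0) (a * t + b * 1) (c * 1 + d * 0) (c * t + d * 1)"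
    by (rule quantum_at_compose[OF assms(2) quantum_at_translation[OF N]])
       (auto simp: J m shift extension_domain_def)
  then show ?thesis by simp
qed

text \<open>
  For \<open>c \<ge> 0\<close> and \<open>d > 0\<close> both factors of \<open>\<tau> (d -
  c/\<tau>) = d \<tau> - c\<close> have non-negative imaginary part, hence no branch is crossed.
  Moreover \<open>c/d \<ge> 0\<close>, so the slit \<open>(-\<infinity>, c/d]\<close> of the
  product contains the slit of the inversion, and the inversion maps its complement into the
  domain for \<open>(c, d)\<close>.
\<close>

lemma quantum_at_mult_inversion:
  assumes N: "0 < N" and \<nu>: "\<nu> \<in> {0, 1}"
    and "quantum_at \<nu> N a b c d" and c: "0 \<le> c" and d: "0 < d"
  shows "quantum_at \<nu> N b (- a) d (- c)"
proof -
  have J: "cocycle_base 1 0 \<tau> = \<tau>" for \<tau> by (simp add: cocycle_base_def)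
  have m: "moebius_map 0 (- 1) 1 0 \<tau> = - 1 / \<tau>" for \<tau> by (simp add: moebius_map_def J)
  have Im_J: "Im (cocycle_base c d v) = of_int c * Im v" for c d v by (simp add: cocycle_base_def)
  have J12: "cocycle_base d (- c) \<tau> = \<tau> * cocycle_base c d (- 1 / \<tau>)" if "\<tau> \<noteq> 0" for \<tau>
    using that by (simp add: cocycle_base_def field_simps)
  have "quantum_at \<nu> N (a * 0 + b * 1) (a * (- 1) + b * 0) (c * 0 + d * 1) (c * (- 1) + d * 0)"
  proof (rule quantum_at_compose[OF assms(3) quantum_at_inversion[OF N \<nu>]])
    fix \<tau> :: complex and x :: complex
    assume \<tau>: "0 < Im \<tau>"
    let ?z = "cocycle_base c d (- 1 / \<tau>)"
    have I: "0 < Im (- 1 / \<tau>)" by (rule inversion_in_upper_half_plane[OF \<tau>])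
    have "(\<tau> * ?z) powr x = \<tau> powr x * ?z powr x"
    proof (rule powr_mult_upper[OF \<tau>])
      show "0 \<le> Im ?z" unfolding Im_J using c I by (intro mult_nonneg_nonneg) auto
      show "0 < Re ?z \<or> 0 < Im ?z"
      proof (cases "c = 0")
        case True then show ?thesis using d by (simp add: cocycle_base_def)
      next
        case False then show ?thesis unfolding Im_J using c I by (intro disjI2 mult_pos_pos) auto
      qed
      have "\<tau> * ?z = cocycle_base d (- c) \<tau>" using J12[of \<tau>] \<tau> by fastforce
      then show "0 < Im (\<tau> * ?z)" using d \<tau> by (simp only: Im_J) simp
    qed
    then show "(cocycle_base c d (moebius_map 0 (- 1) 1 0 \<tau>) * cocycle_base 1 0 \<tau>) powr x
        = cocycle_base c d (moebius_map 0 (- 1) 1 0 \<tau>) powr x * cocycle_base 1 0 \<tau> powr x"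
      unfolding J m by (simp only: mult.commute)
  next
    fix \<tau> :: complex
    assume "\<tau> \<in> extension_domain (c * 0 + d * 1) (c * (- 1) + d * 0)"
    then have dom: "0 < Im \<tau> \<or> cocycle_base d (- c) \<tau> \<notin> \<real>\<^sub>\<le>\<^sub>0" by (simp add: extension_domain_def)
    have slit: "\<tau> \<notin> \<real>\<^sub>\<le>\<^sub>0"
    proof
      assume "\<tau> \<in> \<real>\<^sub>\<le>\<^sub>0"
      then have st: "Re \<tau> \<le> 0" "Im \<tau> = 0" by (auto simp: complex_nonpos_Reals_iff)
      have "of_int d * Re \<tau> \<le> 0" using st(1) d by (simp add: mult_nonneg_nonpos)
      then have "Re (cocycle_base d (- c) \<tau>) \<le> 0" using c by (simp add: cocycle_base_def)
      then show False using dom st(2) by (simp add: complex_nonpos_Reals_iff Im_J)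
    qed
    then have \<tau>0: "\<tau> \<noteq> 0" by auto
    let ?z = "cocycle_base c d (- 1 / \<tau>)"
    have "?z \<notin> \<real>\<^sub>\<le>\<^sub>0"
    proof (cases "Im \<tau> = 0")
      case True
      with dom have pos: "0 < Re (cocycle_base d (- c) \<tau>)" by (auto simp: complex_nonpos_Reals_iff Im_J)
      have "0 < Re \<tau>" using slit True by (auto simp: complex_nonpos_Reals_iff)
      moreover have "Re (cocycle_base d (- c) \<tau>) = Re \<tau> * Re ?z" unfolding J12[OF \<tau>0] using True by simp
      ultimately have "0 < Re ?z" using pos by (simp add: zero_less_mult_iff)
      then show ?thesis by (auto simp: complex_nonpos_Reals_iff)
    next
      case False
      show ?thesis
      proof (cases "c = 0")
        case True then show ?thesis using d by (auto simp: cocycle_base_def complex_nonpos_Reals_iff)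
      next
        case c_nz: False
        have "Im (- 1 / \<tau>) = Im \<tau> / ((Re \<tau>)\<^sup>2 + (Im \<tau>)\<^sup>2)" by (simp add: Im_divide)
        moreover have "(Re \<tau>)\<^sup>2 + (Im \<tau>)\<^sup>2 \<noteq> 0" using False by simp
        ultimately have "Im (- 1 / \<tau>) \<noteq> 0" using False by simp
        then have "Im ?z \<noteq> 0" unfolding Im_J using c_nz by simp
        then show ?thesis by (auto simp: complex_nonpos_Reals_iff)
      qed
    qed
    then show "cocycle_base 1 0 \<tau> \<notin> \<real>\<^sub>\<le>\<^sub>0 \<and> moebius_map 0 (- 1) 1 0 \<tau> \<in> extension_domain c d"
      using slit unfolding J m extension_domain_def by simp
  qed
  then show ?thesis by simp
qed

text \<open>
  Euclidean descent: a translation on the right brings \<open>d\<close> into \<open>(-c,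
  0]\<close>, and then the matrix is a product of one with lower row \<open>(-d, c)\<close> and
  the inversion. The new lower left entry is smaller than \<open>c\<close> and non-negative, and
  the new lower right entry is positive.
\<close>

lemma quantum_at_nonneg:
  assumes N: "0 < N" and \<nu>: "\<nu> \<in> {0, 1}"
  shows "c = int n \<Longrightarrow> (n = 0 \<longrightarrow> d = 1) \<Longrightarrow> a * d - b * c = 1 \<Longrightarrow> quantum_at \<nu> N a b c d"
proof (induction n arbitrary: a b c d rule: less_induct)
  case (less n)
  show ?case
  proof (cases "n = 0")
    case True
    then have "c = 0" "d = 1" "a = 1" using less.prems by auto
    then show ?thesis using quantum_at_translation[OF N, of \<nu> b] by simp
  next
    case False
    \<comment> \<open>Rounding is chosen such that the translated entry is \<open>- d'\<close> with \<open>0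
         \<le> d' < c\<close>.\<close>
    define q where "q = - ((- d) div c)"
    define d' where "d' = (- d) mod c"
    have c: "0 < c" using False less.prems(1) by simp
    have d': "0 \<le> d'" "d' < c" using c by (simp_all add: d'_def)
    have d_eq: "d = c * q - d'"
      using minus_mod_eq_mult_div[of "- d" c] by (simp add: q_def d'_def)
    define b' where "b' = b - a * q"
    have det: "b' * (- c) - a * d' = 1"
      using less.prems(3) unfolding d_eq b'_def by (simp add: algebra_simps)
    have "quantum_at \<nu> N (- b') a d' c"
    proof (rule less.IH[of "nat d'"])
      show "nat d' < n" "d' = int (nat d')" using d' less.prems(1) by simp_all
      show "- b' * c - a * d' = 1" using det by simp
      then have "d' = 0 \<Longrightarrow> c dvd 1" by (intro dvdI[of _ _ "- b'"]) (simp add: mult.commute)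
      then show "nat d' = 0 \<longrightarrow> c = 1" using d' c by auto
    qed
    from quantum_at_mult_inversion[OF N \<nu> this d'(1) c]
    have "quantum_at \<nu> N a b' c (- d')" by simp
    from quantum_at_mult_translation[OF N this, of q]
    show ?thesis by (simp add: b'_def d_eq)
  qed
qed

lemma quantum_at_SL2Z:
  assumes N: "0 < N" and \<nu>: "\<nu> \<in> {0, 1}" and det: "a * d - b * c = 1"
  shows "quantum_at \<nu> N a b c d"
proof (cases c "0 :: int" rule: linorder_cases)
  case greater
  show ?thesis by (rule quantum_at_nonneg[OF N \<nu>, of c "nat c"]) (use greater det in auto)
next
  case less
  have "quantum_at \<nu> N a (- b) (- c) d"
    by (rule quantum_at_nonneg[OF N \<nu>, of "- c" "nat (- c)"]) (use less det in auto)
  from quantum_at_reflection[OF this] show ?thesis using less by simp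
next
  case equal
  then have "a * d = 1" using det by simp
  then consider "d = 1" | "a = - 1" "d = - 1" by (auto simp: zmult_eq_1_iff)
  then show ?thesis
  proof cases
    case 1
    show ?thesis by (rule quantum_at_nonneg[OF N \<nu>, of c 0]) (use equal 1 det in auto)
  next
    case 2
    from quantum_at_mult_translation[OF N quantum_at_minus_identity[OF N], of \<nu> "- b"]
    show ?thesis using 2 equal by simp
  qed
qed

lemma det_2_by_2:
  fixes A :: "int mat"
  assumes A: "A \<in> carrier_mat 2 2"
  shows "Determinant.det A = A $$ (0,0) * A $$ (1,1) - A $$ (0,1) * A $$ (1,0)"
proof -
  have minor: "Determinant.det (mat_delete A 0 j) = mat_delete A 0 j $$ (0,0)" for j
    using A by (intro det_single) (simp add: mat_delete_def)
  have "Determinant.det A = (\<Sum>j<2. A $$ (0,j) * cofactor A 0 j)"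
    using A by (intro laplace_expansion_row[where n = 2]) auto
  moreover have "mat_delete A 0 0 $$ (0,0) = A $$ (1,1)" "mat_delete A 0 1 $$ (0,0) = A $$ (1,0)"
    using A by (simp_all add: mat_delete_def)
  then have "cofactor A 0 0 = A $$ (1,1)" "cofactor A 0 1 = - A $$ (1,0)"
    by (simp_all only: cofactor_def minor) simp_all
  ultimately show ?thesis by (simp add: numeral_2_eq_2)
qed

lemma mat_inverse_eq:
  fixes M M' :: "complex mat"
  assumes M: "M \<in> carrier_mat r r" "M' \<in> carrier_mat r r" "M * M' = 1\<^sub>m r" "M' * M = 1\<^sub>m r"
  shows "the (mat_inverse M) = M'"
proof (cases "mat_inverse M")
  case None
  have "M \<in> Units (ring_mat TYPE(complex) r ())"
    unfolding Units_def using M by (auto simp: ring_mat_simps)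
  with mat_inverse(1)[OF M(1) None, where b = "()"] show ?thesis by blast
next
  case (Some B)
  from mat_inverse(2)[OF M(1) Some] have B: "M * B = 1\<^sub>m r" "B * M = 1\<^sub>m r" "B \<in> carrier_mat r r" by auto
  have "B = B * (M * M')" using B M by simp
  also have "\<dots> = (B * M) * M'" by (rule assoc_mult_mat[OF B(3) M(1,2), symmetric])
  finally show ?thesis using B M Some by simp
qed

text \<open>
  Linear independence identifies the multiplier system with the matrix \<open>M\<close> of
  \<open>quantum_at\<close>, so that \<open>g\<close> is the extension of the cocycle.
\<close>

theorem proposition4p9:
  fixes N \<nu> :: nat
  assumes "N \<ge> 1" and "\<nu> \<in> {0, 1}"
  shows "quantum_modular_form (theta_dim \<nu> N) (3/2 - real \<nu>) (theta_multiplier \<nu> N) (EI_vec \<nu> N)"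
  unfolding quantum_modular_form_def
proof (intro conjI ballI)
  have N: "0 < N" using assms(1) by simp
  show "holomorphic_vec_on (theta_dim \<nu> N) (EI_vec \<nu> N) upper_half_plane"
    by (rule EI_vec_holomorphic[OF N])
  fix \<gamma> assume \<gamma>: "\<gamma> \<in> SL2Z"
  define r where "r = theta_dim \<nu> N"
  define a b c d where "a = \<gamma> $$ (0,0)" and "b = \<gamma> $$ (0,1)" and "c = \<gamma> $$ (1,0)" and "d = \<gamma> $$ (1,1)"
  have "Determinant.det \<gamma> = \<gamma> $$ (0,0) * \<gamma> $$ (1,1) - \<gamma> $$ (0,1) * \<gamma> $$ (1,0)"
    using \<gamma> by (intro det_2_by_2) (simp add: SL2Z_def)
  then have "a * d - b * c = 1" using \<gamma> by (simp add: SL2Z_def a_def b_def c_def d_def)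
  from quantum_at_SL2Z[OF N assms(2) this]
  obtain M M' g where M: "M \<in> carrier_mat r r" "M' \<in> carrier_mat r r" "M * M' = 1\<^sub>m r" "M' * M = 1\<^sub>m r"
    and theta: "\<And>\<tau>. 0 < Im \<tau> \<Longrightarrow> theta_vec \<nu> N \<tau>
        = (cocycle_base c d \<tau> powr of_real (- (1/2 + real \<nu>))) \<cdot>\<^sub>v (M' *\<^sub>v theta_vec \<nu> N (moebius_map a b c d \<tau>))"
    and g: "holomorphic_vec_on r g (extension_domain c d)"
    and EI: "\<And>\<tau>. 0 < Im \<tau> \<Longrightarrow> EI_vec \<nu> N \<tau> + g \<tau>
        = (cocycle_base c d \<tau> powr of_real (- (3/2 - real \<nu>))) \<cdot>\<^sub>v (M' *\<^sub>v EI_vec \<nu> N (moebius_map a b c d \<tau>))"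
    unfolding quantum_at_def r_def[symmetric] by blast
  have J: "automorphy_base \<gamma> \<tau> = cocycle_base c d \<tau>" for \<tau>
    by (simp add: automorphy_base_def cocycle_base_def c_def d_def)
  have m: "moebius_action \<gamma> \<tau> = moebius_map a b c d \<tau>" for \<tau>
    by (simp add: moebius_action_def moebius_map_def J a_def b_def)
  have J0: "cocycle_base c d \<tau> \<noteq> 0" if "0 < Im \<tau>" for \<tau>
    by (rule cocycle_base_nonzero[OF \<open>a * d - b * c = 1\<close> that])
  define factor where "factor = (\<lambda>\<tau>. cocycle_base c d \<tau> powr complex_of_real (1/2 + real \<nu>))"
  have factor: "factor \<tau> * cocycle_base c d \<tau> powr of_real (- (1/2 + real \<nu>)) = 1" "factor \<tau> \<noteq> 0" if "0 < Im \<tau>" for \<tau>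
    using J0[OF that] by (simp_all add: factor_def powr_def exp_add[symmetric] ring_distribs)
  have T: "theta_vec \<nu> N \<tau> \<in> carrier_vec r" for \<tau> by (simp add: r_def)
  have M_theta: "theta_vec \<nu> N (moebius_map a b c d \<tau>) = factor \<tau> \<cdot>\<^sub>v (M *\<^sub>v theta_vec \<nu> N \<tau>)" if \<tau>: "0 < Im \<tau>" for \<tau>
  proof -
    let ?v = "theta_vec \<nu> N (moebius_map a b c d \<tau>)"
    let ?j = "cocycle_base c d \<tau> powr of_real (- (1/2 + real \<nu>))"
    have "factor \<tau> \<cdot>\<^sub>v (M *\<^sub>v theta_vec \<nu> N \<tau>) = factor \<tau> \<cdot>\<^sub>v (M *\<^sub>v (?j \<cdot>\<^sub>v (M' *\<^sub>v ?v)))"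
      using theta[OF \<tau>] by (rule arg_cong)
    also have "M *\<^sub>v (?j \<cdot>\<^sub>v (M' *\<^sub>v ?v)) = ?j \<cdot>\<^sub>v (M *\<^sub>v (M' *\<^sub>v ?v))"
      by (rule mult_mat_vec[OF M(1) mult_mat_vec_carrier[OF M(2) T]])
    also have "M *\<^sub>v (M' *\<^sub>v ?v) = (M * M') *\<^sub>v ?v" by (rule assoc_mult_mat_vec[OF M(1,2) T, symmetric])
    also have "(M * M') *\<^sub>v ?v = ?v" unfolding M(3) by (rule one_mult_mat_vec[OF T])
    also have "factor \<tau> \<cdot>\<^sub>v (?j \<cdot>\<^sub>v ?v) = ?v" unfolding smult_smult_assoc factor(1)[OF \<tau>] by simp
    finally show ?thesis ..
  qed
  have multiplier: "theta_multiplier \<nu> N \<gamma> = M"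
    unfolding theta_multiplier_def
  proof (rule the_equality)
    have "invertible_mat M"
      unfolding invertible_mat_def inverts_mat_def using M by auto
    then show "M \<in> carrier_mat (theta_dim \<nu> N) (theta_dim \<nu> N) \<and> invertible_mat M \<and>
        (\<forall>\<tau>\<in>upper_half_plane. theta_vec \<nu> N (moebius_action \<gamma> \<tau>) =
             (automorphy_base \<gamma> \<tau> powr of_real (1/2 + real \<nu>)) \<cdot>\<^sub>v (M *\<^sub>v theta_vec \<nu> N \<tau>))"
      using M(1) M_theta by (simp add: upper_half_plane_iff J m factor_def r_def)
    fix L assume L: "L \<in> carrier_mat (theta_dim \<nu> N) (theta_dim \<nu> N) \<and> invertible_mat L \<and>
        (\<forall>\<tau>\<in>upper_half_plane. theta_vec \<nu> N (moebius_action \<gamma> \<tau>) =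
             (automorphy_base \<gamma> \<tau> powr of_real (1/2 + real \<nu>)) \<cdot>\<^sub>v (L *\<^sub>v theta_vec \<nu> N \<tau>))"
    show "L = M"
    proof (rule theta_vec_cancel[OF N assms(2)])
      show "L \<in> carrier_mat (theta_dim \<nu> N) (theta_dim \<nu> N)" "M \<in> carrier_mat (theta_dim \<nu> N) (theta_dim \<nu> N)"
        using L M(1) by (simp_all add: r_def)
      fix \<tau> :: complex assume \<tau>: "0 < Im \<tau>"
      have "factor \<tau> \<cdot>\<^sub>v (L *\<^sub>v theta_vec \<nu> N \<tau>) = factor \<tau> \<cdot>\<^sub>v (M *\<^sub>v theta_vec \<nu> N \<tau>)"
        using L M_theta[OF \<tau>] \<tau> by (simp add: upper_half_plane_iff J m factor_def)
      then have "inverse (factor \<tau>) \<cdot>\<^sub>v (factor \<tau> \<cdot>\<^sub>v (L *\<^sub>v theta_vec \<nu> N \<tau>)) = inverse (factor \<tau>) \<cdot>\<^sub>v (factor \<tau> \<cdot>\<^sub>v (M *\<^sub>v theta_vec \<nu> N \<tau>))"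
        by (rule arg_cong)
      then show "L *\<^sub>v theta_vec \<nu> N \<tau> = M *\<^sub>v theta_vec \<nu> N \<tau>"
        using factor(2)[OF \<tau>] by (simp add: smult_smult_assoc)
    qed
  qed
  have inv: "the (mat_inverse (theta_multiplier \<nu> N \<gamma>)) = M'"
    unfolding multiplier by (rule mat_inverse_eq[OF M])
  have domain: "upper_half_plane \<union> slit_domain \<gamma> = extension_domain c d"
    by (auto simp: upper_half_plane_def slit_domain_def extension_domain_def J)
  show "\<exists>g. holomorphic_vec_on (theta_dim \<nu> N) g (upper_half_plane \<union> slit_domain \<gamma>) \<and>
        (\<forall>\<tau>\<in>upper_half_plane. g \<tau> = modular_cocycle (3/2 - real \<nu>) (theta_multiplier \<nu> N) (EI_vec \<nu> N) \<gamma> \<tau>)"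
  proof (intro exI conjI ballI)
    show "holomorphic_vec_on (theta_dim \<nu> N) g (upper_half_plane \<union> slit_domain \<gamma>)"
      unfolding domain using g by (simp add: r_def)
    fix \<tau> assume "\<tau> \<in> upper_half_plane"
    then have \<tau>: "0 < Im \<tau>" by (simp add: upper_half_plane_iff)
    have "\<tau> \<in> extension_domain c d" using \<tau> by (simp add: extension_domain_def)
    then have gd: "g \<tau> \<in> carrier_vec r" using g by (simp add: holomorphic_vec_on_def)
    have "modular_cocycle (3/2 - real \<nu>) (theta_multiplier \<nu> N) (EI_vec \<nu> N) \<gamma> \<tau>
       = (EI_vec \<nu> N \<tau> + g \<tau>) - EI_vec \<nu> N \<tau>"
      unfolding modular_cocycle_def inv J m EI[OF \<tau>] ..
    also have "\<dots> = g \<tau>"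
      using gd by (intro eq_vecI) (auto simp: EI_vec_def r_def)
    finally show "g \<tau> = modular_cocycle (3/2 - real \<nu>) (theta_multiplier \<nu> N) (EI_vec \<nu> N) \<gamma> \<tau>" ..
  qed
qed

end
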